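(* Let $p_1,\dots,p_k$ be distinct points of $\mathbb P^n$ with $x_{n+1}\ne0$, and for $1\le u\le k$ let $\mathfrak Z(u)$ be a zero-dimensional scheme of degree $s_u$ concentrated at $p_u$, with local socle degree $\alpha(u)=\alpha(\mathfrak Z(u))$. Let $\mathfrak Z=\bigcup_{u=1}^k\mathfrak Z(u)$, let $I_{\mathfrak Z},I(1),\dots,I(k)$ be the saturated ideals defining $\mathfrak Z,\mathfrak Z(1),\dots,\mathfrak Z(k)$, and let $L,L(1),\dots,L(k)\subset\Gamma$ be their respective global inverse systems. Denote the regularity degree of $\mathfrak Z$ by $\sigma$, and that of each $\mathfrak Z(u)$ by $\sigma(u)$, and set $$\mathfrak Z'(u)=\operatorname{Proj}\Bigl(R/\bigl(m_{p_u}^{\alpha(u)+1}\cap\bigcap_{v\ne u}I(v)\bigr)\Bigr).$$ Then: (i) $L=L(1)+\dots+L(k)$. (ii) When $i\ge\sigma-1$, then $L_i=L(1)_i\oplus\dots\oplus L(k)_i$, and $I(1)_i,\dots,I(k)_i$ intersect properly in $R_i$. (iii) $L(u)_i\subset L_i\cap\bigl(\Gamma_{\alpha(u)}\cdot L_{p_u}^{[i-\alpha(u)]}\bigr)$, with equality for $$i\ \ge\ \min\bigl\{i:\ \dim_k\bigl(L_i\cap(\Gamma_{\alpha(u)}\cdot L_{p_u}^{[i-\alpha(u)]})\bigr)=s_u\bigr\}.$$ Certainly there is equality for $i\ge\tau(\mathfrak Z'(u))$. Also $L(u)_i=R_{j-i}\circ L(u)_j$ if $i\le j$ and $j\ge\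sigma(u)$.
   Context: The base field $k$ is algebraically closed (or all support points are rational), and its characteristic is $0$ or larger than the degree of every form considered. $R=k[x_1,\dots,x_{n+1}]$ is the coordinate ring of $\mathbb P^n$; $\Gamma=k_{DP}[X_1,\dots,X_{n+1}]$ is the divided power ring with product $X^{[U]}X^{[V]}=\binom{U+V}{U}X^{[U+V]}$, on which $R$ acts by contraction $x^K\circ X^{[U]}=X^{[U-K]}$ ($0$ if an exponent is negative). The global inverse system of a graded ideal $I$ is $I^{-1}=\bigoplus_j\{F\in\Gamma_j:h\circ F=0\ \forall h\in I_j\}$. For a zero-dimensional scheme $\mathfrak Y\subset\mathbb P^n$ of degree $s$ with saturated ideal $I_{\mathfrak Y}$: $\tau(\mathfrak Y)=\min\{i:\dim_k(R/I_{\mathfrak Y})_i=s\}$ and the (Castelnuovo–Mumford) regularity degree is $\sigma(\mathfrak Y)=\tau(\mathfrak Y)+1$. If $\mathfrak Y$ is concentrated at a single point, $\alpha(\mathfrak Y)$ is the socle degree of its Artinian local ring, i.e. the largest $i$ with $\mathfrak m^i\ne0$. For $p=(a_1:\dots:a_n:1)$, $m_p=(x_1-a_1x_{n+1},\dots,x_n-a_nx_{n+1})\subset R$ is the homogeneous ideal of $p$, $L_p=a_1X_1+\dots+a_nX_n+X_{n+1}$, and $L_p^{[m]}=\sum_{|U|=m}a^UX^{[U]}$ (with $a_{n+1}=1$). The expression $\Gamma_\alpha\cdot L_p^{[i-\alpha]}$ is interpreted as $\Gamma_i$ when $i\le\alpha$. Subspaces of a finite-dimensional vector space intersect properly if the codimension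 of their intersection is the sum of their codimensions.
   Formalization: In (iii) the minimum is taken over those i for which the dimension equals s_u both in degree i and in degree max(i, α(u)); as printed the claim fails when the minimum is below α(u), e.g. for (y, x³) together with (x, y−z) in the plane. *)

theory Defs
  imports Complex_Main "HOL-Library.FuncSet" "HOL-Library.Poly_Mapping"
begin

section \<open>The coordinate ring and the divided power ring\<close>

text \<open>
  The variables are indexed by a finite type \<open>'v\<close> with \<open>n + 1\<close> elements; one index \<open>z\<close> is
  singled out and plays the role of the last variable.  An exponent vector is a term of type
  \<open>'v \<Rightarrow>\<^sub>0 nat\<close>.  The ring \<open>R\<close> and the divided power ring \<open>\<Gamma>\<close> have the same underlying graded
  vector space; the monomial basis element \<open>Poly_Mapping.single U 1\<close> is read as \<open>x\<^sup>U\<close> in \<open>R\<close> and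
  as \<open>X\<^bsup>[U]\<^esup>\<close> in \<open>\<Gamma>\<close>.  The product \<open>*\<close> of the library is that of \<open>R\<close>; the product of \<open>\<Gamma>\<close> is
  \<open>dp_mult\<close>.
\<close>

type_synonym ('v, 'a) mpoly = "('v \<Rightarrow>\<^sub>0 nat) \<Rightarrow>\<^sub>0 'a"
type_synonym ('v, 'a) dpoly = "('v \<Rightarrow>\<^sub>0 nat) \<Rightarrow>\<^sub>0 'a"

definition scale :: "'a::field \<Rightarrow> ('v, 'a) mpoly \<Rightarrow> ('v, 'a) mpoly"
  where "scale c F = Poly_Mapping.single 0 c * F"

interpretation vs: vector_space "scale :: 'a::field \<Rightarrow> ('v, 'a) mpoly \<Rightarrow> ('v, 'a) mpoly"
proof
  fix c d :: 'a and F G :: "('v, 'a) mpoly"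
  show "scale c (F + G) = scale c F + scale c G"
    by (simp add: scale_def distrib_left)
  show "scale (c + d) F = scale c F + scale d F"
    by (simp add: scale_def single_add distrib_right)
  show "scale c (scale d F) = scale (c * d) F"
    by (simp add: scale_def mult.assoc [symmetric] mult_single)
  show "scale 1 F = F"
    by (simp add: scale_def)
qed

text \<open>\<open>ideal.subspace I\<close> says that \<open>I\<close> is an ideal, \<open>ideal.span B\<close> is the ideal generated by \<open>B\<close>.\<close>

interpretation ideal: module "(*) :: 'r::comm_ring_1 \<Rightarrow> 'r \<Rightarrow> 'r"
  by standard (simp_all add: algebra_simps)

definition mdeg :: "('v::finite \<Rightarrow>\<^sub>0 nat) \<Rightarrow> nat"
  where "mdeg U = (\<Sum>v\<in>UNIV. Poly_Mapping.lookup U v)"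

definition forms :: "nat \<Rightarrow> ('v::finite, 'a::field) mpoly set"
  where "forms d = {F. \<forall>U\<in>Poly_Mapping.keys F. mdeg U = d}"

definition component :: "nat \<Rightarrow> ('v::finite, 'a::field) mpoly \<Rightarrow> ('v, 'a) mpoly"
  where "component d F = (\<Sum>U\<in>{U\<in>Poly_Mapping.keys F. mdeg U = d}. Poly_Mapping.single U (Poly_Mapping.lookup F U))"

definition var :: "'v \<Rightarrow> ('v, 'a::field) mpoly"
  where "var v = Poly_Mapping.single (Poly_Mapping.single v 1) 1"

definition dp_mult :: "('v::finite, 'a::field) dpoly \<Rightarrow> ('v, 'a) dpoly \<Rightarrow> ('v, 'a) dpoly"
  where "dp_mult F G = (\<Sum>U\<in>Poly_Mapping.keys F. \<Sum>V\<in>Poly_Mapping.keys G.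
    Poly_Mapping.single (U + V)
      (of_nat (\<Prod>v\<in>UNIV. Poly_Mapping.lookup (U + V) v choose Poly_Mapping.lookup U v) * Poly_Mapping.lookup F U * Poly_Mapping.lookup G V))"

definition contract :: "('v::finite, 'a::field) mpoly \<Rightarrow> ('v, 'a) dpoly \<Rightarrow> ('v, 'a) dpoly"
  where "contract h F = (\<Sum>K\<in>Poly_Mapping.keys h. \<Sum>U\<in>Poly_Mapping.keys F.
    if \<forall>v. Poly_Mapping.lookup K v \<le> Poly_Mapping.lookup U v
    then Poly_Mapping.single (U - K) (Poly_Mapping.lookup h K * Poly_Mapping.lookup F U) else 0)"

lemma dp_mult_monomials:
  "dp_mult (Poly_Mapping.single U 1) (Poly_Mapping.single V (1::'a::field)) =
    Poly_Mapping.single (U + V) (of_nat (\<Prod>v\<in>UNIV. Poly_Mapping.lookup (U + V) v choose Poly_Mapping.lookup U v))"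
  by (simp add: dp_mult_def)

lemma contract_monomials:
  "contract (Poly_Mapping.single K 1) (Poly_Mapping.single U (1::'a::field)) =
    (if \<forall>v. Poly_Mapping.lookup K v \<le> Poly_Mapping.lookup U v then Poly_Mapping.single (U - K) 1 else 0)"
  apply (simp only: contract_def keys_single one_neq_zero if_False)
  apply (simp only: sum.insert finite.emptyI empty_iff not_False_eq_True sum.empty add_0_right lookup_single_eq mult_1_left)
  done


lemma finite_mdeg: "finite {U :: 'v::finite \<Rightarrow>\<^sub>0 nat. mdeg U = d}"
proof -
  have "Poly_Mapping.lookup U v \<le> d" if "mdeg U = d" for U :: "'v \<Rightarrow>\<^sub>0 nat" and v
    using that member_le_sum [of v UNIV "Poly_Mapping.lookup U"] by (simp add: mdeg_def)
  then have "Poly_Mapping.lookup ` {U :: 'v \<Rightarrow>\<^sub>0 nat. mdeg U = d} \<subseteq> (\<Pi>\<^sub>E v\<in>UNIV. {..d})"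
    by (auto simp: PiE_def)
  moreover have "finite ((\<Pi>\<^sub>E v\<in>UNIV. {..d}) :: ('v \<Rightarrow> nat) set)"
    by (intro finite_PiE) auto
  ultimately have "finite (Poly_Mapping.lookup ` {U :: 'v \<Rightarrow>\<^sub>0 nat. mdeg U = d})"
    by (rule finite_subset)
  then show ?thesis
    apply (rule finite_imageD)
    by (simp add: inj_on_def poly_mapping.lookup_inject)
qed


section \<open>Linear algebra\<close>

definition codim :: "('v, 'a::field) mpoly set \<Rightarrow> ('v, 'a) mpoly set \<Rightarrow> nat"
  where "codim V W = vs.dim V - vs.dim W"

definition subspace_sum :: "'i set \<Rightarrow> ('i \<Rightarrow> ('v, 'a::field) mpoly set) \<Rightarrow> ('v, 'a) mpoly set"
  where "subspace_sum A W = {\<Sum>u\<in>A. F u | F. \<forall>u\<in>A. F u \<in> W u}"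

definition is_direct_sum ::
  "('v, 'a::field) mpoly set \<Rightarrow> 'i set \<Rightarrow> ('i \<Rightarrow> ('v, 'a) mpoly set) \<Rightarrow> bool"
  where "is_direct_sum V A W \<longleftrightarrow> V = subspace_sum A W \<and>
    (\<forall>F. (\<forall>u\<in>A. F u \<in> W u) \<and> (\<Sum>u\<in>A. F u) = 0 \<longrightarrow> (\<forall>u\<in>A. F u = 0))"

text \<open>Properness of the intersection of the subspaces \<open>W u\<close> of the ambient space \<open>V\<close>.\<close>

definition intersect_properly ::
  "('v, 'a::field) mpoly set \<Rightarrow> 'i set \<Rightarrow> ('i \<Rightarrow> ('v, 'a) mpoly set) \<Rightarrow> bool"
  where "intersect_properly V A W \<longleftrightarrow>
    codim V (V \<inter> (\<Inter>u\<in>A. W u)) = (\<Sum>u\<in>A. codim V (W u))"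


section \<open>Ideals and zero-dimensional schemes\<close>

text \<open>
  Closed subschemes of projective space are represented by their saturated homogeneous ideals.
  The union of schemes corresponds to the intersection of the ideals, and the saturated ideal
  of \<open>Proj (R/J)\<close> is \<open>saturation J\<close>.
\<close>

definition homogeneous_ideal :: "('v::finite, 'a::field) mpoly set \<Rightarrow> bool"
  where "homogeneous_ideal I \<longleftrightarrow> ideal.subspace I \<and> (\<forall>f\<in>I. \<forall>d. component d f \<in> I)"

definition saturation :: "('v::finite, 'a::field) mpoly set \<Rightarrow> ('v, 'a) mpoly set"
  where "saturation I = {f. \<exists>N. \<forall>g\<in>forms N. g * f \<in> I}"

definition radical :: "'r::comm_ring_1 set \<Rightarrow> 'r set"
  where "radical I = {f. \<exists>N. f ^ N \<in> I}"

primrec ideal_pow :: "'r::comm_ring_1 set \<Rightarrow> nat \<Rightarrow> 'r set"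
  where
    "ideal_pow I 0 = UNIV"
  | "ideal_pow I (Suc m) = ideal.span {f * g | f g. f \<in> I \<and> g \<in> ideal_pow I m}"

text \<open>\<open>hilb I i\<close> is the dimension of \<open>(R/I)\<^sub>i = R\<^sub>i / I\<^sub>i\<close>.\<close>

definition hilb :: "('v::finite, 'a::field) mpoly set \<Rightarrow> nat \<Rightarrow> nat"
  where "hilb I i = codim (forms i) (I \<inter> forms i)"

text \<open>Dimension zero means that the Hilbert polynomial is a nonzero constant, the degree.\<close>

definition zero_dim_scheme :: "('v::finite, 'a::field) mpoly set \<Rightarrow> bool"
  where "zero_dim_scheme I \<longleftrightarrow> homogeneous_ideal I \<and> saturation I = I \<and>
    (\<exists>s>0. eventually (\<lambda>i. hilb I i = s) sequentially)"

definition scheme_degree :: "('v::finite, 'a::field) mpoly set \<Rightarrow> nat"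
  where "scheme_degree I = (THE s. eventually (\<lambda>i. hilb I i = s) sequentially)"

definition tau :: "('v::finite, 'a::field) mpoly set \<Rightarrow> nat"
  where "tau I = (LEAST i. hilb I i = scheme_degree I)"

definition regularity_degree :: "('v::finite, 'a::field) mpoly set \<Rightarrow> nat"
  where "regularity_degree I = tau I + 1"

text \<open>
  A point \<open>p\<close> with nonzero \<open>z\<close>-coordinate is given by its coordinate vector \<open>a\<close>, normalised by
  \<open>a z = 1\<close>.  (The generator for \<open>j = z\<close> below is then \<open>0\<close>.)
\<close>

definition point_ideal :: "'v \<Rightarrow> ('v \<Rightarrow> 'a) \<Rightarrow> ('v::finite, 'a::field) mpoly set"
  where "point_ideal z a = ideal.span {var j - scale (a j) (var z) | j. True}"

text \<open>
  The scheme is concentrated at \<open>p\<close> iff its reduced subscheme is \<open>p\<close>.  Since this compares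
  ideals and not zero sets, it is the right condition over every base field, and it forces the
  support to be rational.
\<close>

definition concentrated_at ::
  "('v::finite, 'a::field) mpoly set \<Rightarrow> 'v \<Rightarrow> ('v \<Rightarrow> 'a) \<Rightarrow> bool"
  where "concentrated_at I z a \<longleftrightarrow> radical I = point_ideal z a"

text \<open>
  The local ring of the scheme at \<open>p\<close> consists of the fractions \<open>f/g\<close> of forms of \<open>R/I\<close> of equal
  degree with \<open>g \<notin> m\<^sub>p\<close>, and the \<open>i\<close>-th power of its maximal ideal consists of the fractions
  with \<open>f \<in> m\<^sub>p\<^sup>i\<close>.  The fraction \<open>f/g\<close> vanishes iff \<open>h * f \<in> I\<close> for some form \<open>h \<notin> m\<^sub>p\<close>.
  (Every \<open>f\<close> is the numerator of a fraction, with denominator a power of the variable \<open>z\<close>.)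
\<close>

definition local_max_pow_nonzero ::
  "('v::finite, 'a::field) mpoly set \<Rightarrow> 'v \<Rightarrow> ('v \<Rightarrow> 'a) \<Rightarrow> nat \<Rightarrow> bool"
  where "local_max_pow_nonzero I z a i \<longleftrightarrow>
    (\<exists>d. \<exists>f \<in> ideal_pow (point_ideal z a) i \<inter> forms d.
      \<forall>e. \<forall>h \<in> forms e - point_ideal z a. h * f \<notin> I)"

definition socle_degree ::
  "('v::finite, 'a::field) mpoly set \<Rightarrow> 'v \<Rightarrow> ('v \<Rightarrow> 'a) \<Rightarrow> nat"
  where "socle_degree I z a = (GREATEST i. local_max_pow_nonzero I z a i)"


section \<open>Inverse systems\<close>

definition inverse_system :: "('v::finite, 'a::field) mpoly set \<Rightarrow> ('v, 'a) dpoly set"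
  where "inverse_system I = {F. \<forall>j. \<forall>h \<in> I \<inter> forms j. contract h (component j F) = 0}"

definition dp_linear_pow :: "('v::finite \<Rightarrow> 'a::field) \<Rightarrow> nat \<Rightarrow> ('v, 'a) dpoly"
  where "dp_linear_pow a m =
    (\<Sum>U | mdeg U = m. Poly_Mapping.single U (\<Prod>v\<in>UNIV. a v ^ Poly_Mapping.lookup U v))"

text \<open>
  The space \<open>\<Gamma>\<^sub>\<alpha> \<cdot> L\<^sub>p\<^bsup>[i - \<alpha>]\<^esup>\<close>, read as \<open>\<Gamma>\<^sub>i\<close> for \<open>i \<le> \<alpha>\<close>.

  Pitfall: because of this convention, the equality of dimensions
  \<open>dim (L\<^sub>i \<inter> \<Gamma>\<^sub>\<alpha> \<cdot> L\<^sub>p\<^bsup>[i - \<alpha>]\<^esup>) = s\<close> in one degree \<open>i < \<alpha>\<close> only says \<open>dim L\<^sub>i = s\<close>, which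
  may happen by accident and does not imply that the space is \<open>L(u)\<^sub>i\<close>.  Example: in the plane
  take the ideals \<open>(y, x\<^sup>3)\<close> at \<open>(0:0:1)\<close>, with \<open>s = 3\<close> and \<open>\<alpha> = 2\<close>, and \<open>(x, y - z)\<close>.  Then
  \<open>dim L\<^sub>1 = 3\<close> and \<open>dim L\<^sub>2 = 4\<close>, while \<open>dim L(1)\<^sub>1 = 2\<close> and \<open>dim L(1)\<^sub>2 = 3\<close>.  A threshold
  degree \<open>i < \<alpha>\<close> for the equality of the spaces therefore has to satisfy the equality of
  dimensions in degree \<open>\<alpha>\<close> as well, that is, in the degrees \<open>i\<close> and \<open>max i \<alpha>\<close>.
\<close>

definition dp_linear_multiples ::
  "nat \<Rightarrow> ('v::finite \<Rightarrow> 'a::field) \<Rightarrow> nat \<Rightarrow> ('v, 'a) dpoly set"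
  where "dp_linear_multiples \<alpha> a i =
    (if i \<le> \<alpha> then forms i else {dp_mult F (dp_linear_pow a (i - \<alpha>)) | F. F \<in> forms \<alpha>})"

text \<open>The standing assumption on the characteristic, for forms of degree \<open>d\<close>.\<close>

definition admissible_degree :: "'a::field itself \<Rightarrow> nat \<Rightarrow> bool"
  where "admissible_degree T d \<longleftrightarrow> CHAR('a) = 0 \<or> d < CHAR('a)"

end

theory Submission
  imports Defs
begin

text \<open>
  The monomials of degree \<open>i\<close> in \<open>R\<close> and in \<open>\<Gamma>\<close> are dual bases for the pairing
  \<open>\<langle>h, F\<rangle> = h \<circ> F\<close> of forms of degree \<open>i\<close>, and the part of degree \<open>i\<close> of the inverse system of \<open>I\<close>
  is the annihilator \<open>perp i I\<close> of \<open>I\<^sub>i\<close>.  Taking annihilators is an inclusion reversing involution on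
  the subspaces (\<open>perp_perp\<close>), and \<open>dim (perp i I) = dim (R/I)\<^sub>i\<close>.  Hence the annihilator of an
  intersection of ideals is the sum of the annihilators; this is assertion (i).

  The coordinate \<open>z\<close> vanishes at none of the points, so it is a nonzerodivisor modulo each ideal
  that occurs.  Dually, contraction by \<open>z\<close> maps \<open>perp (i + 1) I\<close> \<^emph>\<open>onto\<close> \<open>perp i I\<close>, which also yields
  the last part of (iii).  The Hilbert function is therefore nondecreasing, it is constant from
  \<open>tau I\<close> on, and contraction by \<open>z\<close> is injective from there on.

  For (ii) one has to show that a relation \<open>\<Sum>F\<^sub>u = 0\<close> with \<open>F\<^sub>u \<in> perp i (I u)\<close> is trivial.  In high degrees a
  form \<open>h\<close> that lies in \<open>I v\<close> for all \<open>v \<noteq> u\<close>, but does not vanish at the point \<open>p\<^sub>u\<close>, kills all terms except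
  \<open>F\<^sub>u\<close>, and its contraction is injective on the inverse system of \<open>I u\<close>.  In a degree
  \<open>i \<ge> tau (\<Inter>I)\<close> the relation is lifted along a power of \<open>z\<close>: the terms can be lifted by surjectivity,
  and the sum of the lifts is \<open>0\<close> by injectivity (\<open>independent_perps_from_tau\<close>).

  For (iii) let \<open>m\<close> be the ideal of the point and \<open>L\<close> its linear form.  In admissible degrees
  \<open>\<Gamma>\<^sub>\<alpha> \<cdot> L\<^bsup>[i - \<alpha>]\<^esup>\<close> is the inverse system of \<open>m\<^bsup>\<alpha> + 1\<^esup>\<close> (\<open>dp_linear_multiples_eq_perp\<close>): contraction by
  a variable is a derivation and the generators of \<open>m\<close> kill the powers of \<open>L\<close>, which gives one inclusion, and a
  comparison of dimensions gives the other.  The characteristic enters only there, through the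
  binomial coefficients that must not vanish for multiplication by \<open>L\<^bsup>[i - \<alpha>]\<^esup>\<close> to be injective.
  Since \<open>m\<^bsup>\<alpha> + 1\<^esup> \<subseteq> I u\<close> by definition of the socle degree, the inclusion in (iii) follows.  The
  equality for \<open>i \<ge> tau (IZ' u)\<close> is (ii), applied to the family in which \<open>I u\<close> is replaced by \<open>m\<^bsup>\<alpha> + 1\<^esup>\<close>.
  Finally, contraction by \<open>z\<close> is injective on the inverse system of \<open>m\<^bsup>\<alpha> + 1\<^esup>\<close> above degree
  \<open>\<alpha>\<close>, so from \<open>\<alpha>\<close> on the dimension of the intersection of \<open>perp i IZ\<close> with it does not increase with
  \<open>i\<close>; its eventual value is the degree of the scheme, and once it is attained it stays.  Below degree
  \<open>\<alpha>\<close> the space \<open>\<Gamma>\<^sub>\<alpha> \<cdot> L\<^bsup>[i - \<alpha>]\<^esup>\<close> is all of \<open>\<Gamma>\<^sub>i\<close>, and the equality is carried down from degree \<open>\<alpha>\<close> by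
  contraction with powers of \<open>z\<close>.
\<close>

section \<open>Linear algebra in finitely spanned subspaces\<close>

context vector_space
begin

lemma finite_basis_exists:
  assumes "V \<subseteq> span C" and "finite C"
  obtains B where "B \<subseteq> V" "finite B" "independent B" "V \<subseteq> span B" "card B = dim V"
proof -
  obtain B where B: "B \<subseteq> V" "independent B" "V \<subseteq> span B" "card B = dim V"
    using basis_exists by blast
  have "finite B"
    using independent_span_bound [OF assms(2) B(2)] B(1) assms(1) by blast
  then show thesis using that B by blast
qed

text \<open>
  This contains rank-nullity (\<open>W = 0\<close>) and the dimension formula for a sum of subspaces
  (\<open>f = id\<close>): a basis of the preimage of \<open>W\<close> in \<open>V\<close> is extended to a basis of \<open>V\<close>, and the images of the
  added vectors together with a basis of \<open>W\<close> form a basis of \<open>f V + W\<close>.  The ambient space may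
  have infinite dimension, so finiteness is stated as containment in the span of a finite set.
\<close>

lemma dim_image_plus_eq:
  assumes f: "Vector_Spaces.linear scale scale f" and V: "subspace V" and W: "subspace W"
    and VB: "V \<subseteq> span B" "finite B" and WC: "W \<subseteq> span C" "finite C"
  shows "dim V + dim W = dim {f v + w | v w. v \<in> V \<and> w \<in> W} + dim {v \<in> V. f v \<in> W}"
proof -
  interpret f: Vector_Spaces.linear scale scale f by (rule f)
  define K where "K = {v \<in> V. f v \<in> W}"
  have K: "subspace K"
    using V W by (auto simp: K_def subspace_def f.add f.scale f.zero)
  have "K \<subseteq> span B" using VB by (auto simp: K_def)
  then obtain B0 where B0: "B0 \<subseteq> K" "finite B0" "independent B0" "K \<subseteq> span B0" "card B0 = dim K"
    using VB finite_basis_exists by metis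
  obtain B1 where B1: "B0 \<subseteq> B1" "B1 \<subseteq> V" "independent B1" "V \<subseteq> span B1"
    using maximal_independent_subset_extend [of B0 V] B0 by (auto simp: K_def)
  have fin1: "finite B1"
    using independent_span_bound [OF VB(2) B1(3)] B1(2) VB(1) by blast
  obtain C1 where C1: "C1 \<subseteq> W" "finite C1" "independent C1" "W \<subseteq> span C1" "card C1 = dim W"
    using WC finite_basis_exists by metis
  have spanK: "span B0 = K"
    using B0 K by (simp add: span_subspace)
  \<comment> \<open>The images of the new basis vectors are independent modulo \<open>W\<close>.\<close>
  have zero: "h b = 0" if "(\<Sum>b\<in>B1 - B0. scale (h b) (f b)) \<in> W" "b \<in> B1 - B0" for h b
  proof -
    let ?x = "\<Sum>b\<in>B1 - B0. scale (h b) b"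
    have "f ?x \<in> W" using that(1) by (simp add: f.sum f.scale)
    moreover have "?x \<in> V"
      using B1(2) by (intro subspace_sum [OF V] subspace_scale [OF V]) auto
    ultimately have "?x \<in> span B0" by (simp add: spanK K_def)
    then obtain r where r: "?x = (\<Sum>b\<in>B0. scale (r b) b)"
      using B0(2) by (auto simp: span_finite)
    have "(\<Sum>b\<in>B1. scale (if b \<in> B0 then - r b else h b) b) =
        (\<Sum>b\<in>B0. scale (- r b) b) + ?x"
      using fin1 B1(1) by (subst sum.subset_diff [of B0 B1]) (auto intro!: sum.cong simp: add.commute)
    also have "\<dots> = 0" by (simp add: r sum_negf)
    finally have "(if b \<in> B0 then - r b else h b) = 0"
      using independentD [OF B1(3) fin1 subset_refl, where u = "\<lambda>b. if b \<in> B0 then - r b else h b"]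
        that(2) by blast
    then show ?thesis using that(2) by simp
  qed
  have inj: "inj_on f (B1 - B0)"
  proof (rule inj_onI, rule ccontr)
    fix b c assume *: "b \<in> B1 - B0" "c \<in> B1 - B0" "f b = f c" "b \<noteq> c"
    let ?h = "\<lambda>x. if x = b then 1 else if x = c then - 1 else 0"
    have "(\<Sum>x\<in>B1 - B0. scale (?h x) (f x)) = (\<Sum>x\<in>{b, c}. scale (?h x) (f x))"
      using * fin1 by (intro sum.mono_neutral_right) auto
    also have "\<dots> = 0" using * by simp
    finally have "(\<Sum>x\<in>B1 - B0. scale (?h x) (f x)) \<in> W" using subspace_0 [OF W] by metis
    from zero [OF this *(1)] show False by simp
  qed
  have disj: "C1 \<inter> f ` (B1 - B0) = {}"
  proof (rule ccontr)
    assume "C1 \<inter> f ` (B1 - B0) \<noteq> {}"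
    then obtain b where b: "b \<in> B1 - B0" "f b \<in> W" using C1(1) by blast
    let ?h = "\<lambda>x. if x = b then 1 else 0"
    have "(\<Sum>x\<in>B1 - B0. scale (?h x) (f x)) = (\<Sum>x\<in>{b}. scale (?h x) (f x))"
      using b fin1 by (intro sum.mono_neutral_right) auto
    then have "(\<Sum>x\<in>B1 - B0. scale (?h x) (f x)) \<in> W" using b by simp
    from zero [OF this b(1)] show False by simp
  qed
  let ?T = "C1 \<union> f ` (B1 - B0)"
  let ?S = "{f v + w | v w. v \<in> V \<and> w \<in> W}"
  have sub: "?T \<subseteq> ?S"
  proof
    fix x assume "x \<in> ?T"
    then show "x \<in> ?S"
    proof
      assume "x \<in> C1"
      then have "x = f 0 + x" "x \<in> W" using C1(1) by (auto simp: f.zero)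
      then show ?thesis using subspace_0 [OF V] by blast
    next
      assume "x \<in> f ` (B1 - B0)"
      then obtain b where "b \<in> V" "x = f b + 0" using B1(2) by auto
      then show ?thesis using subspace_0 [OF W] by blast
    qed
  qed
  have "independent ?T"
  proof (rule independent_if_scalars_zero)
    show "finite ?T" using C1(2) fin1 by simp
    fix g x assume eq: "(\<Sum>x\<in>?T. scale (g x) x) = 0" and x: "x \<in> ?T"
    have split: "(\<Sum>x\<in>C1. scale (g x) x) + (\<Sum>b\<in>B1 - B0. scale (g (f b)) (f b)) = 0"
      using eq C1(2) fin1 disj by (simp add: sum.union_disjoint sum.reindex [OF inj])
    have inW: "(\<Sum>x\<in>C1. scale (g x) x) \<in> W"
      using C1(1) by (intro subspace_sum [OF W] subspace_scale [OF W]) auto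
    have "(\<Sum>b\<in>B1 - B0. scale (g (f b)) (f b)) = - (\<Sum>x\<in>C1. scale (g x) x)"
      using split by (simp add: eq_neg_iff_add_eq_0 add.commute)
    then have z: "g (f b) = 0" if "b \<in> B1 - B0" for b
      using zero [of "\<lambda>b. g (f b)"] that subspace_neg [OF W inW] by simp
    then have "(\<Sum>x\<in>C1. scale (g x) x) = 0" using split by simp
    then have "g x = 0" if "x \<in> C1" for x
      using independentD [OF C1(3,2) subset_refl] that by blast
    then show "g x = 0" using x z by blast
  qed
  moreover have "?S \<subseteq> span ?T"
  proof
    fix x assume "x \<in> ?S"
    then obtain v w where vw: "x = f v + w" "v \<in> V" "w \<in> W" by blast
    then have "v \<in> span B1" using B1(4) by blast
    then obtain r where r: "v = (\<Sum>b\<in>B1. scale (r b) b)" using fin1 by (auto simp: span_finite)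
    have "f b \<in> span ?T" if "b \<in> B1" for b
    proof (cases "b \<in> B0")
      case True
      then have "f b \<in> span C1" using B0(1) C1(4) by (auto simp: K_def)
      then show ?thesis using span_mono [of C1 ?T] by blast
    next
      case False
      then show ?thesis using that by (intro span_base) auto
    qed
    then have "f v \<in> span ?T" by (simp add: r f.sum f.scale span_sum span_scale)
    moreover have "w \<in> span ?T" using vw(3) C1(4) span_mono [of C1 ?T] by blast
    ultimately show "x \<in> span ?T" by (simp add: vw(1) span_add)
  qed
  ultimately have "dim ?S = card ?T"
    using sub by (intro dim_unique) auto
  also have "\<dots> = dim W + card (B1 - B0)"
    using C1 fin1 disj by (simp add: card_Un_disjoint card_image [OF inj])
  finally have "dim ?S = dim W + card (B1 - B0)" .
  moreover have "card B1 = dim V"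
    using B1 by (intro basis_card_eq_dim) auto
  moreover have "card B1 = card B0 + card (B1 - B0)"
    using fin1 B1(1) B0(2) by (simp add: card_Diff_subset card_mono)
  ultimately show ?thesis using B0(5) by (simp add: K_def)
qed

lemma dim_subspace_mono:
  assumes "W \<subseteq> V" and "V \<subseteq> span B" "finite B"
  shows "dim W \<le> dim V"
proof -
  obtain B1 where "finite B1" "V \<subseteq> span B1" "card B1 = dim V"
    using assms(2,3) finite_basis_exists by metis
  then show ?thesis using dim_le_card [of W B1] assms(1) by simp
qed

lemma subspace_eqI_dim:
  assumes W: "subspace W" and V: "subspace V" and sub: "W \<subseteq> V" and fin: "V \<subseteq> span B" "finite B"
    and le: "dim V \<le> dim W"
  shows "W = V"
proof -
  have "W \<subseteq> span B" using sub fin by blast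
  then obtain B0 where B0: "B0 \<subseteq> W" "finite B0" "independent B0" "W \<subseteq> span B0" "card B0 = dim W"
    using fin finite_basis_exists by metis
  obtain B1 where B1: "B0 \<subseteq> B1" "B1 \<subseteq> V" "independent B1" "V \<subseteq> span B1"
    using maximal_independent_subset_extend [OF subset_trans [OF B0(1) sub] B0(3)] by blast
  have fin1: "finite B1"
    using independent_span_bound [OF fin(2) B1(3)] B1(2) fin(1) by blast
  have "card B1 = dim V" using B1 by (intro basis_card_eq_dim) auto
  then have "B0 = B1" using card_seteq [OF fin1 B1(1)] le B0(5) by simp
  then show ?thesis using B0(4) B1(2,4) sub W B0(1) span_minimal [of B0 W] by blast
qed

lemma dim_singleton_0: "dim {0} = 0"
proof -
  have "dim {0} = card {}"
    by (rule dim_unique [symmetric, THEN sym]) (auto simp: independent_empty)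
  then show ?thesis by simp
qed

lemma rank_nullity:
  assumes f: "Vector_Spaces.linear scale scale f" and V: "subspace V" and fin: "V \<subseteq> span B" "finite B"
  shows "dim V = dim (f ` V) + dim {v \<in> V. f v = 0}"
proof -
  have "{f v + w | v w. v \<in> V \<and> w \<in> {0}} = f ` V" by auto
  then show ?thesis
    using dim_image_plus_eq [OF f V subspace_single_0 fin, of "{}"] by (simp add: dim_singleton_0)
qed

lemma dim_image_inj:
  assumes f: "Vector_Spaces.linear scale scale f" and V: "subspace V" and fin: "V \<subseteq> span B" "finite B"
    and inj: "\<And>v. v \<in> V \<Longrightarrow> f v = 0 \<Longrightarrow> v = 0"
  shows "dim (f ` V) = dim V"
proof -
  interpret f: Vector_Spaces.linear scale scale f by (rule f)
  have "{v \<in> V. f v = 0} = {0}" using inj subspace_0 [OF V] by (auto simp: f.zero)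
  then show ?thesis using rank_nullity [OF f V fin] by (simp add: dim_singleton_0)
qed

lemma kernel_trivial_if_dim_image_ge:
  assumes f: "Vector_Spaces.linear scale scale f" and V: "subspace V" and fin: "V \<subseteq> span B" "finite B"
    and le: "dim V \<le> dim (f ` V)" and v: "v \<in> V" "f v = 0"
  shows "v = 0"
proof -
  interpret f: Vector_Spaces.linear scale scale f by (rule f)
  have K: "subspace {v \<in> V. f v = 0}"
    using V by (auto simp: subspace_def f.add f.scale f.zero)
  have "dim {v \<in> V. f v = 0} = 0" using rank_nullity [OF f V fin] le by simp
  then have "{0} = {v \<in> V. f v = 0}"
    using fin by (intro subspace_eqI_dim [OF _ K]) (auto simp: subspace_0 [OF V] f.zero)
  then show ?thesis using v by blast
qed

lemma dim_plus_eq: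
  assumes V: "subspace V" and W: "subspace W"
    and fin: "V \<subseteq> span B" "finite B" "W \<subseteq> span C" "finite C" and disj: "V \<inter> W = {0}"
  shows "dim {v + w | v w. v \<in> V \<and> w \<in> W} = dim V + dim W"
proof -
  have "{v \<in> V. v \<in> W} = {0}" using disj by blast
  then show ?thesis
    using dim_image_plus_eq [OF linear_id V W fin] by (simp add: dim_singleton_0)
qed

end

section \<open>Polynomials as sums of monomials\<close>

abbreviation lookup where "lookup \<equiv> Poly_Mapping.lookup"
abbreviation keys where "keys \<equiv> Poly_Mapping.keys"
abbreviation single where "single \<equiv> Poly_Mapping.single"

text \<open>
  As an instance of the module law for \<open>(*)\<close> this is associativity, oriented against
  \<open>mult.assoc\<close>; together they make the simplifier loop.
\<close>

declare ideal.scale_scale [simp del]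

lemma keys_iff: "U \<in> keys f \<longleftrightarrow> lookup f U \<noteq> 0"
  by (simp add: in_keys_iff)

lemma lookup_scale [simp]: "lookup (scale c F) U = c * lookup F U"
  by (simp add: scale_def mult_map_scale_conv_mult [symmetric] Poly_Mapping.map.rep_eq when_def)

lemma scale_single [simp]: "scale c (single U d) = single U (c * d)"
  by (simp add: scale_def mult_single)

lemma scale_mult_left: "scale c f * g = scale c (f * g)"
  unfolding scale_def by (rule mult.assoc)

lemma scale_mult_right: "f * scale c g = scale c (f * g)"
  unfolding scale_def by (rule mult.left_commute)

lemma sum_monomials:
  assumes "finite A" "keys f \<subseteq> A"
  shows "f = (\<Sum>K\<in>A. single K (lookup f K))"
proof (rule poly_mapping_eqI)
  fix U
  have "lookup (\<Sum>K\<in>A. single K (lookup f K)) U = (\<Sum>K\<in>A. if K = U then lookup f K else 0)"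
    by (simp add: lookup_sum lookup_single when_def)
  also have "\<dots> = lookup f U"
    using assms by (auto simp: in_keys_iff subset_iff)
  finally show "lookup f U = lookup (\<Sum>K\<in>A. single K (lookup f K)) U" by simp
qed

lemma poly_induct [case_names zero single add]:
  assumes "P 0" and "\<And>K c. P (single K c)" and "\<And>f g. P f \<Longrightarrow> P g \<Longrightarrow> P (f + g)"
  shows "P (f :: 'b \<Rightarrow>\<^sub>0 'c::comm_monoid_add)"
proof -
  have "P (\<Sum>K\<in>A. single K (lookup f K))" if "finite A" for A
    using that by induction (auto intro: assms)
  then have "P (\<Sum>K\<in>keys f. single K (lookup f K))" by simp
  then show ?thesis by (simp only: sum_monomials [OF finite_keys subset_refl, symmetric])
qed

text \<open>
  The operations of the coordinate ring and the divided power ring are defined by sums over the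
  supports of their arguments.  Enlarging the supports to a common finite set shows that such sums
  are additive.
\<close>

lemma sum_keys_superset:
  assumes "finite A" "keys f \<subseteq> A" "\<And>K. \<theta> K 0 = 0"
  shows "(\<Sum>K\<in>keys f. \<theta> K (lookup f K)) = (\<Sum>K\<in>A. \<theta> K (lookup f K))"
  using assms by (intro sum.mono_neutral_left) (auto simp: in_keys_iff)

lemma sum_keys_add:
  assumes "\<And>K. \<theta> K 0 = 0" "\<And>K c d. \<theta> K (c + d) = \<theta> K c + \<theta> K d"
  shows "(\<Sum>K\<in>keys (f + g). \<theta> K (lookup (f + g) K)) =
    (\<Sum>K\<in>keys f. \<theta> K (lookup f K)) + (\<Sum>K\<in>keys g. \<theta> K (lookup g K))"
proof -
  have fin: "finite (keys f \<union> keys g)" by simp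
  show ?thesis
    using sum_keys_superset [OF fin keys_add, of \<theta>] sum_keys_superset [OF fin Un_upper1, of \<theta>]
      sum_keys_superset [OF fin Un_upper2, of \<theta>]
    by (simp add: assms lookup_add sum.distrib)
qed

section \<open>Forms and homogeneous components\<close>

lemma mdeg_0 [simp]: "mdeg 0 = 0"
  by (simp add: mdeg_def)

lemma mdeg_add [simp]: "mdeg (U + V) = mdeg U + mdeg V"
  by (simp add: mdeg_def lookup_add sum.distrib)

lemma mdeg_single [simp]: "mdeg (single v n) = n"
  by (simp add: mdeg_def lookup_single when_def)

lemma mdeg_eq_0_iff: "mdeg U = 0 \<longleftrightarrow> U = 0"
  by (auto simp: mdeg_def intro!: poly_mapping_eqI)

lemma formsI: "(\<And>U. lookup F U \<noteq> 0 \<Longrightarrow> mdeg U = d) \<Longrightarrow> F \<in> forms d"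
  by (simp add: forms_def keys_iff)

lemma formsD: "F \<in> forms d \<Longrightarrow> lookup F U \<noteq> 0 \<Longrightarrow> mdeg U = d"
  by (simp add: forms_def keys_iff)

lemma lookup_forms: "F \<in> forms d \<Longrightarrow> mdeg U \<noteq> d \<Longrightarrow> lookup F U = 0"
  using formsD by blast

lemma subspace_forms: "vs.subspace (forms d)"
  by (auto simp: vs.subspace_def lookup_add intro!: formsI dest: formsD) (metis add_0 formsD)

lemma single_forms [simp]: "mdeg U = d \<Longrightarrow> single U c \<in> forms d"
  by (rule formsI) (auto simp: lookup_single when_def split: if_splits)

lemma var_forms [simp]: "var v \<in> forms 1" "var v \<in> forms (Suc 0)"
  by (simp_all add: var_def)

lemma mult_forms: "f \<in> forms d \<Longrightarrow> g \<in> forms e \<Longrightarrow> f * g \<in> forms (d + e)"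
  using keys_mult [of f g] by (fastforce simp: forms_def)

lemma one_forms: "1 \<in> forms 0"
  using single_forms [of 0 0 1] by simp

lemma power_forms: "f \<in> forms d \<Longrightarrow> f ^ n \<in> forms (d * n)"
  by (induction n) (auto intro: one_forms mult_forms)

lemma var_power_forms: "var v ^ n \<in> forms n"
  using power_forms [of "var v" 1 n] by simp

lemma forms_span:
  "(forms d :: ('v::finite, 'a::field) mpoly set) =
    vs.span ((\<lambda>U. single U 1) ` {U. mdeg U = d})" (is "?V = vs.span ?B")
proof
  show "?V \<subseteq> vs.span ?B"
  proof
    fix F assume F: "F \<in> ?V"
    have "F = (\<Sum>U\<in>keys F. scale (lookup F U) (single U 1))"
      using sum_monomials [of "keys F" F] by simp
    also have "\<dots> \<in> vs.span ?B"
      using F by (intro vs.span_sum vs.span_scale vs.span_base) (auto simp: forms_def)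
    finally show "F \<in> vs.span ?B" .
  qed
  show "vs.span ?B \<subseteq> ?V"
    by (intro vs.span_minimal subspace_forms) auto
qed

lemma forms_finite_span:
  obtains B :: "('v::finite, 'a::field) mpoly set" where "finite B" "forms d \<subseteq> vs.span B"
  by (rule that [of "(\<lambda>U. single U 1) ` {U. mdeg U = d}"]) (simp_all add: forms_span finite_mdeg)

lemma lookup_component: "lookup (component d F) U = (if mdeg U = d then lookup F U else 0)"
proof -
  have "lookup (component d F) U =
      (\<Sum>V\<in>{V\<in>keys F. mdeg V = d}. if V = U then lookup F V else 0)"
    by (simp add: component_def lookup_sum lookup_single when_def)
  also have "\<dots> = (if mdeg U = d then lookup F U else 0)"
    by (auto simp: in_keys_iff)
  finally show ?thesis .
qed

lemma component_forms [simp]: "component d F \<in> forms d"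
  by (rule formsI) (auto simp: lookup_component split: if_splits)

lemma component_id: "F \<in> forms d \<Longrightarrow> component d F = F"
  by (rule poly_mapping_eqI) (auto simp: lookup_component lookup_forms)

lemma component_other: "F \<in> forms e \<Longrightarrow> e \<noteq> d \<Longrightarrow> component d F = 0"
  by (rule poly_mapping_eqI) (auto simp: lookup_component lookup_forms)

lemma component_add: "component d (F + G) = component d F + component d G"
  by (rule poly_mapping_eqI) (auto simp: lookup_component lookup_add)

lemma component_0 [simp]: "component d 0 = 0"
  by (rule poly_mapping_eqI) (auto simp: lookup_component)

lemma component_sum: "component d (\<Sum>x\<in>A. F x) = (\<Sum>x\<in>A. component d (F x))"
  by (rule poly_mapping_eqI) (auto simp: lookup_component lookup_sum)

lemma sum_components:
  assumes "finite D" "mdeg ` keys F \<subseteq> D"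
  shows "F = (\<Sum>d\<in>D. component d F)"
proof (rule poly_mapping_eqI)
  fix U
  have "lookup (\<Sum>d\<in>D. component d F) U = (if mdeg U \<in> D then lookup F U else 0)"
    using assms(1) by (simp add: lookup_sum lookup_component)
  also have "\<dots> = lookup F U"
    using assms(2) by (auto simp: in_keys_iff image_subset_iff)
  finally show "lookup F U = lookup (\<Sum>d\<in>D. component d F) U" by simp
qed

lemma component_mult_form:
  assumes p: "p \<in> forms e"
  shows "component d (r * p) = (if e \<le> d then component (d - e) r * p else 0)"
proof (induction r rule: poly_induct)
  case (single K c)
  have 1: "single K c * p \<in> forms (mdeg K + e)" using p by (simp add: mult_forms)
  show ?case
  proof (cases "mdeg K + e = d")
    case True
    then show ?thesis using 1 by (auto simp: component_id)
  next
    case False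
    then have "e \<le> d \<Longrightarrow> component (d - e) (single K c) = 0"
      by (intro component_other [of _ "mdeg K"]) auto
    then show ?thesis using component_other [OF 1 False] by simp
  qed
qed (auto simp: component_add distrib_right)

section \<open>Contraction\<close>

lemma lookup_contract:
  fixes h :: "('v::finite, 'a::field) mpoly"
  shows "lookup (contract h F) V = (\<Sum>K\<in>keys h. lookup h K * lookup F (K + V))"
proof -
  have *: "(\<forall>v. lookup K v \<le> lookup U v) \<and> U - K = V \<longleftrightarrow> U = K + V" for K U :: "'v \<Rightarrow>\<^sub>0 nat"
  proof
    assume a: "(\<forall>v. lookup K v \<le> lookup U v) \<and> U - K = V"
    show "U = K + V"
    proof (rule poly_mapping_eqI)
      fix v
      have "lookup V v = lookup U v - lookup K v" using a by (auto simp: lookup_minus)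
      then show "lookup U v = lookup (K + V) v" using a by (auto simp: lookup_add)
    qed
  qed (auto simp: lookup_add)
  have "(\<Sum>U\<in>keys F. lookup (if \<forall>v. lookup K v \<le> lookup U v
      then single (U - K) (lookup h K * lookup F U) else 0) V) = lookup h K * lookup F (K + V)" for K
  proof -
    have "(\<Sum>U\<in>keys F. lookup (if \<forall>v. lookup K v \<le> lookup U v
        then single (U - K) (lookup h K * lookup F U) else 0) V) =
      (\<Sum>U\<in>keys F. if (\<forall>v. lookup K v \<le> lookup U v) \<and> U - K = V then lookup h K * lookup F U else 0)"
      by (intro sum.cong) (auto simp: lookup_single when_def)
    also have "\<dots> = (\<Sum>U\<in>keys F. if U = K + V then lookup h K * lookup F U else 0)"
      by (simp only: *)
    also have "\<dots> = lookup h K * lookup F (K + V)"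
      by (auto simp: in_keys_iff)
    finally show ?thesis .
  qed
  then show ?thesis by (simp add: contract_def lookup_sum)
qed

lemma contract_add_left: "contract (f + g) F = contract f F + contract g F"
proof (rule poly_mapping_eqI)
  fix V
  show "lookup (contract (f + g) F) V = lookup (contract f F + contract g F) V"
    using sum_keys_add [of "\<lambda>K c. c * lookup F (K + V)" f g]
    by (simp add: lookup_contract lookup_add [of "contract f F"] distrib_right)
qed

lemma contract_add_right: "contract f (F + G) = contract f F + contract f G"
  by (rule poly_mapping_eqI) (simp add: lookup_contract lookup_add distrib_left sum.distrib)

lemma contract_scale_right: "contract f (scale c F) = scale c (contract f F)"
  by (rule poly_mapping_eqI) (simp add: lookup_contract sum_distrib_left mult_ac)

lemma contract_0_left [simp]: "contract 0 F = 0"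
  by (rule poly_mapping_eqI) (simp add: lookup_contract)

lemma contract_0_right [simp]: "contract f 0 = 0"
  by (rule poly_mapping_eqI) (simp add: lookup_contract)

lemma lookup_contract_single [simp]:
  "lookup (contract (single K c) F) V = c * lookup F (K + V)"
  by (simp add: lookup_contract)

lemma contract_mult: "contract (f * g) F = contract f (contract g F)"
proof (induction f rule: poly_induct)
  case (single K c)
  show ?case
  proof (induction g rule: poly_induct)
    case (single L d)
    show ?case
      by (rule poly_mapping_eqI) (simp add: mult_single add.assoc add.left_commute)
  qed (simp_all add: distrib_left contract_add_left contract_add_right)
qed (simp_all add: distrib_right contract_add_left)

lemma contract_scale_left: "contract (scale c f) F = scale c (contract f F)"
proof -
  have "contract (single 0 c) G = scale c G" for G :: "('a, 'b) dpoly"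
    by (rule poly_mapping_eqI) simp
  then show ?thesis by (simp add: scale_def contract_mult)
qed

lemma contract_minus_left: "contract (f - g) F = contract f F - contract g F"
  using contract_add_left [of "f - g" g F] by simp

lemma contract_minus_right: "contract f (F - G) = contract f F - contract f G"
  using contract_add_right [of f "F - G" G] by simp

lemma contract_sum_left: "contract (\<Sum>x\<in>A. f x) F = (\<Sum>x\<in>A. contract (f x) F)"
  by (induction A rule: infinite_finite_induct) (simp_all add: contract_add_left)

lemma contract_sum_right: "contract f (\<Sum>x\<in>A. F x) = (\<Sum>x\<in>A. contract f (F x))"
  by (induction A rule: infinite_finite_induct) (simp_all add: contract_add_right)

lemma linear_contract: "Vector_Spaces.linear scale scale (contract h)"
  by unfold_locales (simp_all add: contract_add_right contract_scale_right)

lemma contract_1_left [simp]: "contract 1 F = F"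
  by (rule poly_mapping_eqI) (simp add: lookup_contract)

lemma contract_forms:
  assumes "h \<in> forms d" "F \<in> forms (d + i)"
  shows "contract h F \<in> forms i"
proof (rule formsI)
  fix V assume "lookup (contract h F) V \<noteq> 0"
  then obtain K where "lookup h K * lookup F (K + V) \<noteq> 0"
    unfolding lookup_contract by (meson sum.not_neutral_contains_not_neutral)
  then show "mdeg V = i" using assms formsD [of h d K] formsD [of F "d + i" "K + V"] by auto
qed

lemma contract_low_degree:
  assumes "h \<in> forms d" "F \<in> forms i" "i < d"
  shows "contract h F = 0"
proof (rule poly_mapping_eqI)
  fix V
  have "lookup h K * lookup F (K + V) = 0" for K
    using assms lookup_forms [of h d K] lookup_forms [of F i "K + V"] by (cases "mdeg K = d") auto
  then show "lookup (contract h F) V = lookup 0 V"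
    unfolding lookup_contract lookup_zero by (rule sum.neutral [OF ballI])
qed

section \<open>The pairing of forms of equal degree\<close>

text \<open>
  For forms of equal degree the contraction is a constant.  The definition makes sense, and is
  symmetric, for all polynomials.
\<close>

definition pairing :: "('v::finite, 'a::field) mpoly \<Rightarrow> ('v, 'a) dpoly \<Rightarrow> 'a"
  where "pairing h F = lookup (contract h F) 0"

lemma pairing_eq: "pairing h F = (\<Sum>K\<in>keys h. lookup h K * lookup F K)"
  by (simp add: pairing_def lookup_contract)

lemma pairing_commute: "pairing h F = pairing F h"
proof -
  have "(\<Sum>K\<in>keys h. lookup h K * lookup F K) = (\<Sum>K\<in>keys h \<union> keys F. lookup h K * lookup F K)"
    by (rule sum_keys_superset [where \<theta> = "\<lambda>K c. c * lookup F K"]) auto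
  also have "\<dots> = (\<Sum>K\<in>keys h \<union> keys F. lookup F K * lookup h K)"
    by (simp add: mult.commute)
  also have "\<dots> = (\<Sum>K\<in>keys F. lookup F K * lookup h K)"
    by (rule sum_keys_superset [where \<theta> = "\<lambda>K c. c * lookup h K", symmetric]) auto
  finally show ?thesis by (simp add: pairing_eq)
qed

lemma pairing_linear:
  "pairing (f + g) F = pairing f F + pairing g F"
  "pairing (scale c f) F = c * pairing f F"
  "pairing f (F + G) = pairing f F + pairing f G"
  "pairing f (F - G) = pairing f F - pairing f G"
  "pairing f (scale c F) = c * pairing f F"
  "pairing f 0 = 0" "pairing 0 F = 0"
  by (simp_all add: pairing_def contract_add_left contract_add_right contract_scale_left
      contract_scale_right lookup_add contract_minus_right lookup_minus)

lemma pairing_sum_right: "pairing f (\<Sum>x\<in>A. F x) = (\<Sum>x\<in>A. pairing f (F x))"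
  by (simp add: pairing_def contract_sum_right lookup_sum)

lemma pairing_mult: "pairing (f * g) F = pairing f (contract g F)"
  by (simp add: pairing_def contract_mult)

lemma pairing_single [simp]: "pairing (single U c) F = c * lookup F U"
  by (simp add: pairing_def)

lemma contract_eq_0_iff_pairing:
  assumes "h \<in> forms i" "F \<in> forms i"
  shows "contract h F = 0 \<longleftrightarrow> pairing h F = 0"
proof
  assume "pairing h F = 0"
  moreover have "lookup (contract h F) V = 0" if "V \<noteq> 0" for V
    using contract_forms [of h i F 0] assms that mdeg_eq_0_iff [of V] by (simp add: lookup_forms)
  ultimately show "contract h F = 0"
    by (intro poly_mapping_eqI) (metis lookup_zero pairing_def)
qed (simp add: pairing_def)

text \<open>
  Both arguments of the pairing have the same type, so \<open>perp i\<close> also denotes the annihilator in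
  \<open>R\<^sub>i\<close> of a subset of \<open>\<Gamma>\<^sub>i\<close>.  Elements of \<open>W\<close> of other degrees are ignored, which allows
  \<open>W\<close> to be an ideal.
\<close>

definition perp :: "nat \<Rightarrow> ('v::finite, 'a::field) mpoly set \<Rightarrow> ('v, 'a) dpoly set"
  where "perp i W = {F \<in> forms i. \<forall>h\<in>W \<inter> forms i. pairing h F = 0}"

lemma perp_subset_forms: "perp i W \<subseteq> forms i"
  by (auto simp: perp_def)

lemma subspace_perp: "vs.subspace (perp i W)"
  using subspace_forms [of i]
  by (auto simp: perp_def vs.subspace_def pairing_linear)

lemma inverse_system_iff: "F \<in> inverse_system I \<longleftrightarrow> (\<forall>j. component j F \<in> perp j I)"
proof -
  have "(\<forall>h\<in>I \<inter> forms j. contract h (component j F) = 0) \<longleftrightarrow>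
      (\<forall>h\<in>I \<inter> forms j. pairing h (component j F) = 0)" for j
    by (intro ball_cong refl contract_eq_0_iff_pairing) auto
  then show ?thesis by (simp add: inverse_system_def perp_def)
qed

lemma inverse_system_forms: "inverse_system I \<inter> forms i = perp i I"
proof -
  have "F \<in> inverse_system I \<longleftrightarrow> F \<in> perp i I" if F: "F \<in> forms i" for F
  proof -
    have "component j F \<in> perp j I \<longleftrightarrow> (j = i \<longrightarrow> F \<in> perp i I)" for j
      using component_id [OF F] component_other [OF F, of j] vs.subspace_0 [OF subspace_perp, of j I]
      by (cases "j = i") auto
    then show ?thesis by (simp add: inverse_system_iff)
  qed
  then show ?thesis using perp_subset_forms by blast
qed

lemma perp_finite_span:
  obtains B :: "('v::finite, 'a::field) mpoly set" where "finite B" "perp i W \<subseteq> vs.span B"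
  using forms_finite_span perp_subset_forms by (metis subset_trans)

lemma perp_antimono: "W \<subseteq> W' \<Longrightarrow> perp i W' \<subseteq> perp i W"
  by (auto simp: perp_def)

lemma perp_Int_forms: "perp i (W \<inter> forms i) = perp i W"
  by (auto simp: perp_def)

text \<open>
  A basis \<open>B0\<close> of \<open>W\<close> is extended to a basis \<open>B\<close> of the space of forms.  Every linear functional on this
  space is the pairing with a form, whose coefficients are the values of the functional on the
  monomials; applied to the coordinate functionals of \<open>B\<close>, this yields the forms \<open>\<Phi> b\<close>.
\<close>

lemma dual_basis:
  assumes W: "vs.subspace W" and sub: "W \<subseteq> forms i"
  obtains B0 B and \<Phi> :: "('v::finite, 'a::field) mpoly \<Rightarrow> ('v, 'a) dpoly" where
    "B0 \<subseteq> B" "finite B" "vs.independent B" "vs.span B = forms i" "vs.span B0 = W"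
    "\<And>b. \<Phi> b \<in> forms i"
    "\<And>g b. g \<in> forms i \<Longrightarrow> pairing g (\<Phi> b) = vs.representation B g b"
proof -
  obtain C :: "('v, 'a) mpoly set" where C: "finite C" "forms i \<subseteq> vs.span C"
    using forms_finite_span by blast
  obtain B0 where B0: "B0 \<subseteq> W" "vs.independent B0" "W \<subseteq> vs.span B0"
    using vs.basis_exists by metis
  obtain B where B: "B0 \<subseteq> B" "B \<subseteq> forms i" "vs.independent B" "forms i \<subseteq> vs.span B"
    using vs.maximal_independent_subset_extend [OF subset_trans [OF B0(1) sub] B0(2)] by blast
  have fin: "finite B"
    using vs.independent_span_bound [OF C(1) B(3)] B(2) C(2) by blast
  have span: "vs.span B = forms i" using vs.span_subspace [OF B(2,4) subspace_forms] .
  define \<Phi> :: "('v, 'a) mpoly \<Rightarrow> ('v, 'a) dpoly"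
    where "\<Phi> b = (\<Sum>U | mdeg U = i. single U (vs.representation B (single U 1) b))" for b
  have \<Phi>: "\<Phi> b \<in> forms i" for b
    unfolding \<Phi>_def by (intro vs.subspace_sum [OF subspace_forms]) auto
  have lk: "lookup (\<Phi> b) U = vs.representation B (single U 1) b" if "mdeg U = i" for b U
    using that by (simp add: \<Phi>_def lookup_sum lookup_single when_def finite_mdeg)
  have "pairing g (\<Phi> b) = vs.representation B g b" if g: "g \<in> forms i" for g b
  proof -
    have "vs.representation B g b =
        vs.representation B (\<Sum>U\<in>keys g. scale (lookup g U) (single U 1)) b"
      using sum_monomials [of "keys g" g] by simp
    also have "\<dots> = (\<Sum>U\<in>keys g. vs.representation B (scale (lookup g U) (single U 1)) b)"
      using g by (subst vs.representation_sum [OF B(3)]) (auto simp: span forms_def)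
    also have "\<dots> = (\<Sum>U\<in>keys g. lookup g U * vs.representation B (single U 1) b)"
      using g by (intro sum.cong refl, subst vs.representation_scale [OF B(3)]) (auto simp: span forms_def)
    also have "\<dots> = pairing g (\<Phi> b)"
      using g by (auto simp: pairing_eq lk forms_def intro!: sum.cong)
    finally show ?thesis by simp
  qed
  moreover have "vs.span B0 = W" using vs.span_subspace [OF B0(1,3) W] .
  ultimately show thesis using that B(1,3) fin span \<Phi> by blast
qed

text \<open>
  The forms dual to the basis vectors outside \<open>W\<close> annihilate \<open>W\<close>, so an element of the double
  annihilator has no coordinates outside \<open>W\<close>.
\<close>

lemma perp_perp:
  assumes W: "vs.subspace W" and sub: "W \<subseteq> forms i"
  shows "perp i (perp i W) = W"
proof
  show "W \<subseteq> perp i (perp i W)"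
  proof
    fix x assume "x \<in> W"
    then have "pairing h x = 0" if "h \<in> perp i W" for h
      using that sub pairing_commute [of h x] by (auto simp: perp_def)
    then show "x \<in> perp i (perp i W)"
      using sub \<open>x \<in> W\<close> by (auto simp: perp_def [of i "perp i W"])
  qed
  show "perp i (perp i W) \<subseteq> W"
  proof
    fix h assume h: "h \<in> perp i (perp i W)"
    obtain B0 B \<Phi> where B: "B0 \<subseteq> B" "finite B" "vs.independent B" "vs.span B = forms i" "vs.span B0 = W"
      "\<And>b. \<Phi> b \<in> forms i"
      "\<And>g b. g \<in> forms i \<Longrightarrow> pairing g (\<Phi> b) = vs.representation B g b"
      using dual_basis [OF W sub] by metis
    have hf: "h \<in> forms i" using h by (simp add: perp_def)
    have zero: "vs.representation B h b = 0" if "b \<in> B - B0" for b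
    proof -
      have "vs.representation B w b = 0" if "w \<in> W" for w
      proof -
        have "vs.representation B w = vs.representation B0 w"
          using that B by (intro vs.representation_extend) auto
        then show ?thesis using \<open>b \<in> B - B0\<close> vs.representation_ne_zero by fastforce
      qed
      then have "\<Phi> b \<in> perp i W" using B(6,7) by (auto simp: perp_def)
      then have "pairing (\<Phi> b) h = 0" using h B(6) by (auto simp: perp_def)
      then show ?thesis using B(7) [OF hf] by (simp add: pairing_commute)
    qed
    have "h = (\<Sum>b\<in>B. scale (vs.representation B h b) b)"
      using vs.sum_representation_eq [OF B(3) _ B(2) subset_refl] hf B(4) by simp
    also have "\<dots> = (\<Sum>b\<in>B0. scale (vs.representation B h b) b)"
      using B(1,2) zero by (intro sum.mono_neutral_right) auto
    also have "\<dots> \<in> vs.span B0" by (intro vs.span_sum vs.span_scale vs.span_base)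
    finally show "h \<in> W" using B(5) by simp
  qed
qed

text \<open>
  The forms dual to the basis vectors outside \<open>W\<close> are a basis of the annihilator.
\<close>

lemma dim_perp:
  fixes W :: "('v::finite, 'a::field) mpoly set"
  assumes W: "vs.subspace W" and sub: "W \<subseteq> forms i"
  shows "vs.dim (forms i :: ('v, 'a) mpoly set) = vs.dim W + vs.dim (perp i W)"
proof -
  obtain B0 B \<Phi> where B: "B0 \<subseteq> B" "finite B" "vs.independent B" "vs.span B = forms i" "vs.span B0 = W"
    "\<And>b. \<Phi> b \<in> forms i"
    "\<And>g b. g \<in> forms i \<Longrightarrow> pairing g (\<Phi> b) = vs.representation B g b"
    using dual_basis [OF W sub] by metis
  have Bf: "b \<in> forms i" if "b \<in> B" for b
    using that B(4) vs.span_base by blast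
  have delta: "pairing b (\<Phi> c) = (if b = c then 1 else 0)" if "b \<in> B" for b c
    using that B(3) by (simp add: B(7) Bf vs.representation_basis)
  have inj: "inj_on \<Phi> (B - B0)"
    by (rule inj_onI) (metis DiffD1 delta zero_neq_one)
  have perpI: "\<Phi> b \<in> perp i W" if "b \<in> B - B0" for b
  proof -
    have "pairing w (\<Phi> b) = 0" if "w \<in> W" for w
    proof -
      have "vs.representation B w = vs.representation B0 w"
        using that B by (intro vs.representation_extend) auto
      then show ?thesis
        using that sub \<open>b \<in> B - B0\<close> vs.representation_ne_zero [of B0 w b] by (auto simp: B(7) subset_iff)
    qed
    then show ?thesis using B(6) by (auto simp: perp_def)
  qed
  have "vs.independent (\<Phi> ` (B - B0))"
  proof (rule vs.independent_if_scalars_zero)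
    fix r x assume eq: "(\<Sum>x\<in>\<Phi> ` (B - B0). scale (r x) x) = 0" and "x \<in> \<Phi> ` (B - B0)"
    then obtain b where b: "b \<in> B - B0" "x = \<Phi> b" by blast
    have "0 = pairing b (\<Sum>c\<in>B - B0. scale (r (\<Phi> c)) (\<Phi> c))"
      using eq by (simp add: sum.reindex [OF inj] pairing_linear)
    also have "\<dots> = (\<Sum>c\<in>B - B0. if b = c then r (\<Phi> c) else 0)"
      using b by (auto simp: pairing_sum_right pairing_linear delta intro!: sum.cong)
    also have "\<dots> = r x" using b B(2) by simp
    finally show "r x = 0" by simp
  qed (use B(2) in simp)
  moreover have "perp i W \<subseteq> vs.span (\<Phi> ` (B - B0))"
  proof
    fix F assume F: "F \<in> perp i W"
    define G where "G = (\<Sum>c\<in>B - B0. scale (pairing c F) (\<Phi> c))"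
    have eqB: "pairing b F = pairing b G" if "b \<in> B" for b
    proof -
      have "pairing b G = (\<Sum>c\<in>B - B0. if b = c then pairing c F else 0)"
        using that by (auto simp: G_def pairing_sum_right pairing_linear delta intro!: sum.cong)
      also have "\<dots> = (if b \<in> B - B0 then pairing b F else 0)" using B(2) by simp
      also have "\<dots> = pairing b F"
        using that F Bf vs.span_base [of b B0] B(5) by (auto simp: perp_def)
      finally show ?thesis by simp
    qed
    have "pairing g F = pairing g G" if "g \<in> vs.span B" for g
      using that by (induction rule: vs.span_induct_alt) (simp_all add: pairing_linear eqB)
    then have "lookup F U = lookup G U" if "mdeg U = i" for U
      using pairing_single [of U 1] that B(4) by (metis mult_1 single_forms)
    moreover have "G \<in> forms i"
      unfolding G_def using B(6) by (intro vs.subspace_sum [OF subspace_forms] vs.subspace_scale [OF subspace_forms])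
    ultimately have "F = G"
      using F by (intro poly_mapping_eqI) (metis lookup_forms perp_subset_forms subsetD)
    also have "G \<in> vs.span (\<Phi> ` (B - B0))"
      unfolding G_def by (intro vs.span_sum vs.span_scale vs.span_base) auto
    finally show "F \<in> vs.span (\<Phi> ` (B - B0))" .
  qed
  ultimately have "vs.dim (perp i W) = card (\<Phi> ` (B - B0))"
    using perpI by (intro vs.dim_unique) auto
  also have "\<dots> = card (B - B0)" by (rule card_image [OF inj])
  finally have "vs.dim (perp i W) = card (B - B0)" .
  moreover have "vs.dim (forms i :: ('v, 'a) mpoly set) = card B"
    using vs.dim_span_eq_card_independent [OF B(3)] by (simp add: B(4))
  moreover have "vs.dim W = card B0"
    using vs.dim_span_eq_card_independent [OF vs.independent_mono [OF B(3,1)]] by (simp add: B(5))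
  moreover have "card B = card B0 + card (B - B0)"
    using B(1,2) by (simp add: card_Diff_subset card_mono finite_subset)
  ultimately show ?thesis by simp
qed

section \<open>Powers of ideals and homogeneous ideals\<close>

primrec products :: "'r::comm_ring_1 set \<Rightarrow> nat \<Rightarrow> 'r set"
  where
    "products S 0 = {1}"
  | "products S (Suc m) = {f * g | f g. f \<in> S \<and> g \<in> products S m}"

lemma ideal_span_mult:
  fixes S T :: "'r::comm_ring_1 set"
  assumes "f \<in> ideal.span S" "g \<in> ideal.span T" "\<And>s t. s \<in> S \<Longrightarrow> t \<in> T \<Longrightarrow> s * t \<in> ideal.span U"
  shows "f * g \<in> ideal.span U"
  using assms(1)
proof (induction rule: ideal.span_induct_alt)
  case (step c s f)
  have "s * g \<in> ideal.span U"
    using assms(2)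
  proof (induction rule: ideal.span_induct_alt)
    case (step d t g)
    have "s * (d * t + g) = d * (s * t) + s * g" by (simp add: algebra_simps)
    then show ?case
      using step assms(3) \<open>s \<in> S\<close> by (simp add: ideal.span_add ideal.span_scale)
  qed (simp add: ideal.span_zero)
  moreover have "(c * s + f) * g = c * (s * g) + f * g" by (simp add: algebra_simps)
  ultimately show ?case using step by (simp add: ideal.span_add ideal.span_scale)
qed (simp add: ideal.span_zero)

text \<open>
  Questions on \<open>m\<^sup>N\<close>, for \<open>m\<close> the ideal of a point, are thus reduced to products of \<open>N\<close> of the linear generators of \<open>m\<close>.
\<close>

lemma ideal_pow_span: "ideal_pow (ideal.span S) m = ideal.span (products S m)"
proof (induction m)
  case 0
  have "x \<in> ideal.span {1 :: 'a}" for x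
    using ideal.span_scale [OF ideal.span_base [of 1 "{1}"], of x] by simp
  then show ?case by auto
next
  case (Suc m)
  show ?case
  proof
    show "ideal_pow (ideal.span S) (Suc m) \<subseteq> ideal.span (products S (Suc m))"
    proof -
      have "f * g \<in> ideal.span (products S (Suc m))"
        if "f \<in> ideal.span S" "g \<in> ideal_pow (ideal.span S) m" for f g
        using ideal_span_mult [OF that(1), of g "products S m" "products S (Suc m)"] that(2) Suc
        by (auto intro: ideal.span_base)
      then show ?thesis unfolding ideal_pow.simps by (intro ideal.span_minimal) auto
    qed
    show "ideal.span (products S (Suc m)) \<subseteq> ideal_pow (ideal.span S) (Suc m)"
      unfolding ideal_pow.simps products.simps Suc
      by (intro ideal.span_mono) (auto intro: ideal.span_base)
  qed
qed

lemma ideal_pow_ideal: "ideal.subspace (ideal_pow I m)"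
  by (cases m) auto

lemma ideal_pow_mult: "x \<in> I \<Longrightarrow> f \<in> ideal_pow I m \<Longrightarrow> x * f \<in> ideal_pow I (Suc m)"
  by (auto intro: ideal.span_base)

lemma ideal_pow_decreasing: "ideal_pow I (Suc m) \<subseteq> ideal_pow I m"
proof -
  have "x * f \<in> ideal_pow I m" if "f \<in> ideal_pow I m" for x f
    using ideal.subspace_scale [OF ideal_pow_ideal that] .
  then show ?thesis
    unfolding ideal_pow.simps by (intro ideal.span_minimal ideal_pow_ideal) auto
qed

lemma ideal_pow_antimono: "m \<le> n \<Longrightarrow> ideal_pow I n \<subseteq> ideal_pow I m"
  by (rule lift_Suc_antimono_le [of "ideal_pow I"]) (use ideal_pow_decreasing in auto)

lemma power_in_ideal_pow: "x \<in> I \<Longrightarrow> x ^ n \<in> ideal_pow I n"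
  by (induction n) (auto intro: ideal.span_base)

lemma ideal_pow_1: "ideal.subspace I \<Longrightarrow> ideal_pow I 1 \<subseteq> I"
  unfolding One_nat_def ideal_pow.simps
  by (intro ideal.span_minimal) (clarsimp, metis ideal.subspace_scale mult.commute)

lemma ideal_imp_vs_subspace: "ideal.subspace I \<Longrightarrow> vs.subspace I"
  by (auto simp: ideal.subspace_def vs.subspace_def scale_def)

lemma homogeneous_idealD:
  assumes "homogeneous_ideal I"
  shows "ideal.subspace I" "f \<in> I \<Longrightarrow> component d f \<in> I"
  using assms by (auto simp: homogeneous_ideal_def)

lemma subspace_ideal_forms:
  "homogeneous_ideal I \<Longrightarrow> vs.subspace (I \<inter> forms i)"
  by (intro vs.subspace_inter subspace_forms ideal_imp_vs_subspace homogeneous_idealD)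

lemma in_ideal_if_components:
  assumes "ideal.subspace I" "\<And>d. component d f \<in> I"
  shows "f \<in> I"
proof -
  have "(\<Sum>d\<in>mdeg ` keys f. component d f) \<in> I"
    using assms by (intro ideal.subspace_sum)
  then show ?thesis using sum_components [of "mdeg ` keys f" f] by simp
qed

lemma homogeneous_span:
  assumes "P \<subseteq> forms e"
  shows "homogeneous_ideal (ideal.span P)"
  unfolding homogeneous_ideal_def
proof (intro conjI ballI allI)
  fix f d assume "f \<in> ideal.span P"
  then show "component d f \<in> ideal.span P"
  proof (induction rule: ideal.span_induct_alt)
    case (step c p f)
    have "component d (c * p) \<in> ideal.span P"
      using step(1) assms
      by (subst component_mult_form [of p e]) (auto simp: ideal.span_zero ideal.span_scale ideal.span_base)
    then show ?case using step by (simp add: component_add ideal.span_add)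
  qed (simp add: ideal.span_zero)
qed simp

lemma homogeneous_ideal_Inter:
  "(\<And>u. u \<in> A \<Longrightarrow> homogeneous_ideal (I u)) \<Longrightarrow> homogeneous_ideal (\<Inter>u\<in>A. I u)"
  by (auto simp: homogeneous_ideal_def intro: ideal.subspace_Int)

section \<open>The ideal of a point\<close>

abbreviation point_gen :: "'v \<Rightarrow> ('v \<Rightarrow> 'a) \<Rightarrow> 'v \<Rightarrow> ('v::finite, 'a::field) mpoly"
  where "point_gen z a j \<equiv> var j - scale (a j) (var z)"

lemma point_gen_forms: "point_gen z a j \<in> forms 1"
  by (intro vs.subspace_diff [OF subspace_forms] vs.subspace_scale [OF subspace_forms]) auto

lemma point_gen_in: "point_gen z a j \<in> point_ideal z a"
  by (auto simp: point_ideal_def intro: ideal.span_base)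

lemma point_ideal_ideal: "ideal.subspace (point_ideal z a)"
  by (simp add: point_ideal_def)

abbreviation gens :: "'v \<Rightarrow> ('v \<Rightarrow> 'a) \<Rightarrow> ('v::finite, 'a::field) mpoly set"
  where "gens z a \<equiv> {point_gen z a j | j. True}"

lemma products_forms: "S \<subseteq> forms 1 \<Longrightarrow> products S m \<subseteq> forms m"
proof (induction m)
  case (Suc m)
  then show ?case using mult_forms [of _ 1 _ m] by fastforce
qed (simp add: one_forms)

lemma gens_forms: "gens z a \<subseteq> forms 1"
  using point_gen_forms by auto

lemma point_pow_eq: "ideal_pow (point_ideal z a) m = ideal.span (products (gens z a) m)"
  unfolding point_ideal_def ideal_pow_span ..

lemma homogeneous_point_pow: "homogeneous_ideal (ideal_pow (point_ideal z a) m)"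
  unfolding point_pow_eq by (rule homogeneous_span [OF products_forms [OF gens_forms]])

lemma lookup_dp_linear_pow:
  "lookup (dp_linear_pow a m) U = (if mdeg U = m then (\<Prod>v\<in>UNIV. a v ^ lookup U v) else 0)"
proof -
  have "lookup (dp_linear_pow a m) U =
      (\<Sum>V | mdeg V = m. if U = V then (\<Prod>v\<in>UNIV. a v ^ lookup V v) else 0)"
    by (simp add: eq_commute dp_linear_pow_def lookup_sum lookup_single when_def)
  also have "\<dots> = (if mdeg U = m then (\<Prod>v\<in>UNIV. a v ^ lookup U v) else 0)"
    by (subst sum.delta' [OF finite_mdeg]) (simp add: eq_commute)
  finally show ?thesis .
qed

lemma dp_linear_pow_forms: "dp_linear_pow a m \<in> forms m"
  by (rule formsI) (auto simp: lookup_dp_linear_pow split: if_splits)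

lemma prod_power_add_single:
  fixes a :: "'v::finite \<Rightarrow> 'a::comm_monoid_mult"
  shows "(\<Prod>v\<in>UNIV. a v ^ lookup (single j 1 + U) v) = a j * (\<Prod>v\<in>UNIV. a v ^ lookup U v)"
proof -
  have "(\<Prod>v\<in>UNIV. a v ^ lookup (single j 1 + U) v) =
      (\<Prod>v\<in>UNIV. if v = j then a j else 1) * (\<Prod>v\<in>UNIV. a v ^ lookup U v)"
    unfolding prod.distrib [symmetric]
    by (intro prod.cong) (auto simp: lookup_add lookup_single)
  then show ?thesis by simp
qed

lemma contract_var_dp_linear_pow:
  "contract (var j) (dp_linear_pow a (Suc m)) = scale (a j) (dp_linear_pow a m)"
  by (rule poly_mapping_eqI)
    (use prod_power_add_single [of a j] in \<open>simp add: var_def lookup_dp_linear_pow\<close>)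

lemma contract_point_gen_dp_linear_pow:
  assumes "a z = 1"
  shows "contract (point_gen z a j) (dp_linear_pow a m) = 0"
proof (cases m)
  case 0
  then show ?thesis
    using contract_low_degree [OF point_gen_forms dp_linear_pow_forms] by auto
next
  case (Suc n)
  then show ?thesis
    by (simp add: contract_minus_left contract_scale_left contract_var_dp_linear_pow assms)
qed

lemma contract_point_ideal_dp_linear_pow:
  assumes "a z = 1" "f \<in> point_ideal z a"
  shows "contract f (dp_linear_pow a m) = 0"
  using assms(2) unfolding point_ideal_def
proof (induction rule: ideal.span_induct_alt)
  case (step c x y)
  then show ?case
    using contract_point_gen_dp_linear_pow [of a z, OF assms(1)]
    by (auto simp: contract_add_left contract_mult)
qed simp

text \<open>
  Contraction by an element of the ideal of the point kills the divided powers of its linear form,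
  whereas \<open>z\<^sup>n\<close> contracts \<open>L\<^bsup>[n]\<^esup>\<close> to \<open>1\<close>.
\<close>

lemma var_power_notin_point_ideal:
  assumes "a z = 1" "c \<noteq> 0"
  shows "scale c (var z ^ n) \<notin> point_ideal z a"
proof
  assume "scale c (var z ^ n) \<in> point_ideal z a"
  then have "contract (scale c (var z ^ n)) (dp_linear_pow a n) = 0"
    using contract_point_ideal_dp_linear_pow assms(1) by blast
  moreover have "contract (var z ^ k) (dp_linear_pow a (m + k)) = dp_linear_pow a m" for k m
    by (induction k arbitrary: m)
      (simp_all add: contract_mult contract_var_dp_linear_pow assms flip: add_Suc)
  from this [of n 0] have "contract (scale c (var z ^ n)) (dp_linear_pow a n) = scale c (dp_linear_pow a 0)"
    by (simp add: contract_scale_left)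
  ultimately have "scale c (dp_linear_pow a 0) = 0" by simp
  then have "c * lookup (dp_linear_pow a 0) 0 = 0" by (metis lookup_scale lookup_zero)
  then show False using assms(2) by (simp add: lookup_dp_linear_pow)
qed

lemma exponent_cases:
  obtains "lookup U v = 0" | V where "U = single v (1 :: nat) + V"
proof (cases "lookup U v = 0")
  case False
  have "U = single v 1 + (U - single v 1)"
    by (rule poly_mapping_eqI) (use False in \<open>auto simp: lookup_add lookup_minus lookup_single when_def\<close>)
  then show thesis using that(2) by blast
qed (use that in blast)

lemma monomial_split:
  fixes U :: "'v::finite \<Rightarrow>\<^sub>0 nat"
  assumes "mdeg U = Suc t"
  shows "\<exists>j V. U = single j 1 + V \<and> mdeg V = t"
proof -
  have "\<exists>j. lookup U j \<noteq> 0"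
    by (rule ccontr) (use assms in \<open>simp add: mdeg_def\<close>)
  then obtain j where j: "lookup U j \<noteq> 0" by blast
  obtain V where U: "U = single j 1 + V"
    by (cases U j rule: exponent_cases) (use j in simp)
  have "mdeg U = 1 + mdeg V" unfolding U by (simp only: mdeg_add mdeg_single)
  then show ?thesis using assms U by auto
qed

text \<open>
  Splitting off a variable \<open>x\<^sub>j = (x\<^sub>j - a\<^sub>j z) + a\<^sub>j z\<close>, the remaining monomial is \<open>z g + q\<close> with
  \<open>q\<close> in the previous power of the ideal.  Only the product of \<open>x\<^sub>j - a\<^sub>j z\<close> with \<open>q\<close> is not
  visibly divisible by \<open>z\<close>, and it lies in the next power.
\<close>

lemma monomial_mod_point_pow:
  fixes U :: "'v::finite \<Rightarrow>\<^sub>0 nat" and a :: "'v \<Rightarrow> 'a::field"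
  assumes "mdeg U = Suc t"
  shows "\<exists>g\<in>forms t. single U 1 - var z * g \<in> ideal_pow (point_ideal z a) (Suc t)"
  using assms
proof (induction t arbitrary: U)
  case 0
    then obtain j V where U: "U = single j 1 + V" "mdeg V = 0" using monomial_split [OF 0] by blast
    then have "U = single j 1" using mdeg_eq_0_iff [of V] by simp
    then have "single U 1 - var z * single 0 (a j) = point_gen z a j * 1"
      by (simp add: var_def scale_def mult.commute)
    then have "single U 1 - var z * single 0 (a j) \<in> ideal_pow (point_ideal z a) (Suc 0)"
      using ideal_pow_mult [OF point_gen_in, of 1 z a 0 j] by simp
    then show ?case by (intro bexI [of _ "single 0 (a j)"]) auto
  next
    case (Suc t)
    obtain j V where U: "U = single j 1 + V" "mdeg V = Suc t" using monomial_split [OF Suc.prems] by blast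
    obtain g where g: "g \<in> forms t" "single V 1 - var z * g \<in> ideal_pow (point_ideal z a) (Suc t)"
      using Suc.IH [OF U(2)] by blast
    define q where "q = single V 1 - var z * g"
    have qf: "q \<in> forms (Suc t)"
      unfolding q_def using U(2) mult_forms [OF var_forms(1) g(1), of z]
      by (intro vs.subspace_diff [OF subspace_forms]) auto
    define g' where "g' = var j * g + scale (a j) q"
    have "g' \<in> forms (Suc t)"
      unfolding g'_def using mult_forms [OF var_forms(1) g(1), of j] qf
      by (intro vs.subspace_add [OF subspace_forms] vs.subspace_scale [OF subspace_forms]) auto
    moreover have "single U 1 - var z * g' = point_gen z a j * q"
    proof -
      have "single U 1 = var j * (single V 1 :: ('v, 'a) mpoly)" by (simp add: U(1) var_def mult_single)
      also have "\<dots> = var j * (var z * g + q)" by (simp add: q_def)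
      finally show ?thesis
        unfolding g'_def scale_def by (simp add: algebra_simps)
    qed
    then have "single U 1 - var z * g' \<in> ideal_pow (point_ideal z a) (Suc (Suc t))"
      using ideal_pow_mult [OF point_gen_in g(2), folded q_def] by metis
    ultimately show ?case by blast
qed

text \<open>
  In degree \<open>t + 1\<close> multiplication by \<open>z\<close> is surjective modulo \<open>m\<^bsup>t + 1\<^esup>\<close>.  Every ideal that contains a
  power of \<open>m\<close> inherits this in high degrees, and dually contraction by \<open>z\<close> is injective on its inverse
  system there.
\<close>

lemma form_mod_point_pow:
  fixes f :: "('v::finite, 'a::field) mpoly"
  assumes "f \<in> forms (Suc t)"
  shows "\<exists>g\<in>forms t. f - var z * g \<in> ideal_pow (point_ideal z a) (Suc t)"
proof -
  let ?J = "ideal_pow (point_ideal z a) (Suc t)"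
  have J: "vs.subspace ?J" by (intro ideal_imp_vs_subspace ideal_pow_ideal)
  have "f \<in> vs.span ((\<lambda>U. single U 1) ` {U. mdeg U = Suc t})"
    using assms by (simp add: forms_span)
  then show ?thesis
  proof (induction rule: vs.span_induct_alt)
    case base
    then show ?case using vs.subspace_0 [OF J] vs.subspace_0 [OF subspace_forms] by force
  next
    case (step c x f)
    then obtain g where g: "g \<in> forms t" "f - var z * g \<in> ?J" by blast
    obtain h where h: "h \<in> forms t" "x - var z * h \<in> ?J"
      using step monomial_mod_point_pow by blast
    have "scale c x + f - var z * (scale c h + g) = scale c (x - var z * h) + (f - var z * g)"
      by (simp add: algebra_simps vs.scale_right_diff_distrib scale_mult_right)
    moreover have "\<dots> \<in> ?J" using g h J by (intro vs.subspace_add vs.subspace_scale)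
    moreover have "scale c h + g \<in> forms t"
      using g h by (intro vs.subspace_add [OF subspace_forms] vs.subspace_scale [OF subspace_forms])
    ultimately show ?case by metis
  qed
qed

lemma form_mod_point_ideal:
  fixes f :: "('v::finite, 'a::field) mpoly"
  assumes "f \<in> forms d"
  shows "\<exists>c. f - scale c (var z ^ d) \<in> point_ideal z a"
  using assms
proof (induction d arbitrary: f)
  case 0
  have "f = scale (lookup f 0) (var z ^ 0)"
    using lookup_forms [OF 0]
    by (intro poly_mapping_eqI) (auto simp: lookup_one when_def mdeg_eq_0_iff)
  then have "f - scale (lookup f 0) (var z ^ 0) = 0" by simp
  then show ?case using ideal.subspace_0 [OF point_ideal_ideal] by metis
next
  case (Suc d)
  obtain g where g: "g \<in> forms d" "f - var z * g \<in> ideal_pow (point_ideal z a) (Suc d)"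
    using form_mod_point_pow [OF Suc.prems] by blast
  then have fg: "f - var z * g \<in> point_ideal z a"
    using ideal_pow_antimono [of 1 "Suc d" "point_ideal z a"] ideal_pow_1 [OF point_ideal_ideal, of z a]
    by auto
  obtain c where c: "g - scale c (var z ^ d) \<in> point_ideal z a" using Suc.IH [OF g(1)] by blast
  have "f - scale c (var z ^ Suc d) = (f - var z * g) + var z * (g - scale c (var z ^ d))"
    by (simp add: right_diff_distrib scale_mult_right)
  then show ?case
    using fg c by (metis ideal.subspace_add ideal.subspace_scale point_ideal_ideal)
qed

lemma point_ideal_prime_forms:
  fixes f g :: "('v::finite, 'a::field) mpoly"
  assumes "a z = 1" and f: "f \<in> forms d" "f \<notin> point_ideal z a" and g: "g \<in> forms e" "g \<notin> point_ideal z a"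
  shows "f * g \<notin> point_ideal z a"
proof
  assume fg: "f * g \<in> point_ideal z a"
  note I = point_ideal_ideal [of z a]
  obtain c where c: "f - scale c (var z ^ d) \<in> point_ideal z a" using form_mod_point_ideal [OF f(1)] by blast
  obtain b where b: "g - scale b (var z ^ e) \<in> point_ideal z a" using form_mod_point_ideal [OF g(1)] by blast
  have "c \<noteq> 0" "b \<noteq> 0" using b c f g by auto
  have "scale (c * b) (var z ^ (d + e)) =
      f * g - g * (f - scale c (var z ^ d)) - scale c (var z ^ d) * (g - scale b (var z ^ e))"
    by (simp add: algebra_simps scale_mult_left scale_mult_right power_add)
  also have "\<dots> \<in> point_ideal z a"
    by (intro ideal.subspace_diff [OF I] fg ideal.subspace_scale [OF I c] ideal.subspace_scale [OF I b])
  finally show False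
    using var_power_notin_point_ideal [of a z "c * b" "d + e", OF assms(1)] \<open>c \<noteq> 0\<close> \<open>b \<noteq> 0\<close> by simp
qed

lemma power_notin_point_ideal:
  assumes "a z = 1" "f \<in> forms d" "f \<notin> point_ideal z a"
  shows "f ^ n \<notin> point_ideal z a"
proof (induction n)
  case 0
  then show ?case using var_power_notin_point_ideal [of a z 1 0] assms(1) by simp
next
  case (Suc n)
  then show ?case
    using point_ideal_prime_forms [OF assms(1) assms(2,3) power_forms [OF assms(2)]] by simp
qed

text \<open>
  Up to a nonzero constant factor, \<open>h\<close> is \<open>z\<^sup>e - q\<close> with \<open>q \<in> m\<close>, and \<open>z\<^sup>e - q\<close> divides
  \<open>z\<^bsup>e n\<^esup> - q\<^sup>n\<close>.  This replaces the inversion of \<open>h\<close> in the local ring of the point.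
\<close>

lemma var_power_in_principal_plus_power:
  fixes h :: "('v::finite, 'a::field) mpoly"
  assumes h: "h \<in> forms e" "h \<notin> point_ideal z a"
  shows "\<exists>r. var z ^ (e * n) - r * h \<in> ideal_pow (point_ideal z a) n"
proof -
  obtain c where c: "h - scale c (var z ^ e) \<in> point_ideal z a"
    using form_mod_point_ideal [OF h(1)] by blast
  then have "c \<noteq> 0" using h by auto
  define q where "q = scale (- inverse c) (h - scale c (var z ^ e))"
  have "q \<in> point_ideal z a"
    unfolding q_def using c by (intro vs.subspace_scale ideal_imp_vs_subspace point_ideal_ideal)
  then have "q ^ n \<in> ideal_pow (point_ideal z a) n" by (rule power_in_ideal_pow)
  moreover have zq: "var z ^ e - q = scale (inverse c) h"
    using \<open>c \<noteq> 0\<close> by (simp add: q_def vs.scale_right_diff_distrib)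
  obtain r where "(var z ^ e) ^ n - q ^ n = (var z ^ e - q) * r"
    using power_diff_sumr2 by blast
  then have "var z ^ (e * n) - scale (inverse c) r * h = q ^ n"
    by (simp add: zq power_mult scale_mult_left scale_mult_right algebra_simps)
  ultimately show ?thesis by metis
qed

section \<open>Substitution and the powers of the ideal of a point\<close>

definition substitute :: "('v \<Rightarrow> ('v, 'a) mpoly) \<Rightarrow> ('v::finite, 'a::field) mpoly \<Rightarrow> ('v, 'a) mpoly"
  where "substitute \<sigma> f = (\<Sum>U\<in>keys f. scale (lookup f U) (\<Prod>v\<in>UNIV. \<sigma> v ^ lookup U v))"

lemma substitute_0 [simp]: "substitute \<sigma> 0 = 0"
  by (simp add: substitute_def)

lemma substitute_add: "substitute \<sigma> (f + g) = substitute \<sigma> f + substitute \<sigma> g"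
  unfolding substitute_def
  by (rule sum_keys_add [where \<theta> = "\<lambda>U c. scale c (\<Prod>v\<in>UNIV. \<sigma> v ^ lookup U v)"])
    (simp_all add: vs.scale_left_distrib)

lemma substitute_single: "substitute \<sigma> (single U c) = scale c (\<Prod>v\<in>UNIV. \<sigma> v ^ lookup U v)"
  by (simp add: substitute_def)

lemma substitute_mult: "substitute \<sigma> (f * g) = substitute \<sigma> f * substitute \<sigma> g"
proof (induction f rule: poly_induct)
  case (single K c)
  show ?case
    by (induction g rule: poly_induct)
      (simp_all add: substitute_add distrib_left substitute_single mult_single lookup_add power_add prod.distrib
        scale_mult_left scale_mult_right)
qed (simp_all add: substitute_add distrib_right)

lemma substitute_1 [simp]: "substitute \<sigma> 1 = 1"
  using substitute_single [of \<sigma> 0 1] by simp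

lemma substitute_power: "substitute \<sigma> (f ^ n) = substitute \<sigma> f ^ n"
  by (induction n) (simp_all add: substitute_mult)

lemma substitute_prod: "substitute \<sigma> (\<Prod>x\<in>A. f x) = (\<Prod>x\<in>A. substitute \<sigma> (f x))"
  by (induction A rule: infinite_finite_induct) (simp_all add: substitute_mult)

lemma substitute_scale: "substitute \<sigma> (scale c f) = scale c (substitute \<sigma> f)"
  by (simp add: scale_def substitute_mult substitute_single)

lemma substitute_diff: "substitute \<sigma> (f - g) = substitute \<sigma> f - substitute \<sigma> g"
  using substitute_add [of \<sigma> "f - g" g] by simp

lemma substitute_var [simp]: "substitute \<sigma> (var j) = \<sigma> j"
proof -
  have "(\<Prod>v\<in>UNIV. \<sigma> v ^ lookup (single j 1) v) = (\<Prod>v\<in>UNIV. if v = j then \<sigma> j else 1)"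
    by (intro prod.cong) (auto simp: lookup_single when_def)
  then show ?thesis by (simp add: var_def substitute_single)
qed

lemma var_power: "var v ^ n = single (single v n) 1"
  by (induction n) (simp_all add: var_def mult_single single_add [symmetric])

lemma monomial_eq_prod:
  fixes U :: "'v::finite \<Rightarrow>\<^sub>0 nat"
  shows "single U (1 :: 'a::field) = (\<Prod>v\<in>UNIV. var v ^ lookup U v)"
proof -
  have "(\<Prod>v\<in>A. single (single v (n v)) 1) = single (\<Sum>v\<in>A. single v (n v)) (1 :: 'a)"
    if "finite A" for A :: "'v set" and n :: "'v \<Rightarrow> nat"
    using that by induction (simp_all add: mult_single)
  from this [of UNIV "lookup U"] show ?thesis
    using sum_monomials [of UNIV U, symmetric] by (simp add: var_power)
qed

lemma substitute_inverse:
  assumes "\<And>v. substitute \<tau> (\<sigma> v) = var v"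
  shows "substitute \<tau> (substitute \<sigma> f) = f"
proof (induction f rule: poly_induct)
  case (single U c)
  have "substitute \<tau> (substitute \<sigma> (single U c)) = scale c (single U 1)"
    unfolding monomial_eq_prod by (simp add: substitute_single substitute_scale substitute_prod substitute_power assms)
  then show ?case by simp
qed (simp_all add: substitute_add)

definition codegree :: "'v \<Rightarrow> ('v::finite \<Rightarrow>\<^sub>0 nat) \<Rightarrow> nat"
  where "codegree z U = (\<Sum>v\<in>UNIV - {z}. lookup U v)"

lemma codegree_add: "codegree z (U + V) = codegree z U + codegree z V"
  by (simp add: codegree_def lookup_add sum.distrib)

lemma codegree_single: "codegree z (single v n) = (if v = z then 0 else n)"
  by (auto simp: codegree_def lookup_single when_def)

text \<open>
  For the point \<open>(0 : \<dots> : 0 : 1)\<close> this is the \<open>N\<close>-th power of its ideal: membership can be read off from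
  the monomials.
\<close>

definition origin_pow :: "'v \<Rightarrow> nat \<Rightarrow> ('v::finite, 'a::field) mpoly set"
  where "origin_pow z N = {f. \<forall>U. lookup f U \<noteq> 0 \<longrightarrow> N \<le> codegree z U}"

lemma origin_pow_mult:
  assumes "f \<in> origin_pow z M" "g \<in> origin_pow z N"
  shows "f * g \<in> origin_pow z (M + N)"
  unfolding origin_pow_def
proof clarify
  fix W assume "lookup (f * g) W \<noteq> 0"
  then obtain U V where "W = U + V" "U \<in> keys f" "V \<in> keys g"
    using keys_mult [of f g] by (auto simp: keys_iff)
  then show "M + N \<le> codegree z W"
    using assms by (auto simp: origin_pow_def keys_iff codegree_add intro!: add_mono)
qed

lemma origin_pow_add: "f \<in> origin_pow z N \<Longrightarrow> g \<in> origin_pow z N \<Longrightarrow> f + g \<in> origin_pow z N"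
  by (auto simp: origin_pow_def lookup_add) (metis add_0)

lemma lookup_single_mult: "lookup (single K c * f) (K + U) = c * lookup (f :: (_ :: cancel_comm_monoid_add \<Rightarrow>\<^sub>0 _ :: comm_semiring_0)) U"
  by (induction f rule: poly_induct)
    (simp_all add: distrib_left lookup_add mult_single lookup_single when_def)

lemma ideal_pow_power_mult: "x \<in> I \<Longrightarrow> f \<in> ideal_pow I m \<Longrightarrow> x ^ n * f \<in> ideal_pow I (n + m)"
  by (induction n) (auto simp: mult.assoc intro: ideal.span_base)

lemma prod_power_in_ideal_pow:
  assumes "finite A" "\<And>v. v \<in> A \<Longrightarrow> x v \<in> I"
  shows "(\<Prod>v\<in>A. x v ^ n v) \<in> ideal_pow I (\<Sum>v\<in>A. n v)"
  using assms by induction (simp_all add: ideal_pow_power_mult)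

text \<open>
  The linear change of coordinates \<open>\<sigma>\<close> moves the point to \<open>(0 : \<dots> : 0 : 1)\<close> and fixes \<open>z\<close>.  There the
  powers of the ideal are spanned by monomials, and multiplication by \<open>z\<close> does not change the
  degree in the other variables.
\<close>

lemma var_nonzerodivisor_point_pow:
  fixes f :: "('v::finite, 'a::field) mpoly"
  assumes az: "a z = 1" and zf: "var z * f \<in> ideal_pow (point_ideal z a) N"
  shows "f \<in> ideal_pow (point_ideal z a) N"
proof -
  let ?m = "point_ideal z a"
  define \<sigma> :: "'v \<Rightarrow> ('v, 'a) mpoly"
    where "\<sigma> v = (if v = z then var z else var v + scale (a v) (var z))" for v
  define \<tau> :: "'v \<Rightarrow> ('v, 'a) mpoly"
    where "\<tau> v = (if v = z then var z else point_gen z a v)" for v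
  have gen: "substitute \<sigma> (point_gen z a j) = (if j = z then 0 else var j)" for j
    by (simp add: substitute_diff substitute_scale \<sigma>_def az)
  have prods: "substitute \<sigma> p \<in> origin_pow z n" if "p \<in> products (gens z a) n" for p n
    using that
  proof (induction n arbitrary: p)
    case (Suc n)
    then obtain j q where jq: "p = point_gen z a j * q" "q \<in> products (gens z a) n" by auto
    have "substitute \<sigma> (point_gen z a j) \<in> origin_pow z 1"
      unfolding gen by (auto simp: origin_pow_def var_def lookup_single when_def codegree_single)
    then show ?case
      using origin_pow_mult [of "substitute \<sigma> (point_gen z a j)" z 1 "substitute \<sigma> q" n] Suc.IH [OF jq(2)]
      by (simp add: jq(1) substitute_mult)
  qed (simp add: origin_pow_def)
  \<comment> \<open>\<open>\<sigma>\<close> maps the generators of the ideal to variables other than \<open>z\<close>, and \<open>\<tau>\<close> maps them back.\<close>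
  have image: "substitute \<sigma> g \<in> origin_pow z N" if "g \<in> ideal_pow ?m N" for g
    using that unfolding point_pow_eq
  proof (induction rule: ideal.span_induct_alt)
    case base
    then show ?case by (simp add: origin_pow_def)
  next
    case (step c p g)
    have "substitute \<sigma> c \<in> origin_pow z 0" by (simp add: origin_pow_def)
    then show ?case
      using origin_pow_mult [of "substitute \<sigma> c" z 0 "substitute \<sigma> p" N] prods [OF step(1)] step(2)
      by (simp add: substitute_add substitute_mult origin_pow_add)
  qed
  have preimage: "substitute \<tau> g \<in> ideal_pow ?m N" if "g \<in> origin_pow z N" for g
  proof -
    have "(\<Prod>v\<in>UNIV. \<tau> v ^ lookup U v) \<in> ideal_pow ?m N" if "U \<in> keys g" for U
    proof -
      have "(\<Prod>v\<in>UNIV. \<tau> v ^ lookup U v) =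
          var z ^ lookup U z * (\<Prod>v\<in>UNIV - {z}. \<tau> v ^ lookup U v)"
        by (simp add: prod.remove [of UNIV z] \<tau>_def)
      moreover have "(\<Prod>v\<in>UNIV - {z}. \<tau> v ^ lookup U v) \<in> ideal_pow ?m (codegree z U)"
        unfolding codegree_def
        by (rule prod_power_in_ideal_pow) (auto simp: \<tau>_def point_gen_in)
      moreover have "N \<le> codegree z U"
        using that \<open>g \<in> origin_pow z N\<close> by (auto simp: origin_pow_def keys_iff)
      ultimately show ?thesis
        using ideal_pow_antimono [of N "codegree z U" ?m]
        by (auto intro: ideal.subspace_scale [OF ideal_pow_ideal])
    qed
    then show ?thesis
      unfolding substitute_def
      by (intro vs.subspace_sum vs.subspace_scale ideal_imp_vs_subspace ideal_pow_ideal)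
  qed
  have "var z * substitute \<sigma> f \<in> origin_pow z N"
    using image [OF zf] by (simp add: substitute_mult \<sigma>_def)
  then have "substitute \<sigma> f \<in> origin_pow z N"
    unfolding origin_pow_def
  proof clarify
    fix U assume *: "\<forall>U. lookup (var z * substitute \<sigma> f) U \<noteq> 0 \<longrightarrow> N \<le> codegree z U"
      and U: "lookup (substitute \<sigma> f) U \<noteq> 0"
    have "lookup (var z * substitute \<sigma> f) (single z 1 + U) \<noteq> 0"
      unfolding var_def lookup_single_mult using U by simp
    then show "N \<le> codegree z U" using * by (fastforce simp: codegree_add codegree_single)
  qed
  then have "substitute \<tau> (substitute \<sigma> f) \<in> ideal_pow ?m N" by (rule preimage)
  moreover have "substitute \<tau> (substitute \<sigma> f) = f"
    by (rule substitute_inverse) (simp add: \<sigma>_def substitute_add substitute_scale \<tau>_def)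
  ultimately show ?thesis by simp
qed

section \<open>Punctual ideals\<close>

definition regular_mod :: "'r::comm_ring_1 \<Rightarrow> 'r set \<Rightarrow> bool"
  where "regular_mod h I \<longleftrightarrow> (\<forall>f. h * f \<in> I \<longrightarrow> f \<in> I)"

lemma regular_modI: "(\<And>f. h * f \<in> I \<Longrightarrow> f \<in> I) \<Longrightarrow> regular_mod h I"
  by (simp add: regular_mod_def)

lemma regular_modD: "regular_mod h I \<Longrightarrow> h * f \<in> I \<Longrightarrow> f \<in> I"
  by (simp add: regular_mod_def)

lemma regular_mod_power:
  assumes "regular_mod h I"
  shows "regular_mod (h ^ n) I"
proof (rule regular_modI)
  fix f assume "h ^ n * f \<in> I"
  then show "f \<in> I"
    by (induction n) (auto simp: mult.assoc intro: regular_modD [OF assms])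
qed

text \<open>
  These are the properties of the saturated ideal of a scheme concentrated at the point that the
  proof uses.  They hold for the powers of the ideal of the point as well, so that both kinds of
  ideals can be put into one family.
\<close>

definition punctual :: "'v \<Rightarrow> ('v \<Rightarrow> 'a) \<Rightarrow> ('v::finite, 'a::field) mpoly set \<Rightarrow> bool"
  where "punctual z a I \<longleftrightarrow> homogeneous_ideal I \<and> (\<exists>N. ideal_pow (point_ideal z a) N \<subseteq> I) \<and>
    regular_mod (var z) I"

lemma punctualD:
  assumes "punctual z a I"
  shows "homogeneous_ideal I" "regular_mod (var z) I"
  using assms by (auto simp: punctual_def)

lemma punctual_point_pow: "a z = 1 \<Longrightarrow> punctual z a (ideal_pow (point_ideal z a) N)"
  using homogeneous_point_pow var_nonzerodivisor_point_pow by (auto simp: punctual_def regular_mod_def)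

text \<open>
  Modulo a power of \<open>m\<close> that is contained in \<open>I\<close>, some power of \<open>z\<close> is a multiple of \<open>h\<close>.
\<close>

lemma punctual_regular_mod:
  assumes I: "punctual z a I" and h: "h \<in> forms e" "h \<notin> point_ideal z a"
  shows "regular_mod h I"
proof (rule regular_modI)
  fix f assume hf: "h * f \<in> I"
  have ideal: "ideal.subspace I" using I by (auto simp: punctual_def homogeneous_ideal_def)
  obtain N where N: "ideal_pow (point_ideal z a) N \<subseteq> I" using I by (auto simp: punctual_def)
  obtain r where r: "var z ^ (e * N) - r * h \<in> ideal_pow (point_ideal z a) N"
    using var_power_in_principal_plus_power [OF h] by blast
  have "var z ^ (e * N) * f = f * (var z ^ (e * N) - r * h) + r * (h * f)"
    by (simp add: algebra_simps)
  also have "\<dots> \<in> I"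
    by (intro ideal.subspace_add [OF ideal] ideal.subspace_scale [OF ideal] subsetD [OF N r] hf)
  finally have zf: "var z ^ (e * N) * f \<in> I" .
  show "f \<in> I" by (rule regular_modD [OF regular_mod_power [OF punctualD(2) [OF I]] zf])
qed

text \<open>
  In a product of more than \<open>\<Sum>n\<^sub>j\<close> factors \<open>x\<^sub>j\<close>, some \<open>x\<^sub>j\<close> occurs at least \<open>n\<^sub>j\<close> times.
\<close>

lemma products_nilpotent:
  assumes "\<And>j. \<exists>n. x j ^ n \<in> I" and I: "ideal.subspace I"
  shows "\<exists>N. products {x j | j :: 'v::finite. True} N \<subseteq> (I :: 'r::comm_ring_1 set)"
proof -
  obtain n where n: "\<And>j. x j ^ n j \<in> I" using assms(1) by metis
  have form: "\<exists>e. p = (\<Prod>j\<in>UNIV. x j ^ e j) \<and> (\<Sum>j\<in>UNIV. e j) = m"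
    if "p \<in> products {x j | j. True} m" for p m
    using that
  proof (induction m arbitrary: p)
    case 0
    then show ?case by (intro exI [of _ "\<lambda>_. 0"]) simp
  next
    case (Suc m)
    then obtain j q where p: "p = x j * q" "q \<in> products {x j | j. True} m" by auto
    obtain e where e: "q = (\<Prod>j\<in>UNIV. x j ^ e j)" "(\<Sum>j\<in>UNIV. e j) = m"
      using Suc.IH [OF p(2)] by blast
    have "(\<Prod>i\<in>UNIV. x i ^ (e(j := Suc (e j))) i) = x j * (\<Prod>i\<in>UNIV. x i ^ e i)"
      by (simp add: prod.remove [of UNIV j] mult.assoc)
    moreover have "(\<Sum>i\<in>UNIV. (e(j := Suc (e j))) i) = Suc m"
      using e(2) by (simp add: sum.remove [of UNIV j])
    ultimately show ?case using p e by metis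
  qed
  have "products {x j | j. True} (Suc (\<Sum>j\<in>UNIV. n j)) \<subseteq> I"
  proof
    fix p assume "p \<in> products {x j | j. True} (Suc (\<Sum>j\<in>UNIV. n j))"
    then obtain e where e: "p = (\<Prod>j\<in>UNIV. x j ^ e j)" "(\<Sum>j\<in>UNIV. e j) = Suc (\<Sum>j\<in>UNIV. n j)"
      using form by blast
    have "\<exists>j. n j \<le> e j"
      by (rule ccontr) (use e(2) sum_mono [of UNIV e n] in \<open>force simp: not_le intro: less_imp_le\<close>)
    then obtain j where j: "n j \<le> e j" by blast
    have "p = (x j ^ (e j - n j) * (\<Prod>i\<in>UNIV - {j}. x i ^ e i)) * x j ^ n j"
      using j by (simp add: e(1) prod.remove [of UNIV j] power_add [symmetric] mult_ac flip: mult.assoc)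
    then show "p \<in> I" using ideal.subspace_scale [OF I n] by metis
  qed
  then show ?thesis by blast
qed

text \<open>
  The generators of \<open>m\<close> are nilpotent modulo \<open>I\<close>, so \<open>m\<^sup>N \<subseteq> I\<close> for some \<open>N\<close>.  A form \<open>g\<close> of degree
  \<open>N + 1\<close> is a multiple of \<open>z\<close> modulo \<open>m\<^sup>N\<close>; so if \<open>z f \<in> I\<close>, then \<open>g f \<in> I\<close>, and \<open>f \<in> I\<close> by saturation.
\<close>

lemma punctual_if_concentrated:
  assumes Z: "zero_dim_scheme I" and c: "concentrated_at I z a"
  shows "punctual z a I"
proof -
  have I: "homogeneous_ideal I" and sat: "saturation I = I"
    using Z by (auto simp: zero_dim_scheme_def)
  note ideal = homogeneous_idealD(1) [OF I]
  have "\<exists>n. point_gen z a j ^ n \<in> I" for j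
    using c point_gen_in [where z = z and a = a and j = j]
    by (auto simp: concentrated_at_def radical_def)
  then obtain N where "products (gens z a) N \<subseteq> I"
    using products_nilpotent [of "point_gen z a" I, OF _ ideal] by blast
  then have N: "ideal_pow (point_ideal z a) N \<subseteq> I"
    unfolding point_pow_eq using ideal by (intro ideal.span_minimal)
  have "regular_mod (var z) I"
  proof (rule regular_modI)
    fix f assume zf: "var z * f \<in> I"
    have "g * f \<in> I" if g: "g \<in> forms (Suc N)" for g
    proof -
      obtain h where h: "g - var z * h \<in> ideal_pow (point_ideal z a) (Suc N)"
        using form_mod_point_pow [OF g] by blast
      then have "g - var z * h \<in> I" using N ideal_pow_decreasing by blast
      moreover have "g * f = f * (g - var z * h) + h * (var z * f)" by (simp add: algebra_simps)
      ultimately show ?thesis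
        using zf by (metis ideal ideal.subspace_add ideal.subspace_scale)
    qed
    then show "f \<in> I" using sat by (auto simp: saturation_def)
  qed
  then show ?thesis using I N by (auto simp: punctual_def)
qed

lemma saturation_eq:
  assumes "ideal.subspace I" "regular_mod (var z) I"
  shows "saturation I = I"
proof
  show "saturation I \<subseteq> I"
  proof
    fix f assume "f \<in> saturation I"
    then obtain N where "\<And>g. g \<in> forms N \<Longrightarrow> g * f \<in> I" by (auto simp: saturation_def)
    then have zf: "var z ^ N * f \<in> I" using var_power_forms by blast
    show "f \<in> I" by (rule regular_modD [OF regular_mod_power [OF assms(2)] zf])
  qed
  show "I \<subseteq> saturation I"
    using assms(1) by (auto simp: saturation_def intro: ideal.subspace_scale)
qed

text \<open>
  With \<open>i\<close> the socle degree, every form in \<open>m\<^bsup>i + 1\<^esup>\<close> is carried into \<open>I\<close> by some form \<open>h \<notin> m\<close>, and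
  \<open>h\<close> is regular modulo \<open>I\<close>.  The greatest nonvanishing power of the maximal ideal exists because the
  zeroth power does not vanish and \<open>I\<close> contains some power of \<open>m\<close>.
\<close>

lemma point_pow_socle_degree:
  assumes az: "a z = 1" and I: "punctual z a I" and c: "concentrated_at I z a"
  shows "ideal_pow (point_ideal z a) (socle_degree I z a + 1) \<subseteq> I"
proof -
  note ideal = homogeneous_idealD(1) [of I]
  have hom: "homogeneous_ideal I" using I by (simp add: punctual_def)
  have one: "1 \<notin> point_ideal z a" using var_power_notin_point_ideal [of a z 1 0] az by simp
  have "f \<in> point_ideal z a" if "f \<in> I" for f
  proof -
    have "f ^ 1 \<in> I" using that by simp
    then show ?thesis using c unfolding concentrated_at_def radical_def by blast
  qed
  then have 0: "local_max_pow_nonzero I z a 0"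
    unfolding local_max_pow_nonzero_def using one_forms by (intro exI [of _ 0] bexI [of _ 1]) auto
  obtain N where N: "ideal_pow (point_ideal z a) N \<subseteq> I" using I by (auto simp: punctual_def)
  have bound: "i \<le> N" if nz: "local_max_pow_nonzero I z a i" for i
  proof (rule ccontr)
    assume "\<not> i \<le> N"
    then have "ideal_pow (point_ideal z a) i \<subseteq> I" using N ideal_pow_antimono [of N i] by force
    moreover obtain f where "f \<in> ideal_pow (point_ideal z a) i"
      "\<And>e h. h \<in> forms e - point_ideal z a \<Longrightarrow> h * f \<notin> I"
      using nz by (auto simp: local_max_pow_nonzero_def)
    ultimately show False using one one_forms by (metis DiffI mult_1 subsetD)
  qed
  have "\<not> local_max_pow_nonzero I z a (socle_degree I z a + 1)"
    using Greatest_le_nat [of "local_max_pow_nonzero I z a" "socle_degree I z a + 1" N] bound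
    by (auto simp: socle_degree_def)
  then have form: "f \<in> I" if "f \<in> ideal_pow (point_ideal z a) (socle_degree I z a + 1)" "f \<in> forms d" for f d
    using that regular_modD [OF punctual_regular_mod [OF I]] unfolding local_max_pow_nonzero_def by blast
  show ?thesis
  proof
    fix f assume f: "f \<in> ideal_pow (point_ideal z a) (socle_degree I z a + 1)"
    show "f \<in> I"
      by (rule in_ideal_if_components [OF ideal [OF hom]])
        (rule form [OF homogeneous_idealD(2) [OF homogeneous_point_pow f] component_forms])
  qed
qed

text \<open>
  The product over \<open>v\<close> of high powers of linear forms that vanish at the point of \<open>v\<close>, but not at the
  point of \<open>u\<close>.
\<close>

lemma separating_form:
  assumes "finite A" "u \<notin> A" and az: "\<And>v. v \<in> insert u A \<Longrightarrow> a v z = 1" and inj: "inj_on a (insert u A)"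
    and I: "\<And>v. v \<in> A \<Longrightarrow> punctual z (a v) (I v)"
  shows "\<exists>e. \<exists>h\<in>forms e. h \<notin> point_ideal z (a u) \<and> (\<forall>v\<in>A. h \<in> I v)"
  using assms
proof (induction A)
  case empty
  then show ?case
    using var_power_notin_point_ideal [of "a u" z 1 0] one_forms
    by (intro exI [of _ 0] bexI [of _ 1]) auto
next
  case (insert w A)
  have "inj_on a (insert u A)"
    using insert.prems(3) by (rule inj_on_subset) auto
  then obtain e h where h: "h \<in> forms e" "h \<notin> point_ideal z (a u)" "\<forall>v\<in>A. h \<in> I v"
    using insert.IH insert.prems by auto
  have "a u \<noteq> a w" using insert.prems(1,3) by (auto simp: inj_on_def)
  then obtain j where j: "a u j \<noteq> a w j" by blast
  have auz: "a u z = 1" using insert.prems(2) by simp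
  let ?l = "point_gen z (a w) j"
  have l: "?l \<notin> point_ideal z (a u)"
  proof
    assume "?l \<in> point_ideal z (a u)"
    then have "?l - point_gen z (a u) j \<in> point_ideal z (a u)"
      using ideal.subspace_diff [OF point_ideal_ideal] point_gen_in by blast
    moreover have "?l - point_gen z (a u) j = scale (a u j - a w j) (var z ^ 1)"
      by (simp add: vs.scale_left_diff_distrib)
    ultimately show False
      using var_power_notin_point_ideal [of "a u" z "a u j - a w j" 1, OF auz] j by simp
  qed
  obtain N where N: "ideal_pow (point_ideal z (a w)) N \<subseteq> I w"
    using insert.prems(4) [of w] unfolding punctual_def by blast
  have "h * ?l ^ N \<notin> point_ideal z (a u)"
    using point_ideal_prime_forms [OF auz h(1,2) power_forms [OF point_gen_forms]]
      power_notin_point_ideal [of "a u" z ?l 1 N] auz point_gen_forms l by blast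
  moreover have "h * ?l ^ N \<in> forms (e + 1 * N)"
    by (intro mult_forms h power_forms point_gen_forms)
  moreover have "h * ?l ^ N \<in> I v" if "v \<in> insert w A" for v
  proof -
    have ideal: "ideal.subspace (I v)"
      using insert.prems(4) [OF that] by (auto simp: punctual_def homogeneous_ideal_def)
    show ?thesis
    proof (cases "v = w")
      case True
      have "?l ^ N \<in> I w" using N power_in_ideal_pow [OF point_gen_in] by blast
      then show ?thesis using True ideal.subspace_scale [OF ideal] by blast
    next
      case False
      then have "h \<in> I v" using h(3) that by blast
      then show ?thesis using ideal.subspace_scale [OF ideal, of h "?l ^ N"] by (simp add: mult.commute)
    qed
  qed
  ultimately show ?case by blast
qed

section \<open>Contraction on inverse systems and Hilbert functions\<close>

lemma forms_eq_0_if_pairing: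
  assumes "F \<in> forms i" "\<And>f. f \<in> forms i \<Longrightarrow> pairing f F = 0"
  shows "F = 0"
proof (rule poly_mapping_eqI)
  fix U
  show "lookup F U = lookup 0 U"
    using assms(2) [of "single U 1"] lookup_forms [OF assms(1), of U] by (cases "mdeg U = i") auto
qed

lemma contract_ideal_perp:
  assumes I: "homogeneous_ideal I" and p: "p \<in> I" and F: "F \<in> perp i I"
  shows "contract p F = 0"
proof -
  note ideal = homogeneous_idealD(1) [OF I]
  have form: "contract q F = 0" if q: "q \<in> I" "q \<in> forms d" for q d
  proof (cases "d \<le> i")
    case True
    have Ff: "F \<in> forms (d + (i - d))" using F True by (simp add: perp_def)
    show ?thesis
    proof (rule poly_mapping_eqI)
      fix V
      show "lookup (contract q F) V = lookup 0 V"
      proof (cases "mdeg V = i - d")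
        case V: True
        have "single V 1 * q \<in> forms (mdeg V + d)" using q(2) by (intro mult_forms) auto
        then have "single V 1 * q \<in> I \<inter> forms i"
          using V True ideal.subspace_scale [OF ideal q(1)] by simp
        then have "pairing (single V 1 * q) F = 0" using F by (auto simp: perp_def)
        then show ?thesis by (simp add: pairing_mult)
      next
        case False
        then show ?thesis using lookup_forms [OF contract_forms [OF q(2) Ff]] by simp
      qed
    qed
  next
    case False
    then show ?thesis using q(2) F contract_low_degree [of q d F i] by (auto simp: perp_def)
  qed
  have "contract p F = contract (\<Sum>d\<in>mdeg ` keys p. component d p) F"
    using sum_components [of "mdeg ` keys p" p] by simp
  also have "\<dots> = 0"
    unfolding contract_sum_left
    by (intro sum.neutral ballI form [OF homogeneous_idealD(2) [OF I p] component_forms])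
  finally show ?thesis .
qed

lemma contract_in_perp:
  assumes I: "homogeneous_ideal I" and h: "h \<in> forms d" and F: "F \<in> perp (d + i) I"
  shows "contract h F \<in> perp i I"
proof -
  have "pairing g (contract h F) = 0" if g: "g \<in> I" "g \<in> forms i" for g
  proof -
    have "h * g \<in> I" using ideal.subspace_scale [OF homogeneous_idealD(1) [OF I] g(1)] .
    then have "g * h \<in> I \<inter> forms (d + i)" using mult_forms [OF h g(2)] by (simp add: mult.commute)
    then have "pairing (g * h) F = 0" using F by (auto simp: perp_def)
    then show ?thesis by (simp add: pairing_mult)
  qed
  then show ?thesis using F contract_forms [OF h] by (auto simp: perp_def)
qed

lemma hilb_eq_dim_perp:
  fixes I :: "('v::finite, 'a::field) mpoly set"
  assumes "homogeneous_ideal I"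
  shows "hilb I i = vs.dim (perp i I)"
  using dim_perp [OF subspace_ideal_forms [OF assms, of i]] by (simp add: hilb_def codim_def perp_Int_forms)

text \<open>
  A form \<open>g\<close> annihilates the image of \<open>perp (d + i) I\<close> iff \<open>g h\<close> annihilates \<open>perp (d + i) I\<close>, that is, iff
  \<open>g h \<in> I\<close>, and then \<open>g \<in> I\<close>.  So the image has the same annihilator as \<open>perp i I\<close>.
\<close>

lemma contract_perp_surj:
  fixes I :: "('v::finite, 'a::field) mpoly set"
  assumes I: "homogeneous_ideal I" and h: "h \<in> forms d" and nzd: "regular_mod h I"
  shows "contract h ` perp (d + i) I = perp i I"
proof
  show sub: "contract h ` perp (d + i) I \<subseteq> perp i I" using contract_in_perp [OF I h] by blast
  interpret c: Vector_Spaces.linear scale scale "contract h :: ('v, 'a) dpoly \<Rightarrow> _" by (rule linear_contract)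
  let ?S = "contract h ` perp (d + i) I"
  have S: "vs.subspace ?S" by (intro c.subspace_image subspace_perp)
  have Sf: "?S \<subseteq> forms i" using sub perp_subset_forms by blast
  have "perp i ?S \<subseteq> I"
  proof
    fix g assume g: "g \<in> perp i ?S"
    have "g * h \<in> perp (d + i) (perp (d + i) (I \<inter> forms (d + i)))"
    proof -
      have "pairing F (g * h) = 0" if F: "F \<in> perp (d + i) I" for F
      proof -
        have "contract h F \<in> ?S \<inter> forms i" using F Sf by blast
        then have "pairing (contract h F) g = 0" using g by (auto simp: perp_def)
        then show ?thesis by (metis pairing_commute pairing_mult)
      qed
      moreover have "g * h \<in> forms (d + i)"
        using mult_forms [OF _ h, of g i] g by (simp add: perp_def add.commute)
      ultimately show ?thesis by (simp add: perp_Int_forms) (auto simp: perp_def [of _ "perp _ _"])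
    qed
    then have "g * h \<in> I" using perp_perp [OF subspace_ideal_forms [OF I]] by blast
    then show "g \<in> I" using regular_modD [OF nzd] by (simp add: mult.commute)
  qed
  then have "perp i I \<subseteq> perp i (perp i ?S)" by (rule perp_antimono)
  then show "perp i I \<subseteq> ?S" using perp_perp [OF S Sf] by simp
qed

text \<open>
  By duality this says that multiplication by \<open>z\<close> maps \<open>(R/I)\<^sub>i\<close> onto \<open>(R/I)\<^bsub>i + 1\<^esub>\<close>.
\<close>

definition var_injective :: "'v \<Rightarrow> ('v::finite, 'a::field) mpoly set \<Rightarrow> nat \<Rightarrow> bool"
  where "var_injective z I i \<longleftrightarrow> (\<forall>F\<in>perp (Suc i) I. contract (var z) F = 0 \<longrightarrow> F = 0)"

lemma var_injective_high_degree:
  assumes I: "homogeneous_ideal I" and N: "ideal_pow (point_ideal z a) N \<subseteq> I" "N \<le> Suc i"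
  shows "var_injective z I i"
  unfolding var_injective_def
proof (intro ballI impI, rule forms_eq_0_if_pairing)
  fix F assume F: "F \<in> perp (Suc i) I" and zF: "contract (var z) F = 0"
  show "F \<in> forms (Suc i)" using F by (simp add: perp_def)
  fix f :: "('a, 'b) mpoly" assume "f \<in> forms (Suc i)"
  then obtain g where "f - var z * g \<in> ideal_pow (point_ideal z a) (Suc i)"
    using form_mod_point_pow by blast
  then have "f - var z * g \<in> I" using N ideal_pow_antimono [OF N(2)] by blast
  then have "contract (f - g * var z) F = 0" using contract_ideal_perp [OF I _ F] by (simp add: mult.commute)
  then have "contract f F = 0" by (simp add: contract_minus_left contract_mult zF)
  then show "pairing f F = 0" by (simp add: pairing_def)
qed

lemma contract_var_power_inj:
  assumes I: "homogeneous_ideal I"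
    and inj: "\<forall>j\<ge>t. var_injective z I j"
    and F: "F \<in> perp (M + t) I" "contract (var z ^ M) F = 0"
  shows "F = 0"
  using F
proof (induction M arbitrary: F)
  case (Suc M)
  have "contract (var z) F \<in> perp (M + t) I"
    using contract_in_perp [OF I var_forms(1), of F "M + t"] Suc.prems(1) by simp
  moreover have "contract (var z ^ M) (contract (var z) F) = 0"
    using Suc.prems(2) by (simp add: contract_mult [symmetric] mult.commute)
  ultimately have "contract (var z) F = 0" using Suc.IH by blast
  moreover have "var_injective z I (M + t)" using inj by simp
  ultimately show ?case using Suc.prems(1) by (simp add: var_injective_def)
qed simp

lemma hilb_mono_Suc:
  assumes I: "homogeneous_ideal I" and nzd: "regular_mod (var z) I"
  shows "hilb I i \<le> hilb I (Suc i)"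
proof -
  obtain B where B: "finite B" "perp (Suc i) I \<subseteq> vs.span B" using perp_finite_span by blast
  have "contract (var z) ` perp (Suc i) I = perp i I"
    using contract_perp_surj [OF I var_forms(1) nzd, of i] by simp
  then show ?thesis
    using vs.rank_nullity [OF linear_contract subspace_perp B(2,1), of "var z"]
    by (simp add: hilb_eq_dim_perp [OF I])
qed

lemma hilb_mono:
  assumes I: "homogeneous_ideal I" and nzd: "regular_mod (var z) I" and "i \<le> j"
  shows "hilb I i \<le> hilb I j"
  using hilb_mono_Suc [OF I nzd] \<open>i \<le> j\<close> by (rule lift_Suc_mono_le)

lemma hilb_Suc_eq:
  assumes I: "homogeneous_ideal I" and nzd: "regular_mod (var z) I"
    and inj: "var_injective z I i"
  shows "hilb I (Suc i) = hilb I i"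
proof -
  obtain B where B: "finite B" "perp (Suc i) I \<subseteq> vs.span B" using perp_finite_span by blast
  have "contract (var z) ` perp (Suc i) I = perp i I"
    using contract_perp_surj [OF I var_forms(1) nzd, of i] by simp
  then show ?thesis
    using vs.dim_image_inj [OF linear_contract subspace_perp B(2,1), of "var z"] inj
    unfolding var_injective_def by (simp add: hilb_eq_dim_perp [OF I])
qed

lemma var_injective_if_hilb_eq:
  assumes I: "homogeneous_ideal I" and nzd: "regular_mod (var z) I"
    and eq: "hilb I (Suc i) = hilb I i"
  shows "var_injective z I i"
  unfolding var_injective_def
proof (intro ballI impI)
  fix F assume F: "F \<in> perp (Suc i) I" "contract (var z) F = 0"
  obtain B where B: "finite B" "perp (Suc i) I \<subseteq> vs.span B" using perp_finite_span by blast
  have "contract (var z) ` perp (Suc i) I = perp i I"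
    using contract_perp_surj [OF I var_forms(1) nzd, of i] by simp
  then show "F = 0"
    using vs.kernel_trivial_if_dim_image_ge [OF linear_contract subspace_perp B(2,1) _ F] eq
    by (simp add: hilb_eq_dim_perp [OF I])
qed

lemma scheme_degreeI:
  assumes "eventually (\<lambda>i. hilb I i = s) sequentially"
  shows "scheme_degree I = s"
  unfolding scheme_degree_def
proof (rule the_equality)
  fix t assume "eventually (\<lambda>i. hilb I i = t) sequentially"
  with assms have "eventually (\<lambda>i. hilb I i = s \<and> hilb I i = t) sequentially"
    by (rule eventually_conj)
  then show "t = s" by (auto simp: eventually_sequentially)
qed (rule assms)

text \<open>
  Where contraction by \<open>z\<close> is bijective, the Hilbert function has reached its eventual value.
\<close>

lemma hilb_constant:
  assumes I: "homogeneous_ideal I" and nzd: "regular_mod (var z) I"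
    and inj: "\<forall>j\<ge>t. var_injective z I j"
    and "t \<le> i"
  shows "hilb I i = scheme_degree I"
proof -
  have const: "hilb I j = hilb I t" if "t \<le> j" for j
    using that
  proof (induction j rule: dec_induct)
    case (step j)
    then show ?case using hilb_Suc_eq [OF I nzd, of j] inj by simp
  qed simp
  then have "eventually (\<lambda>i. hilb I i = hilb I t) sequentially"
    unfolding eventually_sequentially by blast
  then have "scheme_degree I = hilb I t" by (rule scheme_degreeI)
  then show ?thesis using const [OF \<open>t \<le> i\<close>] by simp
qed

lemma punctual_hilb:
  assumes I: "punctual z a I" and N: "ideal_pow (point_ideal z a) N \<subseteq> I" "N \<le> Suc i"
  shows "hilb I i = scheme_degree I"
proof (rule hilb_constant [OF punctualD [OF I]])
  show "\<forall>j\<ge>N - 1. var_injective z I j"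
    using var_injective_high_degree [OF punctualD(1) [OF I] N(1)] by auto
qed (use N(2) in simp)

lemma hilb_from_tau:
  assumes I: "homogeneous_ideal I" and nzd: "regular_mod (var z) I"
    and ev: "eventually (\<lambda>i. hilb I i = s) sequentially" and i: "tau I \<le> i"
  shows "hilb I i = s"
proof -
  have s: "scheme_degree I = s" using ev by (rule scheme_degreeI)
  obtain M where M: "\<And>j. M \<le> j \<Longrightarrow> hilb I j = s" using ev by (auto simp: eventually_sequentially)
  have "hilb I (tau I) = s"
    unfolding tau_def s by (rule LeastI [of _ M]) (simp add: M)
  then have "s \<le> hilb I i" using hilb_mono [OF I nzd i] by simp
  moreover have "hilb I i \<le> s" using hilb_mono [OF I nzd, of i "max i M"] M [of "max i M"] by simp
  ultimately show ?thesis by simp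
qed

text \<open>
  From \<open>tau I\<close> on the Hilbert function is constant, and a surjection between spaces of equal finite
  dimension is injective.
\<close>

lemma var_injective_from_tau:
  assumes I: "homogeneous_ideal I" and nzd: "regular_mod (var z) I"
    and ev: "eventually (\<lambda>i. hilb I i = s) sequentially" and i: "tau I \<le> i"
  shows "var_injective z I i"
  using var_injective_if_hilb_eq [OF I nzd] hilb_from_tau [OF I nzd ev] i by simp

section \<open>Sums of inverse systems\<close>

lemma subspace_sumI: "(\<And>u. u \<in> A \<Longrightarrow> F u \<in> W u) \<Longrightarrow> (\<Sum>u\<in>A. F u) \<in> subspace_sum A W"
  by (auto simp: subspace_sum_def)

lemma subspace_subspace_sum:
  assumes "\<And>u. u \<in> A \<Longrightarrow> vs.subspace (W u)"
  shows "vs.subspace (subspace_sum A W)"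
  unfolding vs.subspace_def
proof (intro conjI ballI allI)
  show "0 \<in> subspace_sum A W"
    using subspace_sumI [of A "\<lambda>_. 0" W] assms vs.subspace_0 by force
next
  fix x y assume "x \<in> subspace_sum A W" "y \<in> subspace_sum A W"
  then obtain F G where "x = (\<Sum>u\<in>A. F u)" "y = (\<Sum>u\<in>A. G u)" "\<forall>u\<in>A. F u \<in> W u" "\<forall>u\<in>A. G u \<in> W u"
    by (auto simp: subspace_sum_def)
  then show "x + y \<in> subspace_sum A W"
    using subspace_sumI [of A "\<lambda>u. F u + G u" W] vs.subspace_add [OF assms] by (simp add: sum.distrib)
next
  fix c x assume "x \<in> subspace_sum A W"
  then obtain F where "x = (\<Sum>u\<in>A. F u)" "\<forall>u\<in>A. F u \<in> W u" by (auto simp: subspace_sum_def)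
  then show "scale c x \<in> subspace_sum A W"
    using subspace_sumI [of A "\<lambda>u. scale c (F u)" W] vs.subspace_scale [OF assms]
    by (simp add: vs.scale_sum_right)
qed

lemma subset_subspace_sum:
  assumes "finite A" "u \<in> A" "\<And>v. v \<in> A \<Longrightarrow> vs.subspace (W v)"
  shows "W u \<subseteq> subspace_sum A W"
proof
  fix x assume "x \<in> W u"
  then have "(\<Sum>v\<in>A. if v = u then x else 0) \<in> subspace_sum A W"
    using assms by (intro subspace_sumI) (auto intro: vs.subspace_0)
  then show "x \<in> subspace_sum A W" using assms by simp
qed

lemma subspace_sum_insert:
  assumes "finite A" "u \<notin> A"
  shows "subspace_sum (insert u A) W = {x + y | x y. x \<in> W u \<and> y \<in> subspace_sum A W}"
proof
  show "subspace_sum (insert u A) W \<subseteq> {x + y | x y. x \<in> W u \<and> y \<in> subspace_sum A W}"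
  proof
    fix x assume "x \<in> subspace_sum (insert u A) W"
    then obtain F where F: "x = (\<Sum>v\<in>insert u A. F v)" "\<forall>v\<in>insert u A. F v \<in> W v"
      by (auto simp: subspace_sum_def)
    then have "x = F u + (\<Sum>v\<in>A. F v)" using assms by simp
    then show "x \<in> {x + y | x y. x \<in> W u \<and> y \<in> subspace_sum A W}"
      using F(2) subspace_sumI [of A F W] by blast
  qed
  show "{x + y | x y. x \<in> W u \<and> y \<in> subspace_sum A W} \<subseteq> subspace_sum (insert u A) W"
  proof clarify
    fix x y assume x: "x \<in> W u" and "y \<in> subspace_sum A W"
    then obtain F where F: "y = (\<Sum>v\<in>A. F v)" "\<forall>v\<in>A. F v \<in> W v" by (auto simp: subspace_sum_def)
    have "(\<Sum>v\<in>A. F v) = (\<Sum>v\<in>A. (F(u := x)) v)" using assms by (intro sum.cong) auto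
    then have "x + y = (\<Sum>v\<in>insert u A. (F(u := x)) v)" using assms F(1) by simp
    also have "\<dots> \<in> subspace_sum (insert u A) W" using F(2) x by (intro subspace_sumI) auto
    finally show "x + y \<in> subspace_sum (insert u A) W" .
  qed
qed

text \<open>
  The second half of \<open>is_direct_sum\<close>.
\<close>

definition independent_family :: "'i set \<Rightarrow> ('i \<Rightarrow> ('v, 'a::field) mpoly set) \<Rightarrow> bool"
  where "independent_family A W \<longleftrightarrow>
    (\<forall>F. (\<forall>u\<in>A. F u \<in> W u) \<and> (\<Sum>u\<in>A. F u) = 0 \<longrightarrow> (\<forall>u\<in>A. F u = 0))"

lemma independent_familyD:
  "independent_family A W \<Longrightarrow> (\<And>u. u \<in> A \<Longrightarrow> F u \<in> W u) \<Longrightarrow> (\<Sum>u\<in>A. F u) = 0 \<Longrightarrow> u \<in> A \<Longrightarrow> F u = 0"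
  unfolding independent_family_def by blast

lemma dim_subspace_sum:
  fixes W :: "'i \<Rightarrow> ('v::finite, 'a::field) mpoly set"
  assumes "finite A" "\<And>u. u \<in> A \<Longrightarrow> vs.subspace (W u)" "\<And>u. u \<in> A \<Longrightarrow> W u \<subseteq> forms i"
    and "independent_family A W"
  shows "vs.dim (subspace_sum A W) = (\<Sum>u\<in>A. vs.dim (W u))"
  using assms
proof (induction A)
  case empty
  have "subspace_sum {} W = {0}" by (auto simp: subspace_sum_def)
  then show ?case by (simp add: vs.dim_singleton_0)
next
  case (insert u A)
  have ind: "independent_family A W"
    unfolding independent_family_def
  proof (intro allI impI ballI)
    fix F v assume F: "(\<forall>u\<in>A. F u \<in> W u) \<and> (\<Sum>u\<in>A. F u) = 0" and v: "v \<in> A"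
    have "(F(u := 0)) v = 0"
    proof (rule independent_familyD [OF insert.prems(3), of "F(u := 0)" v])
      have "(\<Sum>x\<in>A. (F(u := 0)) x) = (\<Sum>x\<in>A. F x)" using insert.hyps by (intro sum.cong) auto
      then show "(\<Sum>x\<in>insert u A. (F(u := 0)) x) = 0" using F insert.hyps by simp
    qed (use F v insert.prems(1) vs.subspace_0 in auto)
    then show "F v = 0" using v insert.hyps by (auto split: if_splits)
  qed
  have disj: "W u \<inter> subspace_sum A W = {0}"
  proof -
    have "x = 0" if "x \<in> W u" "x \<in> subspace_sum A W" for x
    proof -
      obtain F where F: "x = (\<Sum>v\<in>A. F v)" "\<forall>v\<in>A. F v \<in> W v"
        using \<open>x \<in> subspace_sum A W\<close> by (auto simp: subspace_sum_def)
      have "(F(u := - x)) u = 0"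
      proof (rule independent_familyD [OF insert.prems(3), of "F(u := - x)" u])
        have "(\<Sum>v\<in>A. (F(u := - x)) v) = (\<Sum>v\<in>A. F v)" using insert.hyps by (intro sum.cong) auto
        then show "(\<Sum>v\<in>insert u A. (F(u := - x)) v) = 0" using F insert.hyps by simp
      qed (use F \<open>x \<in> W u\<close> insert.prems(1) vs.subspace_neg in auto)
      then show ?thesis by simp
    qed
    moreover have "0 \<in> W u" "0 \<in> subspace_sum A W"
      using insert.prems(1) subspace_subspace_sum [of A W] vs.subspace_0 by blast+
    ultimately show ?thesis by blast
  qed
  have sub: "subspace_sum A W \<subseteq> forms i"
    using insert.prems(2) by (auto simp: subspace_sum_def intro!: vs.subspace_sum [OF subspace_forms])
  obtain B :: "('v, 'a) mpoly set" where B: "finite B" "forms i \<subseteq> vs.span B" using forms_finite_span by blast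
  have "vs.dim (subspace_sum (insert u A) W) = vs.dim (W u) + vs.dim (subspace_sum A W)"
    unfolding subspace_sum_insert [OF insert.hyps]
  proof (rule vs.dim_plus_eq [where B = B and C = B])
    show "vs.subspace (W u)" "vs.subspace (subspace_sum A W)"
      using insert.prems(1) subspace_subspace_sum [of A W] by simp_all
    show "W u \<subseteq> vs.span B" using insert.prems(2) [of u] B(2) by blast
    show "subspace_sum A W \<subseteq> vs.span B" using sub B(2) by blast
  qed (use B disj in auto)
  then show ?case using insert.IH insert.prems insert.hyps ind by simp
qed

text \<open>
  A form that annihilates the sum of the annihilators lies in the double annihilator of each
  \<open>I u\<close>, hence in the intersection.  The inclusion follows by taking annihilators again.
\<close>

lemma perp_Inter:
  fixes I :: "'i \<Rightarrow> ('v::finite, 'a::field) mpoly set"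
  assumes "finite A" and I: "\<And>u. u \<in> A \<Longrightarrow> homogeneous_ideal (I u)"
  shows "perp i (\<Inter>u\<in>A. I u) = subspace_sum A (\<lambda>u. perp i (I u))"
proof
  let ?S = "subspace_sum A (\<lambda>u. perp i (I u))"
  have S: "vs.subspace ?S" by (intro subspace_subspace_sum subspace_perp)
  have Sf: "?S \<subseteq> forms i"
    using perp_subset_forms by (fastforce simp: subspace_sum_def intro!: vs.subspace_sum [OF subspace_forms])
  show "?S \<subseteq> perp i (\<Inter>u\<in>A. I u)"
  proof -
    have "perp i (I u) \<subseteq> perp i (\<Inter>u\<in>A. I u)" if "u \<in> A" for u
      using that by (intro perp_antimono) auto
    then show ?thesis
      by (fastforce simp: subspace_sum_def intro!: vs.subspace_sum [OF subspace_perp])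
  qed
  have "perp i ?S \<subseteq> I u" if u: "u \<in> A" for u
  proof -
    have "perp i (I u \<inter> forms i) \<subseteq> ?S"
      unfolding perp_Int_forms
      using subset_subspace_sum [OF assms(1) u, of "\<lambda>u. perp i (I u)"] by (simp add: subspace_perp)
    then have "perp i ?S \<subseteq> perp i (perp i (I u \<inter> forms i))" by (rule perp_antimono)
    also have "\<dots> \<subseteq> I u" using perp_perp [OF subspace_ideal_forms [OF I [OF u]]] by blast
    finally show ?thesis .
  qed
  then have "perp i (\<Inter>u\<in>A. I u) \<subseteq> perp i (perp i ?S)" by (intro perp_antimono) blast
  then show "perp i (\<Inter>u\<in>A. I u) \<subseteq> ?S" using perp_perp [OF S Sf] by simp
qed

lemma punctual_Inter:
  assumes "\<forall>u\<in>A. punctual z (a u) (I u)"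
  shows "homogeneous_ideal (\<Inter>u\<in>A. I u)" "regular_mod (var z) (\<Inter>u\<in>A. I u)"
  using assms by (auto simp: punctual_def regular_mod_def intro!: homogeneous_ideal_Inter)

text \<open>
  Fix \<open>u\<close> and let \<open>h\<close> be a separating form, in \<open>I v\<close> for \<open>v \<noteq> u\<close> and not vanishing at the point of
  \<open>u\<close>.  Contracting the relation \<open>\<Sum>F\<^sub>v = 0\<close> by \<open>h\<close> leaves \<open>h \<circ> F\<^sub>u = 0\<close>.  Modulo \<open>I u\<close> a power of \<open>z\<close> is a
  multiple of \<open>h\<close>, so this power kills \<open>F\<^sub>u\<close> too, and in high degrees this implies
  \<open>F\<^sub>u = 0\<close>.
\<close>

lemma independent_perps_high_degree:
  fixes I :: "'i \<Rightarrow> ('v::finite, 'a::field) mpoly set"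
  assumes fin: "finite A" and az: "\<And>u. u \<in> A \<Longrightarrow> a u z = 1" and inj: "inj_on a A"
    and I: "\<And>u. u \<in> A \<Longrightarrow> punctual z (a u) (I u)"
  shows "eventually (\<lambda>i. independent_family A (\<lambda>u. perp i (I u))) sequentially"
proof -
  have "eventually (\<lambda>i. \<forall>F. (\<forall>v\<in>A. F v \<in> perp i (I v)) \<and> (\<Sum>v\<in>A. F v) = 0 \<longrightarrow> F u = 0) sequentially"
    if u: "u \<in> A" for u
  proof -
    have hom: "homogeneous_ideal (I v)" if "v \<in> A" for v using I [OF that] by (simp add: punctual_def)
    have "insert u (A - {u}) = A" using u by blast
    then obtain e h where h: "h \<in> forms e" "h \<notin> point_ideal z (a u)" "\<forall>v\<in>A - {u}. h \<in> I v"
      using separating_form [of "A - {u}" u a z I] fin az inj I by auto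
    obtain N where N: "ideal_pow (point_ideal z (a u)) N \<subseteq> I u"
      using I [OF u] by (auto simp: punctual_def)
    obtain r where r: "var z ^ (e * N) - r * h \<in> I u"
      using var_power_in_principal_plus_power [OF h(1,2)] N by blast
    have "F u = 0" if i: "e * N + N \<le> i" and F: "\<forall>v\<in>A. F v \<in> perp i (I v)" "(\<Sum>v\<in>A. F v) = 0" for i F
    proof -
      have "contract h (F v) = 0" if "v \<in> A - {u}" for v
        using contract_ideal_perp [OF hom] h(3) F(1) that by blast
      then have "contract h (\<Sum>v\<in>A. F v) = contract h (F u)"
        unfolding contract_sum_right using fin u by (subst sum.remove [of A u]) auto
      then have "contract h (F u) = 0" using F(2) by simp
      moreover have "contract (var z ^ (e * N) - r * h) (F u) = 0"
        using contract_ideal_perp [OF hom [OF u] r] F(1) u by blast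
      ultimately have "contract (var z ^ (e * N)) (F u) = 0"
        by (simp add: contract_minus_left contract_mult)
      moreover have "F u \<in> perp (e * N + (i - e * N)) (I u)" using F(1) u i by simp
      moreover have "\<forall>j\<ge>i - e * N. var_injective z (I u) j"
        using var_injective_high_degree [OF hom [OF u] N] i by simp
      ultimately show ?thesis
        using contract_var_power_inj [OF hom [OF u], of "i - e * N" z "F u" "e * N"] by blast
    qed
    then show ?thesis unfolding eventually_sequentially by blast
  qed
  then have "eventually (\<lambda>i. \<forall>u\<in>A. \<forall>F. (\<forall>v\<in>A. F v \<in> perp i (I v)) \<and> (\<Sum>v\<in>A. F v) = 0 \<longrightarrow> F u = 0) sequentially"
    using fin by (intro eventually_ball_finite) auto
  then show ?thesis by (rule eventually_mono) (auto simp: independent_family_def)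
qed

lemma hilb_Inter_eq_sum:
  fixes I :: "'i \<Rightarrow> ('v::finite, 'a::field) mpoly set"
  assumes fin: "finite A" and hom: "\<And>u. u \<in> A \<Longrightarrow> homogeneous_ideal (I u)"
    and ind: "independent_family A (\<lambda>u. perp i (I u))"
  shows "hilb (\<Inter>u\<in>A. I u) i = (\<Sum>u\<in>A. hilb (I u) i)"
proof -
  have "hilb (\<Inter>u\<in>A. I u) i = vs.dim (subspace_sum A (\<lambda>u. perp i (I u)))"
    using hilb_eq_dim_perp [of "\<Inter>u\<in>A. I u" i] homogeneous_ideal_Inter [of A I]
      perp_Inter [of A I i] fin hom by simp
  also have "\<dots> = (\<Sum>u\<in>A. vs.dim (perp i (I u)))"
    by (rule dim_subspace_sum [OF fin subspace_perp perp_subset_forms ind])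
  finally show ?thesis using hilb_eq_dim_perp [OF hom] by simp
qed

text \<open>
  The degree of a disjoint union is the sum of the degrees.
\<close>

lemma eventually_hilb_Inter:
  fixes I :: "'i \<Rightarrow> ('v::finite, 'a::field) mpoly set"
  assumes fin: "finite A" and az: "\<And>u. u \<in> A \<Longrightarrow> a u z = 1" and inj: "inj_on a A"
    and I: "\<And>u. u \<in> A \<Longrightarrow> punctual z (a u) (I u)"
  shows "eventually (\<lambda>i. hilb (\<Inter>u\<in>A. I u) i = (\<Sum>u\<in>A. scheme_degree (I u))) sequentially"
proof -
  have hom: "homogeneous_ideal (I v)" if "v \<in> A" for v using I [OF that] by (simp add: punctual_def)
  have "eventually (\<lambda>i. hilb (I u) i = scheme_degree (I u)) sequentially" if "u \<in> A" for u
  proof -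
    obtain N where "ideal_pow (point_ideal z (a u)) N \<subseteq> I u"
      using I [OF \<open>u \<in> A\<close>] by (auto simp: punctual_def)
    then have "hilb (I u) i = scheme_degree (I u)" if "N \<le> i" for i
      using punctual_hilb [OF I [OF \<open>u \<in> A\<close>], of N i] that by simp
    then show ?thesis by (auto simp: eventually_sequentially)
  qed
  then have "eventually (\<lambda>i. \<forall>u\<in>A. hilb (I u) i = scheme_degree (I u)) sequentially"
    using fin by (intro eventually_ball_finite) auto
  moreover have "eventually (\<lambda>i. independent_family A (\<lambda>u. perp i (I u))) sequentially"
    by (rule independent_perps_high_degree [OF fin az inj I])
  ultimately show ?thesis
  proof eventually_elim
    case (elim i)
    have "hilb (\<Inter>u\<in>A. I u) i = (\<Sum>u\<in>A. hilb (I u) i)"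
      by (rule hilb_Inter_eq_sum [OF fin hom elim(2)])
    then show ?case using elim(1) by simp
  qed
qed

text \<open>
  A relation in degree \<open>i\<close> is lifted to degree \<open>M + i\<close>, where the summands are known to be independent.
  The terms lift along \<open>z\<^sup>M\<close> by surjectivity; the sum of the lifts lies in the inverse system of the
  intersection and is killed by \<open>z\<^sup>M\<close>, so it vanishes, because contraction by \<open>z\<close> is injective
  there from \<open>tau\<close> on.
\<close>

lemma independent_perps_from_tau:
  fixes I :: "'i \<Rightarrow> ('v::finite, 'a::field) mpoly set"
  assumes fin: "finite A" and az: "\<And>u. u \<in> A \<Longrightarrow> a u z = 1" and inj: "inj_on a A"
    and I: "\<And>u. u \<in> A \<Longrightarrow> punctual z (a u) (I u)" and i: "tau (\<Inter>u\<in>A. I u) \<le> i"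
  shows "independent_family A (\<lambda>u. perp i (I u))"
  unfolding independent_family_def
proof (intro allI impI ballI)
  fix F u assume F: "(\<forall>u\<in>A. F u \<in> perp i (I u)) \<and> (\<Sum>u\<in>A. F u) = 0" and u: "u \<in> A"
  let ?J = "\<Inter>u\<in>A. I u"
  have hom: "homogeneous_ideal (I v)" if "v \<in> A" for v using I [OF that] by (simp add: punctual_def)
  have J: "homogeneous_ideal ?J" "regular_mod (var z) ?J"
    using punctual_Inter [of A z a I] I by simp_all
  obtain M where M: "\<And>j. M \<le> j \<Longrightarrow> independent_family A (\<lambda>u. perp j (I u))"
    using independent_perps_high_degree [OF fin az inj I] by (auto simp: eventually_sequentially)
  have "\<exists>G. G \<in> perp (M + i) (I v) \<and> contract (var z ^ M) G = F v" if "v \<in> A" for v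
  proof -
    have "contract (var z ^ M) ` perp (M + i) (I v) = perp i (I v)"
      by (intro contract_perp_surj hom that var_power_forms regular_mod_power punctualD(2) [OF I])
    then show ?thesis using F that by (metis (no_types, lifting) imageE)
  qed
  then obtain G where G: "\<And>v. v \<in> A \<Longrightarrow> G v \<in> perp (M + i) (I v)" "\<And>v. v \<in> A \<Longrightarrow> contract (var z ^ M) (G v) = F v"
    by metis
  have ev: "eventually (\<lambda>i. hilb ?J i = (\<Sum>u\<in>A. scheme_degree (I u))) sequentially"
    by (rule eventually_hilb_Inter [OF fin az inj I])
  have "(\<Sum>v\<in>A. G v) = 0"
  proof (rule contract_var_power_inj [OF J(1), of i z])
    show "(\<Sum>v\<in>A. G v) \<in> perp (M + i) ?J"
      using perp_Inter [of A I "M + i"] fin hom subspace_sumI [of A G] G(1) by simp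
    show "contract (var z ^ M) (\<Sum>v\<in>A. G v) = 0"
      using F G(2) by (simp add: contract_sum_right)
    show "\<forall>j\<ge>i. var_injective z ?J j"
      using var_injective_from_tau [OF J ev] i by simp
  qed
  then have "G u = 0" using independent_familyD [OF M [of "M + i"], of G u] G(1) u by simp
  then show "F u = 0" using G(2) [OF u] by simp
qed

section \<open>Divided power multiples of a power of a linear form\<close>

definition dp_coeff :: "('v::finite \<Rightarrow>\<^sub>0 nat) \<Rightarrow> ('v \<Rightarrow>\<^sub>0 nat) \<Rightarrow> nat"
  where "dp_coeff U V = (\<Prod>v\<in>UNIV. lookup (U + V) v choose lookup U v)"

lemma dp_mult_eq:
  "dp_mult F G = (\<Sum>U\<in>keys F. \<Sum>V\<in>keys G.
    single (U + V) (of_nat (dp_coeff U V) * lookup F U * lookup G V))"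
  by (simp add: dp_mult_def dp_coeff_def)

lemma dp_mult_0_left [simp]: "dp_mult 0 G = 0"
  by (simp add: dp_mult_eq)

lemma dp_mult_0_right [simp]: "dp_mult F 0 = 0"
  by (simp add: dp_mult_eq)

lemma dp_mult_single:
  "dp_mult (single U c) (single V d) = single (U + V) (of_nat (dp_coeff U V) * c * d)"
  by (simp add: dp_mult_eq)

lemma dp_mult_add_left: "dp_mult (F + F') G = dp_mult F G + dp_mult F' G"
  unfolding dp_mult_eq
  by (rule sum_keys_add [where \<theta> = "\<lambda>U c. \<Sum>V\<in>keys G.
        single (U + V) (of_nat (dp_coeff U V) * c * lookup G V)"])
    (simp_all add: algebra_simps single_add sum.distrib)

lemma dp_mult_add_right: "dp_mult F (G + G') = dp_mult F G + dp_mult F G'"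
proof -
  have "(\<Sum>V\<in>keys (G + G'). single (U + V) (of_nat (dp_coeff U V) * lookup F U * lookup (G + G') V)) =
      (\<Sum>V\<in>keys G. single (U + V) (of_nat (dp_coeff U V) * lookup F U * lookup G V)) +
      (\<Sum>V\<in>keys G'. single (U + V) (of_nat (dp_coeff U V) * lookup F U * lookup G' V))" for U
    by (rule sum_keys_add [where \<theta> = "\<lambda>V c.
          single (U + V) (of_nat (dp_coeff U V) * lookup F U * c)"])
      (simp_all add: algebra_simps single_add)
  then show ?thesis by (simp add: dp_mult_eq sum.distrib)
qed

lemma dp_mult_scale_left: "dp_mult (scale c F) G = scale c (dp_mult F G)"
proof (induction F rule: poly_induct)
  case (single U d)
  show ?case
    by (induction G rule: poly_induct)
      (simp_all add: dp_mult_single dp_mult_add_right vs.scale_right_distrib mult_ac)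
qed (simp_all add: dp_mult_add_left vs.scale_right_distrib)

lemma dp_mult_scale_right: "dp_mult F (scale c G) = scale c (dp_mult F G)"
proof (induction F rule: poly_induct)
  case (single U d)
  show ?case
    by (induction G rule: poly_induct)
      (simp_all add: dp_mult_single dp_mult_add_right vs.scale_right_distrib mult_ac)
qed (simp_all add: dp_mult_add_left vs.scale_right_distrib)

lemma linear_dp_mult: "Vector_Spaces.linear scale scale (\<lambda>F. dp_mult F G)"
  by unfold_locales (simp_all add: dp_mult_add_left dp_mult_scale_left)

lemma dp_mult_diff_left: "dp_mult (F - F') G = dp_mult F G - dp_mult F' G"
  using dp_mult_add_left [of "F - F'" F' G] by simp

lemma dp_mult_diff_right: "dp_mult F (G - G') = dp_mult F G - dp_mult F G'"
  using dp_mult_add_right [of F "G - G'" G'] by simp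

lemma dp_mult_forms: "F \<in> forms d \<Longrightarrow> G \<in> forms e \<Longrightarrow> dp_mult F G \<in> forms (d + e)"
  unfolding dp_mult_eq
  by (intro vs.subspace_sum [OF subspace_forms]) (auto simp: forms_def)

lemma contract_var_single_add:
  "contract (var v) (single (single v 1 + U) d) = single U d"
  by (rule poly_mapping_eqI) (simp add: var_def lookup_single when_def)

lemma contract_var_single_0:
  assumes "lookup U v = 0"
  shows "contract (var v) (single U d) = 0"
proof (rule poly_mapping_eqI)
  fix V
  have "lookup (single v 1 + V) v \<noteq> lookup U v" using assms by (simp add: lookup_add)
  then have "U \<noteq> single v 1 + V" by metis
  then show "lookup (contract (var v) (single U d)) V = lookup 0 V"
    by (simp add: var_def lookup_single)
qed

lemma dp_coeff_split:
  "dp_coeff U V = (lookup U v + lookup V v choose lookup U v) *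
    (\<Prod>w\<in>UNIV - {v}. lookup U w + lookup V w choose lookup U w)"
  by (simp add: dp_coeff_def lookup_add prod.remove [of UNIV v])

text \<open>
  Pascal's rule in the variable \<open>v\<close>, with its two boundary cases.
\<close>

lemma dp_coeff_single_add:
  fixes U V :: "'v::finite \<Rightarrow>\<^sub>0 nat" and v :: 'v
  defines "E \<equiv> single v 1"
  shows "dp_coeff (E + U) (E + V) = dp_coeff U (E + V) + dp_coeff (E + U) V"
    and "lookup V v = 0 \<Longrightarrow> dp_coeff (E + U) V = dp_coeff U V"
    and "lookup U v = 0 \<Longrightarrow> dp_coeff U (E + V) = dp_coeff U V"
proof -
  have prod: "(\<Prod>w\<in>UNIV - {v}. lookup (E + U) w + lookup (E + V) w choose lookup (E + U) w) =
      (\<Prod>w\<in>UNIV - {v}. lookup U w + lookup V w choose lookup U w)"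
    "(\<Prod>w\<in>UNIV - {v}. lookup (E + U) w + lookup V w choose lookup (E + U) w) =
      (\<Prod>w\<in>UNIV - {v}. lookup U w + lookup V w choose lookup U w)"
    "(\<Prod>w\<in>UNIV - {v}. lookup U w + lookup (E + V) w choose lookup U w) =
      (\<Prod>w\<in>UNIV - {v}. lookup U w + lookup V w choose lookup U w)"
    by (auto intro!: prod.cong simp: E_def lookup_add lookup_single)
  show "dp_coeff (E + U) (E + V) = dp_coeff U (E + V) + dp_coeff (E + U) V"
    unfolding dp_coeff_split [where v = v] prod
    by (simp add: E_def lookup_add distrib_right [symmetric])
  show "lookup V v = 0 \<Longrightarrow> dp_coeff (E + U) V = dp_coeff U V"
    unfolding dp_coeff_split [where v = v] prod by (simp add: E_def lookup_add)
  show "lookup U v = 0 \<Longrightarrow> dp_coeff U (E + V) = dp_coeff U V"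
    unfolding dp_coeff_split [where v = v] prod by (simp add: E_def lookup_add)
qed

text \<open>
  Contraction by a variable is a derivation of the divided power ring.  On monomials this is
  Pascal's rule.
\<close>

lemma contract_var_dp_mult:
  "contract (var v) (dp_mult F G) = dp_mult (contract (var v) F) G + dp_mult F (contract (var v) G)"
proof (induction F rule: poly_induct)
  case (single U c)
  show ?case
  proof (induction G rule: poly_induct)
    case (single V d)
    let ?E = "single v (1 :: nat)"
    show ?case
    proof (cases U v rule: exponent_cases; cases V v rule: exponent_cases)
      assume U: "lookup U v = 0" and V: "lookup V v = 0"
      then have "lookup (U + V) v = 0" by (simp add: lookup_add)
      then show ?thesis using U V by (simp add: dp_mult_single contract_var_single_0)
    next
      fix V' assume U: "lookup U v = 0" and V: "V = ?E + V'"
      show ?thesis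
        by (simp only: V dp_mult_single contract_var_single_0 [OF U] contract_var_single_add
            dp_coeff_single_add(3) [OF U] dp_mult_0_left add_0_left add.left_commute [of U ?E])
    next
      fix U' assume U: "U = ?E + U'" and V: "lookup V v = 0"
      show ?thesis
        by (simp only: U dp_mult_single contract_var_single_0 [OF V] contract_var_single_add
            dp_coeff_single_add(2) [OF V] dp_mult_0_right add_0_right add.assoc)
    next
      fix U' V' assume U: "U = ?E + U'" and V: "V = ?E + V'"
      have "contract (var v) (dp_mult (single U c) (single V d)) =
          single (U' + V) (of_nat (dp_coeff U V) * c * d)"
        by (simp only: U add.assoc dp_mult_single contract_var_single_add)
      also have "\<dots> = single (U' + V) (of_nat (dp_coeff U' V) * c * d) +
          single (U' + V) (of_nat (dp_coeff U V') * c * d)"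
        by (simp only: U V dp_coeff_single_add(1) of_nat_add distrib_right single_add)
      also have "U' + V = U + V'" by (simp only: U V ac_simps)
      finally show ?thesis
        by (simp only: U V dp_mult_single contract_var_single_add add.assoc add.left_commute [of U' ?E])
    qed
  qed (simp_all add: dp_mult_add_right contract_add_right)
qed (simp_all add: dp_mult_add_left contract_add_right)

lemma contract_point_gen_dp_mult:
  assumes "a z = 1"
  shows "contract (point_gen z a j) (dp_mult F (dp_linear_pow a m)) =
    dp_mult (contract (point_gen z a j) F) (dp_linear_pow a m)"
proof -
  have "contract (point_gen z a j) (dp_mult F G) =
      dp_mult (contract (point_gen z a j) F) G + dp_mult F (contract (point_gen z a j) G)" for G
    by (simp add: contract_minus_left contract_scale_left contract_var_dp_mult dp_mult_diff_left
        dp_mult_diff_right dp_mult_scale_left dp_mult_scale_right vs.scale_right_distrib)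
  then show ?thesis using contract_point_gen_dp_linear_pow [of a z j m, OF assms] by simp
qed

text \<open>
  The generators of the ideal of the point kill the divided powers of its linear form, so they act
  as if these were scalars.
\<close>

lemma contract_products_dp_mult:
  assumes "a z = 1" "p \<in> products (gens z a) n"
  shows "contract p (dp_mult F (dp_linear_pow a m)) = dp_mult (contract p F) (dp_linear_pow a m)"
  using assms(2)
proof (induction n arbitrary: p)
  case (Suc n)
  then obtain j q where "p = point_gen z a j * q" "q \<in> products (gens z a) n" by auto
  then show ?case using Suc.IH contract_point_gen_dp_mult [of a z] assms(1) by (simp add: contract_mult)
qed simp

lemma perp_point_powI:
  assumes F: "F \<in> forms i" and "\<And>p. p \<in> products (gens z a) n \<Longrightarrow> contract p F = 0"
  shows "F \<in> perp i (ideal_pow (point_ideal z a) n)"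
proof -
  have "contract h F = 0" if "h \<in> ideal_pow (point_ideal z a) n" for h
    using that unfolding point_pow_eq
    by (induction rule: ideal.span_induct_alt) (simp_all add: contract_add_left contract_mult assms(2))
  then show ?thesis using F by (simp add: perp_def pairing_def)
qed

lemma perp_point_pow_low_degree:
  assumes "i < n"
  shows "perp i (ideal_pow (point_ideal z a) n) = forms i"
proof
  show "forms i \<subseteq> perp i (ideal_pow (point_ideal z a) n)"
  proof
    fix F :: "('a, 'b) dpoly" assume F: "F \<in> forms i"
    then show "F \<in> perp i (ideal_pow (point_ideal z a) n)"
    proof (rule perp_point_powI)
      fix p assume "p \<in> products (gens z a) n"
      then have "p \<in> forms n" by (rule subsetD [OF products_forms [OF gens_forms]])
      then show "contract p F = 0" using assms by (intro contract_low_degree [OF _ F])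
    qed
  qed
qed (rule perp_subset_forms)

lemma dp_mult_linear_pow_in_perp:
  assumes "a z = 1" "F \<in> forms d"
  shows "dp_mult F (dp_linear_pow a m) \<in> perp (d + m) (ideal_pow (point_ideal z a) (d + 1))"
proof (rule perp_point_powI)
  show "dp_mult F (dp_linear_pow a m) \<in> forms (d + m)"
    by (rule dp_mult_forms [OF assms(2) dp_linear_pow_forms])
  fix p assume p: "p \<in> products (gens z a) (d + 1)"
  then have "contract p F = 0"
    using contract_low_degree [OF subsetD [OF products_forms [OF gens_forms] p] assms(2)] by simp
  then show "contract p (dp_mult F (dp_linear_pow a m)) = 0"
    using contract_products_dp_mult [OF assms(1) p] by simp
qed

text \<open>
  If \<open>x\<^sub>j - a\<^sub>j z\<close> kills \<open>F\<close>, then the coefficient of \<open>F\<close> at \<open>x\<^sub>j V\<close> is \<open>a\<^sub>j\<close> times that at \<open>z V\<close>.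
  Hence all coefficients are multiples of the one at \<open>z\<^sup>d\<close>; in other words \<open>F\<close> is a multiple of
  \<open>L\<^bsup>[d]\<^esup>\<close>.
\<close>

lemma eq_0_if_point_gens_kill:
  assumes F: "F \<in> forms d" and kill: "\<And>j. contract (point_gen z a j) F = 0" and 0: "lookup F (single z d) = 0"
  shows "F = 0"
proof (rule poly_mapping_eqI)
  fix U
  show "lookup F U = lookup 0 U"
  proof (induction "codegree z U" arbitrary: U)
    case 0
    then have "lookup U v = 0" if "v \<noteq> z" for v using that by (simp add: codegree_def)
    then have "U = single z (lookup U z)"
      by (intro poly_mapping_eqI) (auto simp: lookup_single when_def)
    then have "U = single z (mdeg U)" by (metis mdeg_single)
    then show ?case using \<open>lookup F (single z d) = 0\<close> lookup_forms [OF F, of U] by (cases "mdeg U = d") auto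
  next
    case (Suc n)
    have "\<exists>j. j \<noteq> z \<and> lookup U j \<noteq> 0"
    proof (rule ccontr)
      assume "\<nexists>j. j \<noteq> z \<and> lookup U j \<noteq> 0"
      then have "codegree z U = 0" unfolding codegree_def by (intro sum.neutral) auto
      then show False using Suc.hyps(2) by simp
    qed
    then obtain j where j: "j \<noteq> z" "lookup U j \<noteq> 0" by blast
    obtain V where U: "U = single j 1 + V" by (cases U j rule: exponent_cases) (use j(2) in simp)
    then have n: "n = codegree z (single z 1 + V)"
      using Suc.hyps(2) j(1) by (simp add: codegree_add codegree_single)
    have "lookup (contract (point_gen z a j) F) V = 0" using kill by simp
    then have "lookup F U = a j * lookup F (single z 1 + V)"
      by (simp add: U contract_minus_left contract_scale_left lookup_minus var_def)
    then show ?case using Suc.hyps(1) [OF n] by simp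
  qed
qed

lemma lookup_dp_mult_pure_power:
  assumes "F \<in> forms d" "G \<in> forms m"
  shows "lookup (dp_mult F G) (single z (d + m)) =
    of_nat (d + m choose d) * lookup F (single z d) * lookup G (single z m)"
proof -
  let ?Z = "\<lambda>n. single z n :: 'a \<Rightarrow>\<^sub>0 nat"
  have iff: "U + V = ?Z (d + m) \<longleftrightarrow> U = ?Z d \<and> V = ?Z m" if "U \<in> keys F" "V \<in> keys G" for U V
  proof
    assume eq: "U + V = ?Z (d + m)"
    have "lookup U v = 0 \<and> lookup V v = 0" if "v \<noteq> z" for v
    proof -
      have "lookup (U + V) v = 0" using that by (simp add: eq lookup_single)
      then show ?thesis by (simp add: lookup_add)
    qed
    then have "U = ?Z (lookup U z)" "V = ?Z (lookup V z)"
      by (auto intro!: poly_mapping_eqI simp: lookup_single when_def)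
    then have "U = ?Z (mdeg U)" "V = ?Z (mdeg V)" by (metis mdeg_single)+
    then show "U = ?Z d \<and> V = ?Z m" using that assms by (simp add: forms_def)
  qed (simp add: single_add)
  have coeff: "dp_coeff (?Z d) (?Z m) = (d + m choose d)"
    by (simp add: dp_coeff_split [of _ _ z] lookup_single)
  have "lookup (dp_mult F G) (?Z (d + m)) = (\<Sum>U\<in>keys F. \<Sum>V\<in>keys G.
      if V = ?Z m then if U = ?Z d then of_nat (dp_coeff U V) * lookup F U * lookup G V else 0 else 0)"
    unfolding dp_mult_eq lookup_sum
    by (intro sum.cong refl) (auto simp: lookup_single when_def iff)
  also have "\<dots> = of_nat (dp_coeff (?Z d) (?Z m)) * lookup F (?Z d) * lookup G (?Z m)"
    by (cases "lookup G (?Z m) = 0") (auto simp: in_keys_iff)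
  finally show ?thesis by (simp add: coeff)
qed

text \<open>
  \<open>n!\<close> is a multiple of the binomial coefficient, and it is a product of numbers that are nonzero
  in the field.
\<close>

lemma admissible_choose_nonzero:
  assumes "admissible_degree TYPE('a::field) n" "k \<le> n"
  shows "(of_nat (n choose k) :: 'a) \<noteq> 0"
proof -
  have "(of_nat j :: 'a) \<noteq> 0" if "1 \<le> j" "j \<le> n" for j
    using assms(1) that by (auto simp: admissible_degree_def of_nat_eq_0_iff_char_dvd dest: dvd_imp_le)
  then have "(of_nat (fact n) :: 'a) \<noteq> 0"
    by (simp add: fact_prod)
  moreover have "fact n = fact k * fact (n - k) * (n choose k)"
    using binomial_fact_lemma [OF assms(2)] by simp
  ultimately show ?thesis by (metis mult_zero_right of_nat_mult)
qed

text \<open>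
  By induction on \<open>d\<close> the contractions of \<open>F\<close> by the generators of the ideal of the point vanish, as
  their products with \<open>L\<^bsup>[m]\<^esup>\<close> do.  Then \<open>F\<close> is determined by its coefficient at \<open>z\<^sup>d\<close>, which occurs
  in the product at \<open>z\<^bsup>d + m\<^esup>\<close> with the factor \<open>d + m choose d\<close>.
\<close>

lemma dp_mult_linear_pow_inj:
  fixes a :: "'v::finite \<Rightarrow> 'a::field"
  assumes "a z = 1" "admissible_degree TYPE('a) (d + m)" "F \<in> forms d"
    and "dp_mult F (dp_linear_pow a m) = 0"
  shows "F = 0"
  using assms(2-)
proof (induction d arbitrary: F)
  have corner: "lookup F (single z d) = 0"
    if "admissible_degree TYPE('a) (d + m)" "F \<in> forms d" "dp_mult F (dp_linear_pow a m) = 0" for d F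
  proof -
    have "(\<Prod>v\<in>UNIV. a v ^ lookup (single z m) v) = 1"
      by (rule prod.neutral) (simp add: lookup_single when_def assms(1))
    then have "of_nat (d + m choose d) * lookup F (single z d) = 0"
      using lookup_dp_mult_pure_power [OF that(2) dp_linear_pow_forms, of a m z] that(3)
      by (simp add: lookup_dp_linear_pow)
    then show ?thesis using admissible_choose_nonzero [OF that(1), of d] by simp
  qed
  {
    case 0
    show ?case
    proof (rule eq_0_if_point_gens_kill [OF 0(2)])
      show "contract (point_gen z a j) F = 0" for j
        using contract_low_degree [OF point_gen_forms 0(2)] by simp
    qed (rule corner [OF 0])
  next
    case (Suc d)
    show ?case
    proof (rule eq_0_if_point_gens_kill [OF Suc.prems(2)])
      fix j
      show "contract (point_gen z a j) F = 0"
      proof (rule Suc.IH)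
        show "admissible_degree TYPE('a) (d + m)"
          using Suc.prems(1) by (auto simp: admissible_degree_def)
        show "contract (point_gen z a j) F \<in> forms d"
          using contract_forms [OF point_gen_forms, of F d] Suc.prems(2) by simp
        show "dp_mult (contract (point_gen z a j) F) (dp_linear_pow a m) = 0"
          using contract_point_gen_dp_mult [of a z j F m] assms(1) Suc.prems(3) by simp
      qed
    qed (rule corner [OF Suc.prems])
  }
qed

text \<open>
  For \<open>i \<le> \<alpha>\<close> both sides consist of all forms.  For \<open>i > \<alpha>\<close> multiplication by \<open>L\<^bsup>[i - \<alpha>]\<^esup>\<close>
  embeds \<open>\<Gamma>\<^sub>\<alpha>\<close> into the inverse system of \<open>m\<^bsup>\<alpha> + 1\<^esup>\<close> in degree
  \<open>i\<close>, and contraction by \<open>z\<^bsup>i - \<alpha>\<^esup>\<close> embeds the latter into \<open>\<Gamma>\<^sub>\<alpha>\<close>.  So the dimensions agree.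
\<close>

lemma dp_linear_multiples_eq_perp:
  fixes a :: "'v::finite \<Rightarrow> 'a::field"
  assumes az: "a z = 1" and adm: "admissible_degree TYPE('a) i"
  shows "dp_linear_multiples \<alpha> a i = perp i (ideal_pow (point_ideal z a) (\<alpha> + 1))"
proof (cases "i \<le> \<alpha>")
  case True
  then have "perp i (ideal_pow (point_ideal z a) (\<alpha> + 1)) = forms i"
    by (intro perp_point_pow_low_degree) simp
  then show ?thesis using True by (simp add: dp_linear_multiples_def)
next
  case False
  let ?J = "ideal_pow (point_ideal z a) (\<alpha> + 1)"
  let ?\<mu> = "\<lambda>F :: ('v, 'a) dpoly. dp_mult F (dp_linear_pow a (i - \<alpha>))"
  have hom: "homogeneous_ideal ?J" by (rule homogeneous_point_pow)
  interpret \<mu>: Vector_Spaces.linear scale scale ?\<mu> by (rule linear_dp_mult)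
  obtain B :: "('v, 'a) dpoly set" where B: "finite B" "forms \<alpha> \<subseteq> vs.span B" using forms_finite_span by blast
  obtain C :: "('v, 'a) dpoly set" where C: "finite C" "perp i ?J \<subseteq> vs.span C" using perp_finite_span by blast
  have "vs.dim (perp i ?J) \<le> vs.dim (forms \<alpha> :: ('v, 'a) dpoly set)"
  proof -
    have "F = 0" if "F \<in> perp i ?J" "contract (var z ^ (i - \<alpha>)) F = 0" for F
    proof (rule contract_var_power_inj [OF hom, of \<alpha> z F "i - \<alpha>"])
      show "\<forall>j\<ge>\<alpha>. var_injective z ?J j"
        using var_injective_high_degree [OF hom subset_refl] by simp
    qed (use that False in auto)
    then have "vs.dim (perp i ?J) = vs.dim (contract (var z ^ (i - \<alpha>)) ` perp i ?J)"
      using vs.dim_image_inj [OF linear_contract subspace_perp C(2,1)] by metis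
    also have "contract (var z ^ (i - \<alpha>)) ` perp i ?J \<subseteq> forms \<alpha>"
      using contract_forms [OF var_power_forms, of _ "i - \<alpha>" \<alpha> z] perp_subset_forms [of i ?J] False by auto
    then have "vs.dim (contract (var z ^ (i - \<alpha>)) ` perp i ?J) \<le> vs.dim (forms \<alpha> :: ('v, 'a) dpoly set)"
      by (rule vs.dim_subspace_mono [OF _ B(2,1)])
    finally show ?thesis .
  qed
  also have "\<dots> = vs.dim (?\<mu> ` forms \<alpha>)"
    using dp_mult_linear_pow_inj [of a z \<alpha> "i - \<alpha>"] az adm False
    by (intro vs.dim_image_inj [OF linear_dp_mult subspace_forms B(2,1), symmetric]) auto
  finally have le: "vs.dim (perp i ?J) \<le> vs.dim (?\<mu> ` forms \<alpha>)" .
  have "?\<mu> ` forms \<alpha> \<subseteq> perp i ?J"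
    using dp_mult_linear_pow_in_perp [of a z _ \<alpha> "i - \<alpha>"] az False by auto
  then have "?\<mu> ` forms \<alpha> = perp i ?J"
    by (intro vs.subspace_eqI_dim [OF _ subspace_perp _ C(2,1) le] \<mu>.subspace_image subspace_forms)
  moreover have "dp_linear_multiples \<alpha> a i = ?\<mu> ` forms \<alpha>"
    using False by (auto simp: dp_linear_multiples_def)
  ultimately show ?thesis by simp
qed

section \<open>The inverse system of one component\<close>

text \<open>
  This is \<open>perp_Inter\<close> in each degree.  An element has only finitely many nonzero components, so
  the decompositions of the components can be summed up.
\<close>

lemma inverse_system_Inter:
  fixes I :: "'i \<Rightarrow> ('v::finite, 'a::field) mpoly set"
  assumes fin: "finite A" and hom: "\<And>u. u \<in> A \<Longrightarrow> homogeneous_ideal (I u)"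
  shows "inverse_system (\<Inter>u\<in>A. I u) = subspace_sum A (\<lambda>u. inverse_system (I u))"
proof
  have perp: "perp j (\<Inter>u\<in>A. I u) = subspace_sum A (\<lambda>u. perp j (I u))" for j
    by (rule perp_Inter [OF fin hom])
  show "subspace_sum A (\<lambda>u. inverse_system (I u)) \<subseteq> inverse_system (\<Inter>u\<in>A. I u)"
  proof
    fix F assume "F \<in> subspace_sum A (\<lambda>u. inverse_system (I u))"
    then obtain G where G: "F = (\<Sum>u\<in>A. G u)" "\<forall>u\<in>A. G u \<in> inverse_system (I u)"
      by (auto simp: subspace_sum_def)
    have "component j F \<in> subspace_sum A (\<lambda>u. perp j (I u))" for j
      unfolding G(1) component_sum using G(2) by (intro subspace_sumI) (simp add: inverse_system_iff)
    then show "F \<in> inverse_system (\<Inter>u\<in>A. I u)" by (simp add: inverse_system_iff perp)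
  qed
  show "inverse_system (\<Inter>u\<in>A. I u) \<subseteq> subspace_sum A (\<lambda>u. inverse_system (I u))"
  proof
    fix F assume "F \<in> inverse_system (\<Inter>u\<in>A. I u)"
    then have "\<forall>j. \<exists>G. component j F = (\<Sum>u\<in>A. G u) \<and> (\<forall>u\<in>A. G u \<in> perp j (I u))"
      by (simp add: inverse_system_iff perp) (auto simp: subspace_sum_def)
    then obtain G where G: "\<And>j. component j F = (\<Sum>u\<in>A. G j u)" "\<And>j u. u \<in> A \<Longrightarrow> G j u \<in> perp j (I u)"
      by metis
    let ?D = "mdeg ` keys F"
    have "F = (\<Sum>j\<in>?D. component j F)" by (rule sum_components) auto
    also have "\<dots> = (\<Sum>u\<in>A. \<Sum>j\<in>?D. G j u)" unfolding G(1) by (rule sum.swap)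
    also have "\<dots> \<in> subspace_sum A (\<lambda>u. inverse_system (I u))"
    proof (rule subspace_sumI)
      fix u assume u: "u \<in> A"
      have "component i (G j u) = (if j = i then G i u else 0)" for i j
        using G(2) [OF u, of j] component_id [of "G j u" j] component_other [of "G j u" j i]
        by (auto simp: perp_def)
      then have "component i (\<Sum>j\<in>?D. G j u) = (if i \<in> ?D then G i u else 0)" for i
        by (simp add: component_sum)
      moreover have "0 \<in> perp i (I u)" for i by (rule vs.subspace_0 [OF subspace_perp])
      ultimately show "(\<Sum>j\<in>?D. G j u) \<in> inverse_system (I u)"
        using G(2) [OF u] by (simp add: inverse_system_iff)
    qed
    finally show "F \<in> subspace_sum A (\<lambda>u. inverse_system (I u))" .
  qed
qed

text \<open>
  Contraction by \<open>z\<^bsup>j - i\<^esup>\<close> alone is already surjective.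
\<close>

lemma perp_eq_span_contractions:
  fixes I :: "('v::finite, 'a::field) mpoly set"
  assumes I: "homogeneous_ideal I" and nzd: "regular_mod (var z) I" and "i \<le> j"
  shows "perp i I = vs.span {contract h F | h F. h \<in> forms (j - i) \<and> F \<in> perp j I}"
proof
  have j: "j - i + i = j" using \<open>i \<le> j\<close> by simp
  have "contract (var z ^ (j - i)) ` perp j I = perp i I"
    using contract_perp_surj [OF I var_power_forms regular_mod_power [OF nzd], of "j - i" i] by (simp add: j)
  then show "perp i I \<subseteq> vs.span {contract h F | h F. h \<in> forms (j - i) \<and> F \<in> perp j I}"
    using var_power_forms by (fastforce intro!: vs.span_base)
  show "vs.span {contract h F | h F. h \<in> forms (j - i) \<and> F \<in> perp j I} \<subseteq> perp i I"
  proof (rule vs.span_minimal [OF _ subspace_perp])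
    show "{contract h F | h F. h \<in> forms (j - i) \<and> F \<in> perp j I} \<subseteq> perp i I"
      using contract_in_perp [OF I, of _ "j - i" _ i] by (auto simp: j)
  qed
qed

text \<open>
  The component at the point of \<open>u\<close> is singled out.  In the application \<open>n\<close> is its socle degree.  The
  ideal \<open>whole\<close> is that of the union of the schemes, \<open>fat_point\<close> is that of an infinitesimal neighbourhood
  of the point that contains the component, and \<open>fattened\<close> is that of the union after the component has
  been replaced by this neighbourhood.
\<close>

locale scheme_component =
  fixes z :: "'v::finite" and A :: "'i set" and a :: "'i \<Rightarrow> 'v \<Rightarrow> 'a::field"
    and I :: "'i \<Rightarrow> ('v, 'a) mpoly set" and u :: 'i and n :: nat
  assumes finite: "finite A"
    and normalised: "\<And>v. v \<in> A \<Longrightarrow> a v z = 1"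
    and distinct: "inj_on a A"
    and punctual: "\<And>v. v \<in> A \<Longrightarrow> punctual z (a v) (I v)"
    and u: "u \<in> A"
    and point_pow: "ideal_pow (point_ideal z (a u)) (n + 1) \<subseteq> I u"
begin

abbreviation "fat_point \<equiv> ideal_pow (point_ideal z (a u)) (n + 1)"
abbreviation "whole \<equiv> \<Inter>v\<in>A. I v"
abbreviation "fattened \<equiv> \<Inter>v\<in>A. (I(u := fat_point)) v"

lemma homogeneous: "v \<in> A \<Longrightarrow> homogeneous_ideal (I v)"
  using punctual punctualD(1) by blast

lemma homogeneous_whole: "homogeneous_ideal whole"
  by (rule homogeneous_ideal_Inter [OF homogeneous])

lemma homogeneous_fat_point: "homogeneous_ideal fat_point"
  by (rule homogeneous_point_pow)

lemma punctual_fattened: "v \<in> A \<Longrightarrow> punctual z (a v) ((I(u := fat_point)) v)"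
  by (cases "v = u") (use punctual_point_pow [of "a u" z] normalised [OF u] punctual in \<open>auto simp del: ideal_pow.simps\<close>)

lemma fattened_subset: "fattened \<subseteq> I u"
  using point_pow u by (auto split: if_splits)

lemma homogeneous_fattened: "homogeneous_ideal fattened" and regular_fattened: "regular_mod (var z) fattened"
  using punctual_Inter [of A z a "I(u := fat_point)"] punctual_fattened by blast+

lemma regular_whole: "regular_mod (var z) whole"
  using punctual_Inter [of A z a I] punctual by blast

lemma perp_subset_inter: "perp i (I u) \<subseteq> perp i whole \<inter> perp i fat_point"
proof -
  have "whole \<subseteq> I u" using u by blast
  then show ?thesis using perp_antimono [of whole "I u" i] perp_antimono [OF point_pow, of i] by blast
qed

text \<open>
  An element \<open>F\<close> of the intersection has a decomposition \<open>F = \<Sum>G\<^sub>v\<close> with \<open>G\<^sub>v \<in> perp i (I v)\<close>.  Then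
  \<open>(G\<^sub>u - F) + \<Sum>\<^bsub>v \<noteq> u\<^esub> G\<^sub>v = 0\<close> is a relation for the fattened family, whose inverse systems are
  independent in these degrees.  Hence \<open>F = G\<^sub>u\<close>.
\<close>

lemma perp_eq_inter_from_tau:
  assumes "tau fattened \<le> i"
  shows "perp i (I u) = perp i whole \<inter> perp i fat_point"
proof
  show "perp i whole \<inter> perp i fat_point \<subseteq> perp i (I u)"
  proof
    fix F assume F: "F \<in> perp i whole \<inter> perp i fat_point"
    have "perp i whole = subspace_sum A (\<lambda>v. perp i (I v))"
      by (rule perp_Inter [OF finite homogeneous])
    then obtain G where G: "F = (\<Sum>v\<in>A. G v)" "\<forall>v\<in>A. G v \<in> perp i (I v)"
      using F by (auto simp: subspace_sum_def)
    \<comment> \<open>The relation in the fattened family; its term at \<open>u\<close> annihilates the fat point.\<close>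
    let ?H = "G(u := G u - F)"
    have ind: "independent_family A (\<lambda>v. perp i ((I(u := fat_point)) v))"
      by (rule independent_perps_from_tau [OF finite normalised distinct punctual_fattened assms])
    have rest: "F = G u + (\<Sum>v\<in>A - {u}. G v)" using G(1) finite u by (simp add: sum.remove)
    have "(\<Sum>v\<in>A. ?H v) = ?H u + (\<Sum>v\<in>A - {u}. ?H v)" using finite u by (rule sum.remove)
    also have "(\<Sum>v\<in>A - {u}. ?H v) = (\<Sum>v\<in>A - {u}. G v)" by (intro sum.cong) auto
    finally have "(\<Sum>v\<in>A. ?H v) = 0" using rest by simp
    moreover have "?H v \<in> perp i ((I(u := fat_point)) v)" if "v \<in> A" for v
    proof (cases "v = u")
      case True
      have "G u \<in> perp i fat_point" using G(2) u perp_antimono [OF point_pow, of i] by blast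
      then show ?thesis using True F vs.subspace_diff [OF subspace_perp, of "G u" i fat_point F] by simp
    qed (use that G(2) in simp)
    ultimately have "?H u = 0" using independent_familyD [OF ind, of ?H u] u by blast
    then have "F = G u" by simp
    then show "F \<in> perp i (I u)" using G(2) u by simp
  qed
qed (rule perp_subset_inter)

text \<open>
  The inverse system of \<open>I u\<close> is contained in that of the fattened union, so contraction by \<open>z\<close> is
  injective on it from the same degree on.
\<close>

lemma hilb_from_tau_fattened:
  assumes "tau fattened \<le> i"
  shows "hilb (I u) i = scheme_degree (I u)"
proof (rule hilb_constant [OF punctualD [OF punctual [OF u]] _ assms])
  have ev: "eventually (\<lambda>i. hilb fattened i = (\<Sum>v\<in>A. scheme_degree ((I(u := fat_point)) v))) sequentially"
    by (rule eventually_hilb_Inter [OF finite normalised distinct punctual_fattened])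
  show "\<forall>j\<ge>tau fattened. var_injective z (I u) j"
    using var_injective_from_tau [OF homogeneous_fattened regular_fattened ev] perp_antimono [OF fattened_subset]
    unfolding var_injective_def by blast
qed

lemma dim_inter_from_tau:
  assumes "tau fattened \<le> i"
  shows "vs.dim (perp i whole \<inter> perp i fat_point) = scheme_degree (I u)"
  using perp_eq_inter_from_tau [OF assms] hilb_from_tau_fattened [OF assms] hilb_eq_dim_perp [OF homogeneous [OF u]]
  by simp

text \<open>
  Contraction by \<open>z\<close> maps the intersection in degree \<open>j + 1\<close> to the one in degree \<open>j\<close>, and it is
  injective on the inverse system of the fat point, because \<open>j \<ge> n\<close>.
\<close>

lemma dim_inter_decreasing:
  assumes "n \<le> i" "i \<le> j"
  shows "vs.dim (perp j whole \<inter> perp j fat_point) \<le> vs.dim (perp i whole \<inter> perp i fat_point)"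
  using assms(2)
proof (induction j rule: dec_induct)
  case (step j)
  let ?K = "\<lambda>j. perp j whole \<inter> perp j fat_point"
  obtain B :: "('v, 'a) mpoly set" where B: "finite B" "perp (Suc j) whole \<subseteq> vs.span B" using perp_finite_span by blast
  obtain C :: "('v, 'a) mpoly set" where C: "finite C" "perp j whole \<subseteq> vs.span C" using perp_finite_span by blast
  have "var_injective z fat_point j"
    using var_injective_high_degree [OF homogeneous_fat_point subset_refl] assms(1) step by simp
  then have "F = 0" if "F \<in> ?K (Suc j)" "contract (var z) F = 0" for F
    using that by (auto simp: var_injective_def)
  then have "vs.dim (?K (Suc j)) = vs.dim (contract (var z) ` ?K (Suc j))"
    using vs.dim_image_inj [OF linear_contract vs.subspace_inter [OF subspace_perp subspace_perp] _ B(1),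
        of "Suc j" whole "Suc j" fat_point "var z"] B(2) by fastforce
  also have "contract (var z) ` ?K (Suc j) \<subseteq> ?K j"
    using contract_in_perp [OF homogeneous_whole var_forms(1), of _ j z]
      contract_in_perp [OF homogeneous_fat_point var_forms(1), of _ j z] by auto
  then have "vs.dim (contract (var z) ` ?K (Suc j)) \<le> vs.dim (?K j)"
    using C by (intro vs.dim_subspace_mono [of _ _ C]) auto
  also note step.IH
  finally show ?case .
qed simp

text \<open>
  From degree \<open>j\<close> on the dimension of the intersection is at most the degree of the component.  But
  \<open>perp i (I u)\<close> is contained in the intersection and has this dimension, as \<open>i \<ge> n\<close>.
\<close>

lemma perp_eq_inter_if_dim:
  assumes "n \<le> j" "j \<le> i" and dim: "vs.dim (perp j whole \<inter> perp j fat_point) = scheme_degree (I u)"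
  shows "perp i (I u) = perp i whole \<inter> perp i fat_point"
proof -
  obtain B :: "('v, 'a) mpoly set" where B: "finite B" "perp i whole \<subseteq> vs.span B" using perp_finite_span by blast
  have "hilb (I u) i = scheme_degree (I u)"
    using assms by (intro punctual_hilb [OF punctual [OF u] point_pow]) simp
  then have "vs.dim (perp i whole \<inter> perp i fat_point) \<le> vs.dim (perp i (I u))"
    using dim_inter_decreasing [OF assms(1,2)] dim hilb_eq_dim_perp [OF homogeneous [OF u], of i] by simp
  then show ?thesis
    using B perp_subset_inter
    by (intro vs.subspace_eqI_dim [of _ _ B] subspace_perp vs.subspace_inter) auto
qed

text \<open>
  Up to degree \<open>n\<close> the fat point imposes no condition.  The equality holds in degree \<open>n\<close>, and it is
  carried down by contraction with powers of \<open>z\<close>, which is surjective on both sides.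
\<close>

lemma perp_eq_inter_if_dim_low_degree:
  assumes "i \<le> n" and dim: "vs.dim (perp n whole \<inter> perp n fat_point) = scheme_degree (I u)"
  shows "perp i (I u) = perp i whole \<inter> perp i fat_point"
proof -
  have all: "perp j fat_point = forms j" if "j \<le> n" for j
    using that by (intro perp_point_pow_low_degree) simp
  have "perp n (I u) = perp n whole"
    using perp_eq_inter_if_dim [OF order_refl order_refl dim] all [of n] perp_subset_forms [of n whole] by auto
  moreover have "contract (var z ^ (n - i)) ` perp n I' = perp i I'"
    if "homogeneous_ideal I'" "regular_mod (var z) I'" for I'
    using contract_perp_surj [OF that(1) var_power_forms regular_mod_power [OF that(2)], of "n - i" i]
      assms(1) by simp
  ultimately have "perp i (I u) = perp i whole"
    using homogeneous_whole regular_whole punctualD [OF punctual [OF u]] by metis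
  then show ?thesis using all [OF assms(1)] perp_subset_forms [of i whole] by auto
qed

end

text \<open>
  The codimension of \<open>I\<^sub>i\<close> is the dimension of its annihilator, so proper intersection means that the
  dimensions of the annihilators add up.
\<close>

lemma direct_sum_from_tau:
  fixes I :: "'i \<Rightarrow> ('v::finite, 'a::field) mpoly set"
  assumes fin: "finite A" and az: "\<And>u. u \<in> A \<Longrightarrow> a u z = 1" and inj: "inj_on a A"
    and I: "\<And>u. u \<in> A \<Longrightarrow> punctual z (a u) (I u)" and i: "tau (\<Inter>u\<in>A. I u) \<le> i"
  shows "is_direct_sum (perp i (\<Inter>u\<in>A. I u)) A (\<lambda>u. perp i (I u))"
    and "intersect_properly (forms i) A (\<lambda>u. I u \<inter> forms i)"
proof -
  have hom: "homogeneous_ideal (I u)" if "u \<in> A" for u using I [OF that] by (rule punctualD(1))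
  have ind: "independent_family A (\<lambda>u. perp i (I u))"
    by (rule independent_perps_from_tau [OF fin az inj I i])
  have "perp i (\<Inter>u\<in>A. I u) = subspace_sum A (\<lambda>u. perp i (I u))"
    by (rule perp_Inter [OF fin hom])
  then show "is_direct_sum (perp i (\<Inter>u\<in>A. I u)) A (\<lambda>u. perp i (I u))"
    using ind by (simp add: is_direct_sum_def independent_family_def)
  have "forms i \<inter> (\<Inter>u\<in>A. I u \<inter> forms i) = (\<Inter>u\<in>A. I u) \<inter> forms i" by blast
  then have "codim (forms i) (forms i \<inter> (\<Inter>u\<in>A. I u \<inter> forms i)) = hilb (\<Inter>u\<in>A. I u) i"
    by (simp add: hilb_def)
  also have "\<dots> = (\<Sum>u\<in>A. hilb (I u) i)"
    by (rule hilb_Inter_eq_sum [OF fin hom ind])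
  finally show "intersect_properly (forms i) A (\<lambda>u. I u \<inter> forms i)"
    by (simp add: intersect_properly_def hilb_def)
qed

theorem theorem2p29:
  fixes z :: "'v::finite"
    and k :: nat
    and a :: "nat \<Rightarrow> 'v \<Rightarrow> 'a::field"
    and I :: "nat \<Rightarrow> ('v, 'a) mpoly set"
    and s :: "nat \<Rightarrow> nat"
    and \<alpha> :: "nat \<Rightarrow> nat"
    and IZ :: "('v, 'a) mpoly set"
    and IZ' :: "nat \<Rightarrow> ('v, 'a) mpoly set"
    and L :: "('v, 'a) dpoly set"
    and Lu :: "nat \<Rightarrow> ('v, 'a) dpoly set"
  assumes points: "\<And>u. u \<in> {1..k} \<Longrightarrow> a u z = 1"
    and distinct: "inj_on a {1..k}"
    and schemes: "\<And>u. u \<in> {1..k} \<Longrightarrow> zero_dim_scheme (I u)"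
    and support: "\<And>u. u \<in> {1..k} \<Longrightarrow> concentrated_at (I u) z (a u)"
    and degrees: "\<And>u. u \<in> {1..k} \<Longrightarrow> scheme_degree (I u) = s u"
    and \<alpha>: "\<And>u. \<alpha> u = socle_degree (I u) z (a u)"
    and IZ: "IZ = (\<Inter>u\<in>{1..k}. I u)"
    and IZ': "\<And>u. IZ' u = saturation
           (ideal_pow (point_ideal z (a u)) (\<alpha> u + 1) \<inter> (\<Inter>v\<in>{1..k} - {u}. I v))"
    and L: "L = inverse_system IZ"
    and Lu: "\<And>u. Lu u = inverse_system (I u)"
    and char_socle: "\<And>u. u \<in> {1..k} \<Longrightarrow> admissible_degree TYPE('a) (\<alpha> u)"
    and char_tau: "\<And>u. u \<in> {1..k} \<Longrightarrow> admissible_degree TYPE('a) (tau (IZ' u))"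
  shows
    "L = subspace_sum {1..k} Lu \<and>
     (\<forall>i. i \<ge> regularity_degree IZ - 1 \<longrightarrow>
        is_direct_sum (L \<inter> forms i) {1..k} (\<lambda>u. Lu u \<inter> forms i) \<and>
        intersect_properly (forms i) {1..k} (\<lambda>u. I u \<inter> forms i)) \<and>
     (\<forall>u\<in>{1..k}.
        (\<forall>i. admissible_degree TYPE('a) i \<longrightarrow>
           Lu u \<inter> forms i \<subseteq> (L \<inter> forms i) \<inter> dp_linear_multiples (\<alpha> u) (a u) i) \<and>
        (\<forall>i. admissible_degree TYPE('a) i \<longrightarrow>
           i \<ge> (LEAST i. \<forall>j\<in>{i, max i (\<alpha> u)}.
                  vs.dim ((L \<inter> forms j) \<inter> dp_linear_multiples (\<alpha> u) (a u) j) = s u) \<longrightarrow>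
           Lu u \<inter> forms i = (L \<inter> forms i) \<inter> dp_linear_multiples (\<alpha> u) (a u) i) \<and>
        (\<forall>i. admissible_degree TYPE('a) i \<longrightarrow> i \<ge> tau (IZ' u) \<longrightarrow>
           Lu u \<inter> forms i = (L \<inter> forms i) \<inter> dp_linear_multiples (\<alpha> u) (a u) i) \<and>
        (\<forall>i j. i \<le> j \<longrightarrow> j \<ge> regularity_degree (I u) \<longrightarrow>
           Lu u \<inter> forms i =
             vs.span {contract h F | h F. h \<in> forms (j - i) \<and> F \<in> Lu u \<inter> forms j}))"
proof -
  have pun: "punctual z (a u) (I u)" if "u \<in> {1..k}" for u
    using punctual_if_concentrated schemes support that by blast
  have hom: "homogeneous_ideal (I u)" if "u \<in> {1..k}" for u
    using punctualD(1) pun that by blast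
  have Lf: "L \<inter> forms i = perp i IZ" and Luf: "Lu u \<inter> forms i = perp i (I u)" for i u
    by (simp_all add: L Lu inverse_system_forms)
  have "L = subspace_sum {1..k} Lu"
    unfolding L IZ Lu [abs_def] by (rule inverse_system_Inter [OF _ hom]) auto
  moreover have "is_direct_sum (L \<inter> forms i) {1..k} (\<lambda>u. Lu u \<inter> forms i) \<and>
      intersect_properly (forms i) {1..k} (\<lambda>u. I u \<inter> forms i)"
    if "i \<ge> regularity_degree IZ - 1" for i
    using direct_sum_from_tau [of "{1..k}" a z I i] points distinct pun that
    unfolding Lf Luf by (simp add: IZ regularity_degree_def)
  moreover have
    "(\<forall>i. admissible_degree TYPE('a) i \<longrightarrow>
        Lu u \<inter> forms i \<subseteq> (L \<inter> forms i) \<inter> dp_linear_multiples (\<alpha> u) (a u) i) \<and>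
     (\<forall>i. admissible_degree TYPE('a) i \<longrightarrow>
        i \<ge> (LEAST i. \<forall>j\<in>{i, max i (\<alpha> u)}.
               vs.dim ((L \<inter> forms j) \<inter> dp_linear_multiples (\<alpha> u) (a u) j) = s u) \<longrightarrow>
        Lu u \<inter> forms i = (L \<inter> forms i) \<inter> dp_linear_multiples (\<alpha> u) (a u) i) \<and>
     (\<forall>i. admissible_degree TYPE('a) i \<longrightarrow> i \<ge> tau (IZ' u) \<longrightarrow>
        Lu u \<inter> forms i = (L \<inter> forms i) \<inter> dp_linear_multiples (\<alpha> u) (a u) i) \<and>
     (\<forall>i j. i \<le> j \<longrightarrow> j \<ge> regularity_degree (I u) \<longrightarrow>
        Lu u \<inter> forms i =
          vs.span {contract h F | h F. h \<in> forms (j - i) \<and> F \<in> Lu u \<inter> forms j})"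
    (is "?sub \<and> ?least \<and> ?tau \<and> ?contr") if u: "u \<in> {1..k}" for u
  proof -
    interpret F: scheme_component z "{1..k}" a I u "\<alpha> u"
    proof
      show "ideal_pow (point_ideal z (a u)) (\<alpha> u + 1) \<subseteq> I u"
        unfolding \<alpha> by (rule point_pow_socle_degree) (use points pun support u in auto)
    qed (use points distinct pun u in auto)
    have "F.fattened = F.fat_point \<inter> (\<Inter>v\<in>{1..k} - {u}. I v)" using u by (auto split: if_splits)
    then have IZ'_eq: "IZ' u = F.fattened"
      using saturation_eq [OF homogeneous_idealD(1) [OF F.homogeneous_fattened] F.regular_fattened] by (simp add: IZ')
    have D: "(L \<inter> forms i) \<inter> dp_linear_multiples (\<alpha> u) (a u) i = perp i F.whole \<inter> perp i F.fat_point"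
      if "admissible_degree TYPE('a) i" for i
      using dp_linear_multiples_eq_perp [of "a u" z i "\<alpha> u"] points [OF u] that by (simp only: Lf IZ)
    have adm_mono: "admissible_degree TYPE('a) i" if "admissible_degree TYPE('a) j" "i \<le> j" for i j
      using that by (auto simp: admissible_degree_def)
    have ?sub
      using F.perp_subset_inter D by (simp add: Luf)
    moreover have ?tau
      using F.perp_eq_inter_from_tau D by (simp add: Luf IZ'_eq)
    moreover have ?least
    proof (intro allI impI)
      define Q where "Q i \<longleftrightarrow> (\<forall>j\<in>{i, max i (\<alpha> u)}.
        vs.dim ((L \<inter> forms j) \<inter> dp_linear_multiples (\<alpha> u) (a u) j) = s u)" for i
      fix i assume adm: "admissible_degree TYPE('a) i" and "(LEAST i. \<forall>j\<in>{i, max i (\<alpha> u)}.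
        vs.dim ((L \<inter> forms j) \<inter> dp_linear_multiples (\<alpha> u) (a u) j) = s u) \<le> i"
      then have le: "(LEAST i. Q i) \<le> i" by (simp add: Q_def)
      have "vs.dim ((L \<inter> forms j) \<inter> dp_linear_multiples (\<alpha> u) (a u) j) = s u"
        if "j \<in> {tau (IZ' u), max (tau (IZ' u)) (\<alpha> u)}" for j
      proof -
        have "admissible_degree TYPE('a) j"
          using that char_tau [OF u] char_socle [OF u] by (auto simp: max_def)
        then show ?thesis
          using D F.dim_inter_from_tau [of j] degrees [OF u] that by (auto simp: IZ'_eq)
      qed
      \<comment> \<open>The set of degrees in the minimum contains \<open>tau (IZ' u)\<close>, so it is not empty.\<close>
      then have "Q (tau (IZ' u))" by (simp add: Q_def)
      then have "Q (LEAST i. Q i)" by (rule LeastI)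
      then obtain i0 where i0: "i0 \<le> i" "Q i0" using le by blast
      let ?j = "max i0 (\<alpha> u)"
      have "?j \<le> max i (\<alpha> u)" using i0(1) by simp
      then have "admissible_degree TYPE('a) ?j"
        using adm char_socle [OF u] adm_mono by (metis max_def)
      then have dim: "vs.dim (perp ?j F.whole \<inter> perp ?j F.fat_point) = scheme_degree (I u)"
        using i0(2) D degrees [OF u] by (simp add: Q_def)
      have "perp i (I u) = perp i F.whole \<inter> perp i F.fat_point"
      proof (cases "\<alpha> u \<le> i")
        case True
        then show ?thesis using i0(1) by (intro F.perp_eq_inter_if_dim [OF _ _ dim]) auto
      next
        case False
        \<comment> \<open>Here the condition on the dimension in degree \<open>max i0 (\<alpha> u)\<close> is what is used.\<close>
        then have "?j = \<alpha> u" using i0(1) by simp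
        then show ?thesis using False dim by (intro F.perp_eq_inter_if_dim_low_degree) auto
      qed
      then show "Lu u \<inter> forms i = (L \<inter> forms i) \<inter> dp_linear_multiples (\<alpha> u) (a u) i"
        using D [OF adm] by (simp add: Luf)
    qed
    moreover have ?contr
      unfolding Luf using perp_eq_span_contractions punctualD [OF pun [OF u]] by blast
    ultimately show ?thesis by blast
  qed
  ultimately show ?thesis by blast
qed

end
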